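(* Let $I$ be a non-zero left ideal of $\mathcal{D}$, let $\{\alpha(1),\ldots,\alpha(s)\}$ be a $\delta$-stair of $I$, let $J=\prod_{i=1}^sC(\alpha(i);I)$ (an ideal of $\mathcal{H}$), and let $U=\mathrm{Spec}(\mathcal{H})\setminus V(J)$. If $\mathfrak{P}\in U$, then $\mathcal{D}_{\mathfrak{P}}/I_{\mathfrak{P}}$ is a free (and hence flat) $\mathcal{H}_{\mathfrak{P}}$-module.
   Context: $\mathbf{k}$ is a field of characteristic zero, $n\ge 1$, $m\ge 0$, and $\mathbf{k}((\tilde X))$ is the fraction field of the formal power series ring $\mathbf{k}[[x_1,\ldots,x_{n+m}]]$. $\mathcal{H}\subset \mathbf{k}((\tilde X))$ is a noetherian $\mathbf{k}$-subalgebra stable under the partial derivatives $\partial_1,\ldots,\partial_n$ (with respect to $x_1,\ldots,x_n$). It is also assumed to be effective: (1) for any finite subset $\{f_1,\ldots,f_r\}\subset\mathcal{H}$ and $f\in\mathcal{H}$ one can decide whether $f$ lies in the ideal generated by $f_1,\ldots,f_r$ and, if so, find $q_i\in\mathcal{H}$ with $f=\sum q_if_i$; (2) for any finite subset of $\mathcal{H}$ one can find a system of generators of its $\mathcal{H}$-module of syzygies. $\mathcal{D}=\mathcal{H}[\partial]=\mathcal{H}[\partial_1,\ldots,\partial_n]$ is the ring of linear differential operators generated by $\mathcal{H}$ and $\partial_1,\ldots,\partial_n$; its elements are the finite sums $\sum_{\alpha\in\mathbb{N}^n}p_\alpha\partial^\alpha$ with $p_\alpha\in\mathcal{H}$ (unique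 expression), $0\in\mathbb{N}$. Fix a (total) well-ordering $<$ on $\mathbb{N}^n$ compatible with the sum: $\alpha+\gamma<\beta+\gamma$ iff $\alpha<\beta$. For nonzero $P=\sum p_\alpha\partial^\alpha\in\mathcal{D}$, $\exp^\delta(P)=\max_<\{\alpha: p_\alpha\ne 0\}$ and $c^\delta(P)=p_{\exp^\delta(P)}\in\mathcal{H}$. For a non-zero left ideal $I$ of $\mathcal{D}$, $\mathrm{Exp}^\delta(I)=\{\exp^\delta(P):P\in I\setminus\{0\}\}$; a $\delta$-stair of $I$ is a finite subset $E\subseteq\mathrm{Exp}^\delta(I)$ with $\mathrm{Exp}^\delta(I)=\bigcup_{\alpha\in E}(\alpha+\mathbb{N}^n)$ (one exists by Dickson's Lemma). For $\alpha\in\mathbb{N}^n$, $C(\alpha;I)$ is the ideal of $\mathcal{H}$ generated by $\{c^\delta(P):P\in I\setminus\{0\},\ \alpha\in\exp^\delta(P)+\mathbb{N}^n\}$. For an ideal $\mathcal{K}$ of $\mathcal{H}$, $V(\mathcal{K})=\{\mathfrak{P}\in\mathrm{Spec}(\mathcal{H}):\mathcal{K}\subseteq\mathfrak{P}\}$. For $\mathfrak{P}\in\mathrm{Spec}(\mathcal{H})$ and $S=\mathcal{H}\setminus\mathfrak{P}$, $\mathcal{H}_{\mathfrak{P}}=S^{-1}\mathcal{H}\subset\mathbf{k}((\tilde X))$; $\mathcal{D}_{\mathfrak{P}}=S^{-1}\mathcal{D}$ is the subalgebra of $\mathbf{k}((\tilde X))[\partial_1,\ldots,\partial_n]$ generated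 by $\mathcal{H}_{\mathfrak{P}}$ and $\partial_1,\ldots,\partial_n$; and $I_{\mathfrak{P}}=S^{-1}I$ is the left ideal of $\mathcal{D}_{\mathfrak{P}}$ generated by $I$. Quotients are regarded as left modules. *)

theory Defs
  imports
    "HOL-Algebra.Algebraic_Closure_Type"
    "HOL-Algebra.Free_Abelian_Groups"
    "HOL-Algebra.Ideal_Product"
    "HOL-Algebra.Generated_Rings"
    "HOL-Computational_Algebra.Fraction_Field"
begin

section \<open>Formal power series in finitely many variables\<close>

typedef ('v, 'k) mps = "UNIV :: (('v \<Rightarrow>\<^sub>0 nat) \<Rightarrow> 'k) set"
  morphisms mps_coeff Mps
  by simp

setup_lifting type_definition_mps

lemma mps_eqI: "(\<And>\<alpha>. mps_coeff f \<alpha> = mps_coeff g \<alpha>) \<Longrightarrow> f = g"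
  by (metis mps_coeff_inject ext)

lemma finite_mexp_le:
  assumes "finite K"
  shows "finite {\<alpha> :: 'v \<Rightarrow>\<^sub>0 nat. Poly_Mapping.keys \<alpha> \<subseteq> K \<and> (\<forall>v. Poly_Mapping.lookup \<alpha> v \<le> N)}"
proof -
  let ?F = "{h. \<forall>v. (v \<in> K \<longrightarrow> h v \<in> {..N}) \<and> (v \<notin> K \<longrightarrow> h v = (0::nat))}"
  have "finite ?F"
    by (rule finite_set_of_finite_funs) (use assms in auto)
  moreover have "Poly_Mapping.lookup ` {\<alpha> :: 'v \<Rightarrow>\<^sub>0 nat. Poly_Mapping.keys \<alpha> \<subseteq> K \<and> (\<forall>v. Poly_Mapping.lookup \<alpha> v \<le> N)} \<subseteq> ?F"
    by (auto simp: in_keys_iff)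
  ultimately show ?thesis
    by (meson finite_imageD finite_subset inj_onI lookup_inject)
qed

lemma finite_mexp_splits: "finite {(\<alpha>, \<beta>). \<alpha> + \<beta> = (\<gamma> :: 'v \<Rightarrow>\<^sub>0 nat)}"
proof -
  let ?N = "\<Sum>v\<in>Poly_Mapping.keys \<gamma>. Poly_Mapping.lookup \<gamma> v"
  let ?A = "{\<alpha>. Poly_Mapping.keys \<alpha> \<subseteq> Poly_Mapping.keys \<gamma> \<and> (\<forall>v. Poly_Mapping.lookup \<alpha> v \<le> ?N)}"
  have le: "Poly_Mapping.lookup \<gamma> v \<le> ?N" for v
    by (cases "v \<in> Poly_Mapping.keys \<gamma>") (auto simp: in_keys_iff intro: member_le_sum)
  have mem: "\<alpha> \<in> ?A" if "\<alpha> + \<beta> = \<gamma>" for \<alpha> \<beta>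
  proof -
    have eq: "Poly_Mapping.lookup \<gamma> v = Poly_Mapping.lookup \<alpha> v + Poly_Mapping.lookup \<beta> v" for v
      using that by (auto simp: lookup_add)
    have "Poly_Mapping.lookup \<alpha> v \<le> ?N" for v
      using le[of v] by (simp only: eq)
    moreover have "Poly_Mapping.keys \<alpha> \<subseteq> Poly_Mapping.keys \<gamma>"
      by (auto simp: in_keys_iff eq)
    ultimately show ?thesis by blast
  qed
  have "{(\<alpha>, \<beta>). \<alpha> + \<beta> = \<gamma>} \<subseteq> ?A \<times> ?A"
    using mem by (auto, (metis add.commute subsetD le)+)
  moreover have "finite ?A"
    by (rule finite_mexp_le) simp
  ultimately show ?thesis
    by (meson finite_SigmaI finite_subset)
qed

instantiation mps :: (type, comm_ring_1) comm_ring_1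
begin

lift_definition zero_mps :: "('a, 'b) mps" is "\<lambda>_. 0" .
lift_definition one_mps :: "('a, 'b) mps" is "\<lambda>\<alpha>. if \<alpha> = 0 then 1 else 0" .
lift_definition plus_mps :: "('a, 'b) mps \<Rightarrow> ('a, 'b) mps \<Rightarrow> ('a, 'b) mps"
  is "\<lambda>f g \<alpha>. f \<alpha> + g \<alpha>" .
lift_definition minus_mps :: "('a, 'b) mps \<Rightarrow> ('a, 'b) mps \<Rightarrow> ('a, 'b) mps"
  is "\<lambda>f g \<alpha>. f \<alpha> - g \<alpha>" .
lift_definition uminus_mps :: "('a, 'b) mps \<Rightarrow> ('a, 'b) mps"
  is "\<lambda>f \<alpha>. - f \<alpha>" .
lift_definition times_mps :: "('a, 'b) mps \<Rightarrow> ('a, 'b) mps \<Rightarrow> ('a, 'b) mps"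
  is "\<lambda>f g \<gamma>. \<Sum>(\<alpha>, \<beta>) | \<alpha> + \<beta> = \<gamma>. f \<alpha> * g \<beta>" .

instance
proof
  fix f g h :: "('a, 'b) mps"
  have comm: "f * g = g * f" for f g :: "('a, 'b) mps"
  proof (transfer, rule ext)
    fix f g :: "('a \<Rightarrow>\<^sub>0 nat) \<Rightarrow> 'b" and \<gamma> :: "'a \<Rightarrow>\<^sub>0 nat"
    show "(\<Sum>(\<alpha>, \<beta>) | \<alpha> + \<beta> = \<gamma>. f \<alpha> * g \<beta>) = (\<Sum>(\<alpha>, \<beta>) | \<alpha> + \<beta> = \<gamma>. g \<alpha> * f \<beta>)"
      by (rule sum.reindex_bij_witness[of _ prod.swap prod.swap]) (auto simp: ac_simps)
  qed
  show "f * g = g * f" by (rule comm)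
  show "f * g * h = f * (g * h)"
  proof (transfer, rule ext)
    fix f g h :: "('a \<Rightarrow>\<^sub>0 nat) \<Rightarrow> 'b" and \<gamma> :: "'a \<Rightarrow>\<^sub>0 nat"
    let ?S = "\<lambda>\<gamma> :: 'a \<Rightarrow>\<^sub>0 nat. {(\<alpha>, \<beta>). \<alpha> + \<beta> = \<gamma>}"
    have "(\<Sum>(\<alpha>, \<beta>)\<in>?S \<gamma>. (\<Sum>(\<delta>, \<epsilon>)\<in>?S \<alpha>. f \<delta> * g \<epsilon>) * h \<beta>)
        = (\<Sum>x\<in>?S \<gamma>. \<Sum>y\<in>?S (fst x). f (fst y) * g (snd y) * h (snd x))"
      by (simp add: case_prod_unfold sum_distrib_right)
    also have "\<dots> = (\<Sum>(x, y)\<in>Sigma (?S \<gamma>) (\<lambda>x. ?S (fst x)). f (fst y) * g (snd y) * h (snd x))"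
      by (rule sum.Sigma) (use finite_mexp_splits in auto)
    also have "\<dots> = (\<Sum>(x, y)\<in>Sigma (?S \<gamma>) (\<lambda>x. ?S (snd x)). f (fst x) * (g (fst y) * h (snd y)))"
      by (rule sum.reindex_bij_witness[of _
            "\<lambda>(x, y). ((fst x + fst y, snd y), (fst x, fst y))"
            "\<lambda>(x, y). ((fst y, snd y + snd x), (snd y, snd x))"])
        (auto simp: ac_simps)
    also have "\<dots> = (\<Sum>x\<in>?S \<gamma>. \<Sum>y\<in>?S (snd x). f (fst x) * (g (fst y) * h (snd y)))"
      by (rule sum.Sigma[symmetric]) (use finite_mexp_splits in auto)
    also have "\<dots> = (\<Sum>(\<alpha>, \<beta>)\<in>?S \<gamma>. f \<alpha> * (\<Sum>(\<delta>, \<epsilon>)\<in>?S \<beta>. g \<delta> * h \<epsilon>))"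
      by (simp add: case_prod_unfold sum_distrib_left)
    finally show "(\<Sum>(\<alpha>, \<beta>)\<in>?S \<gamma>. (\<Sum>(\<delta>, \<epsilon>)\<in>?S \<alpha>. f \<delta> * g \<epsilon>) * h \<beta>)
        = (\<Sum>(\<alpha>, \<beta>)\<in>?S \<gamma>. f \<alpha> * (\<Sum>(\<delta>, \<epsilon>)\<in>?S \<beta>. g \<delta> * h \<epsilon>))" .
  qed
  show "1 * f = f"
  proof (transfer, rule ext)
    fix f :: "('a \<Rightarrow>\<^sub>0 nat) \<Rightarrow> 'b" and \<gamma> :: "'a \<Rightarrow>\<^sub>0 nat"
    have "{(\<alpha>, \<beta>). \<alpha> + \<beta> = \<gamma>} = insert (0, \<gamma>) ({(\<alpha>, \<beta>). \<alpha> + \<beta> = \<gamma>} - {(0, \<gamma>)})"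
      by auto
    also have "(\<Sum>(\<alpha>, \<beta>)\<in>\<dots>. (if \<alpha> = 0 then 1 else 0) * f \<beta>)
        = f \<gamma> + (\<Sum>(\<alpha>, \<beta>)\<in>{(\<alpha>, \<beta>). \<alpha> + \<beta> = \<gamma>} - {(0, \<gamma>)}. (if \<alpha> = 0 then 1 else 0) * f \<beta>)"
      by (subst sum.insert) (simp_all add: finite_mexp_splits)
    also have "(\<Sum>(\<alpha>, \<beta>)\<in>{(\<alpha>, \<beta>). \<alpha> + \<beta> = \<gamma>} - {(0, \<gamma>)}. (if \<alpha> = 0 then 1 else 0) * f \<beta>) = 0"
      by (rule sum.neutral) (auto split: if_splits)
    finally show "(\<Sum>(\<alpha>, \<beta>) | \<alpha> + \<beta> = \<gamma>. (if \<alpha> = 0 then 1 else 0) * f \<beta>) = f \<gamma>"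
      by simp
  qed
  show "(f + g) * h = f * h + g * h"
    by transfer (auto simp: fun_eq_iff case_prod_unfold distrib_right sum.distrib)
  show "f + g + h = f + (g + h)" by transfer (auto simp: ac_simps)
  show "f + g = g + f" by transfer (auto simp: ac_simps)
  show "0 + f = f" by transfer auto
  show "- f + f = 0" by transfer auto
  show "f - g = f + - g" by transfer auto
  show "(0 :: ('a, 'b) mps) \<noteq> 1" 
  proof
    assume "(0 :: ('a, 'b) mps) = 1"
    then have "mps_coeff (0 :: ('a, 'b) mps) 0 = mps_coeff 1 0" by simp
    then show False by (simp add: zero_mps.rep_eq one_mps.rep_eq)
  qed
qed

end

lemma mps_coeff_simps [simp]:
  "mps_coeff 0 \<alpha> = 0"
  "mps_coeff 1 \<alpha> = (if \<alpha> = 0 then 1 else 0)"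
  "mps_coeff (f + g) \<alpha> = mps_coeff f \<alpha> + mps_coeff g \<alpha>"
  "mps_coeff (f - g) \<alpha> = mps_coeff f \<alpha> - mps_coeff g \<alpha>"
  "mps_coeff (- f) \<alpha> = - mps_coeff f \<alpha>"
  by (simp_all only: zero_mps.rep_eq one_mps.rep_eq plus_mps.rep_eq minus_mps.rep_eq uminus_mps.rep_eq)

lemma mps_coeff_times:
  "mps_coeff (f * g) \<gamma> = (\<Sum>(\<alpha>, \<beta>) | \<alpha> + \<beta> = \<gamma>. mps_coeff f \<alpha> * mps_coeff g \<beta>)"
  by (simp only: times_mps.rep_eq)

instance mps :: (finite, idom) idom
proof
  fix f g :: "('a, 'b) mps"
  assume fg: "f \<noteq> 0" "g \<noteq> 0"
  define deg where "deg = (\<lambda>\<alpha> :: 'a \<Rightarrow>\<^sub>0 nat. \<Sum>v\<in>UNIV. Poly_Mapping.lookup \<alpha> v)"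
  obtain e :: "'a \<Rightarrow> nat" where e: "inj e"
    using finite_imp_inj_to_nat_seg[OF finite_UNIV] by metis
  define M where "M = (\<lambda>\<alpha> :: 'a \<Rightarrow>\<^sub>0 nat. \<Sum>v\<in>UNIV. Poly_Mapping.single (e v) (Poly_Mapping.lookup \<alpha> v))"
  have M_lookup: "Poly_Mapping.lookup (M \<alpha>) (e v) = Poly_Mapping.lookup \<alpha> v" for \<alpha> v
  proof -
    have "Poly_Mapping.lookup (M \<alpha>) (e v)
        = (\<Sum>u\<in>UNIV. if u = v then Poly_Mapping.lookup \<alpha> v else 0)"
      unfolding M_def lookup_sum
      by (rule sum.cong) (use e in \<open>auto simp: lookup_single when_def inj_eq\<close>)
    then show ?thesis by simp
  qed
  have M_inj: "M \<alpha> = M \<beta> \<Longrightarrow> \<alpha> = \<beta>" for \<alpha> \<beta>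
    by (metis M_lookup poly_mapping_eqI)
  have M_add: "M (\<alpha> + \<beta>) = M \<alpha> + M \<beta>" for \<alpha> \<beta>
    unfolding M_def by (simp add: lookup_add single_add sum.distrib)
  have deg_add: "deg (\<alpha> + \<beta>) = deg \<alpha> + deg \<beta>" for \<alpha> \<beta>
    by (simp add: deg_def lookup_add sum.distrib)
  have fin: "finite {\<alpha>. deg \<alpha> = d}" for d
  proof (rule finite_subset[OF _ finite_mexp_le[OF finite_UNIV, of d]])
    have "Poly_Mapping.lookup \<alpha> v \<le> deg \<alpha>" for \<alpha> v
      unfolding deg_def by (rule member_le_sum) auto
    then show "{\<alpha>. deg \<alpha> = d} \<subseteq> {\<alpha>. Poly_Mapping.keys \<alpha> \<subseteq> UNIV \<and> (\<forall>v. Poly_Mapping.lookup \<alpha> v \<le> d)}"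
      by auto
  qed
  have lead: "\<exists>a. mps_coeff h a \<noteq> 0 \<and> (\<forall>\<alpha>. mps_coeff h \<alpha> \<noteq> 0 \<longrightarrow> deg a \<le> deg \<alpha>)
      \<and> (\<forall>\<alpha>. mps_coeff h \<alpha> \<noteq> 0 \<and> deg \<alpha> = deg a \<longrightarrow> M \<alpha> \<le> M a)" if "h \<noteq> 0" for h :: "('a, 'b) mps"
  proof -
    obtain \<alpha>0 where "mps_coeff h \<alpha>0 \<noteq> 0"
      using \<open>h \<noteq> 0\<close> mps_eqI[of h 0] by auto
    then obtain a0 where a0: "mps_coeff h a0 \<noteq> 0" "\<And>\<alpha>. mps_coeff h \<alpha> \<noteq> 0 \<Longrightarrow> deg a0 \<le> deg \<alpha>"
      using ex_has_least_nat[of "\<lambda>\<alpha>. mps_coeff h \<alpha> \<noteq> 0" \<alpha>0 deg] by blast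
    let ?A = "{\<alpha>. mps_coeff h \<alpha> \<noteq> 0 \<and> deg \<alpha> = deg a0}"
    have finA: "finite (M ` ?A)"
      by (rule finite_imageI, rule finite_subset[OF _ fin[of "deg a0"]]) auto
    have "M ` ?A \<noteq> {}" using a0 by auto
    then have "Max (M ` ?A) \<in> M ` ?A" using finA by (rule Max_in[rotated])
    then obtain a where a: "a \<in> ?A" "M a = Max (M ` ?A)" by auto
    have "M \<alpha> \<le> M a" if "\<alpha> \<in> ?A" for \<alpha>
      unfolding a(2) using finA that by (intro Max_ge) auto
    with a a0 show ?thesis by (intro exI[of _ a]) auto
  qed
  obtain a where a: "mps_coeff f a \<noteq> 0" "\<And>\<alpha>. mps_coeff f \<alpha> \<noteq> 0 \<Longrightarrow> deg a \<le> deg \<alpha>"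
    "\<And>\<alpha>. mps_coeff f \<alpha> \<noteq> 0 \<Longrightarrow> deg \<alpha> = deg a \<Longrightarrow> M \<alpha> \<le> M a"
    using lead[OF fg(1)] by blast
  obtain b where b: "mps_coeff g b \<noteq> 0" "\<And>\<alpha>. mps_coeff g \<alpha> \<noteq> 0 \<Longrightarrow> deg b \<le> deg \<alpha>"
    "\<And>\<alpha>. mps_coeff g \<alpha> \<noteq> 0 \<Longrightarrow> deg \<alpha> = deg b \<Longrightarrow> M \<alpha> \<le> M b"
    using lead[OF fg(2)] by blast
  have uniq: "\<alpha> = a \<and> \<beta> = b"
    if "\<alpha> + \<beta> = a + b" "mps_coeff f \<alpha> \<noteq> 0" "mps_coeff g \<beta> \<noteq> 0" for \<alpha> \<beta>
  proof -
    have "deg \<alpha> + deg \<beta> = deg a + deg b" using that(1) deg_add by metis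
    with a(2)[OF that(2)] b(2)[OF that(3)] have "deg \<alpha> = deg a" "deg \<beta> = deg b" by linarith+
    then have le: "M \<alpha> \<le> M a" "M \<beta> \<le> M b" using a(3) b(3) that by auto
    have sum: "M \<alpha> + M \<beta> = M a + M b" using that(1) M_add by metis
    have "M \<alpha> = M a"
    proof (rule ccontr)
      assume "M \<alpha> \<noteq> M a"
      with le have "M \<alpha> + M \<beta> < M a + M b" by (intro add_less_le_mono) auto
      with sum show False by simp
    qed
    with sum have "M \<beta> = M b" by simp
    with \<open>M \<alpha> = M a\<close> show ?thesis using M_inj by blast
  qed
  have "mps_coeff (f * g) (a + b) = (\<Sum>(\<alpha>, \<beta>)\<in>{(a, b)}. mps_coeff f \<alpha> * mps_coeff g \<beta>)"
    unfolding mps_coeff_times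
    by (rule sum.mono_neutral_right) (use finite_mexp_splits uniq in auto)
  with a(1) b(1) show "f * g \<noteq> 0" by auto
qed

lift_definition mps_const :: "'k::zero \<Rightarrow> ('v, 'k) mps"
  is "\<lambda>c \<alpha>. if \<alpha> = 0 then c else 0" .

lift_definition mps_deriv :: "'v \<Rightarrow> ('v, 'k::comm_ring_1) mps \<Rightarrow> ('v, 'k) mps"
  is "\<lambda>i f \<alpha>. of_nat (Suc (Poly_Mapping.lookup \<alpha> i)) * f (\<alpha> + Poly_Mapping.single i 1)" .

lemma mps_coeff_deriv:
  "mps_coeff (mps_deriv i f) \<alpha>
     = of_nat (Suc (Poly_Mapping.lookup \<alpha> i)) * mps_coeff f (\<alpha> + Poly_Mapping.single i 1)"
  by (simp only: mps_deriv.rep_eq)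

lemma mps_deriv_add: "mps_deriv i (f + g) = mps_deriv i f + mps_deriv i g"
  by (rule mps_eqI) (simp add: mps_coeff_deriv distrib_left right_diff_distrib del: of_nat_Suc)

lemma mps_deriv_minus: "mps_deriv i (- f) = - mps_deriv i f"
  by (rule mps_eqI) (simp add: mps_coeff_deriv distrib_left right_diff_distrib del: of_nat_Suc)

lemma mps_deriv_diff: "mps_deriv i (f - g) = mps_deriv i f - mps_deriv i g"
  by (rule mps_eqI) (simp add: mps_coeff_deriv distrib_left right_diff_distrib del: of_nat_Suc)

lemma mps_deriv_0 [simp]: "mps_deriv i 0 = 0"
  by (rule mps_eqI) (simp add: mps_coeff_deriv)

lemma mps_deriv_commute: "mps_deriv i (mps_deriv j f) = mps_deriv j (mps_deriv i f)"
proof (cases "i = j")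
  case False
  show ?thesis
  proof (rule mps_eqI)
    fix \<alpha> :: "'a \<Rightarrow>\<^sub>0 nat"
    have "\<alpha> + Poly_Mapping.single i 1 + Poly_Mapping.single j 1
        = \<alpha> + Poly_Mapping.single j 1 + Poly_Mapping.single i (1::nat)"
      by (metis add.assoc add.commute)
    then show "mps_coeff (mps_deriv i (mps_deriv j f)) \<alpha> = mps_coeff (mps_deriv j (mps_deriv i f)) \<alpha>"
      using False by (simp add: mps_coeff_deriv lookup_add lookup_single)
  qed
qed simp

lemma mps_deriv_mult: "mps_deriv i (f * g) = mps_deriv i f * g + f * mps_deriv i g"
proof (rule mps_eqI)
  fix \<gamma> :: "'a \<Rightarrow>\<^sub>0 nat"
  let ?e = "Poly_Mapping.single i (1::nat)"
  let ?l = "\<lambda>\<alpha>. Poly_Mapping.lookup \<alpha> i"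
  let ?S = "\<lambda>\<gamma> :: 'a \<Rightarrow>\<^sub>0 nat. {(\<alpha>, \<beta>). \<alpha> + \<beta> = \<gamma>}"
  have *: "(\<Sum>(\<alpha>, \<beta>)\<in>?S (\<gamma> + ?e). of_nat (?l \<alpha>) * mps_coeff f \<alpha> * mps_coeff g \<beta>)
      = mps_coeff (mps_deriv i f * g) \<gamma>" for f g :: "('a, 'b) mps"
  proof -
    have "(\<Sum>(\<alpha>, \<beta>)\<in>?S (\<gamma> + ?e). of_nat (?l \<alpha>) * mps_coeff f \<alpha> * mps_coeff g \<beta>)
        = (\<Sum>(\<alpha>, \<beta>)\<in>{(\<alpha>, \<beta>). \<alpha> + \<beta> = \<gamma> + ?e \<and> ?l \<alpha> \<noteq> 0}. of_nat (?l \<alpha>) * mps_coeff f \<alpha> * mps_coeff g \<beta>)"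
    proof (rule sum.mono_neutral_right)
      show "\<forall>x\<in>?S (\<gamma> + ?e) - {(\<alpha>, \<beta>). \<alpha> + \<beta> = \<gamma> + ?e \<and> ?l \<alpha> \<noteq> 0}.
          (case x of (\<alpha>, \<beta>) \<Rightarrow> of_nat (?l \<alpha>) * mps_coeff f \<alpha> * mps_coeff g \<beta>) = 0"
      proof (clarify, goal_cases)
        case (1 \<alpha> \<beta>)
        then have "?l \<alpha> \<noteq> 0" by (metis mult_zero_left of_nat_0)
        with 1 show ?case by auto
      qed
      show "finite (?S (\<gamma> + ?e))" by (rule finite_mexp_splits)
    qed auto
    also have "\<dots> = (\<Sum>(\<alpha>, \<beta>)\<in>?S \<gamma>. of_nat (Suc (?l \<alpha>)) * mps_coeff f (\<alpha> + ?e) * mps_coeff g \<beta>)"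
    proof (rule sum.reindex_bij_witness[of _ "\<lambda>(\<alpha>, \<beta>). (\<alpha> + ?e, \<beta>)" "\<lambda>(\<alpha>, \<beta>). (\<alpha> - ?e, \<beta>)"], goal_cases)
      case (1 x)
      obtain \<alpha> \<beta> where x: "x = (\<alpha>, \<beta>)" by force
      have "\<alpha> - ?e + ?e = \<alpha>"
        using 1 x by (intro poly_mapping_eqI) (auto simp: lookup_add lookup_minus lookup_single when_def)
      with x show ?case by simp
    next
      case (2 x)
      obtain \<alpha> \<beta> where x: "x = (\<alpha>, \<beta>)" by force
      have "\<alpha> - ?e + ?e = \<alpha>"
        using 2 x by (intro poly_mapping_eqI) (auto simp: lookup_add lookup_minus lookup_single when_def)
      with 2 x have "(\<alpha> - ?e + \<beta>) + ?e = \<gamma> + ?e" by (simp add: ac_simps)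
      with x show ?case by auto
    next
      case (5 x)
      obtain \<alpha> \<beta> where x: "x = (\<alpha>, \<beta>)" by force
      have *: "\<alpha> - ?e + ?e = \<alpha>"
        using 5 x by (intro poly_mapping_eqI) (auto simp: lookup_add lookup_minus lookup_single when_def)
      have "Suc (?l (\<alpha> - ?e)) = ?l \<alpha>"
        using arg_cong[OF *, of ?l] by (simp add: lookup_add)
      with x * show ?case by (simp del: of_nat_Suc)
    qed (auto simp: ac_simps lookup_add)
    finally show ?thesis
      by (simp add: mps_coeff_times mps_coeff_deriv)
  qed
  have split: "of_nat (Suc (?l \<gamma>)) = (of_nat (?l \<alpha>) + of_nat (?l \<beta>) :: 'b)" if "\<alpha> + \<beta> = \<gamma> + ?e" for \<alpha> \<beta>
  proof -
    have "?l \<alpha> + ?l \<beta> = Suc (?l \<gamma>)"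
      using arg_cong[OF that, of ?l] by (simp add: lookup_add)
    then show ?thesis by (metis of_nat_add)
  qed
  have "mps_coeff (mps_deriv i (f * g)) \<gamma>
      = (\<Sum>(\<alpha>, \<beta>)\<in>?S (\<gamma> + ?e). of_nat (Suc (?l \<gamma>)) * (mps_coeff f \<alpha> * mps_coeff g \<beta>))"
    by (simp only: mps_coeff_deriv mps_coeff_times sum_distrib_left case_prod_unfold)
  also have "\<dots> = (\<Sum>(\<alpha>, \<beta>)\<in>?S (\<gamma> + ?e). of_nat (?l \<alpha>) * mps_coeff f \<alpha> * mps_coeff g \<beta>
       + of_nat (?l \<beta>) * mps_coeff g \<beta> * mps_coeff f \<alpha>)"
  proof (intro sum.cong refl, clarify)
    fix \<alpha> \<beta> :: "'a \<Rightarrow>\<^sub>0 nat"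
    assume "\<alpha> + \<beta> = \<gamma> + ?e"
    from split[OF this] show "of_nat (Suc (?l \<gamma>)) * (mps_coeff f \<alpha> * mps_coeff g \<beta>)
      = of_nat (?l \<alpha>) * mps_coeff f \<alpha> * mps_coeff g \<beta> + of_nat (?l \<beta>) * mps_coeff g \<beta> * mps_coeff f \<alpha>"
      by (simp add: algebra_simps del: of_nat_Suc)
  qed
  also have "\<dots> = (\<Sum>(\<alpha>, \<beta>)\<in>?S (\<gamma> + ?e). of_nat (?l \<alpha>) * mps_coeff f \<alpha> * mps_coeff g \<beta>)
       + (\<Sum>(\<alpha>, \<beta>)\<in>?S (\<gamma> + ?e). of_nat (?l \<beta>) * mps_coeff g \<beta> * mps_coeff f \<alpha>)"
    by (simp add: case_prod_unfold sum.distrib)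
  also have "(\<Sum>(\<alpha>, \<beta>)\<in>?S (\<gamma> + ?e). of_nat (?l \<beta>) * mps_coeff g \<beta> * mps_coeff f \<alpha>)
      = (\<Sum>(\<alpha>, \<beta>)\<in>?S (\<gamma> + ?e). of_nat (?l \<alpha>) * mps_coeff g \<alpha> * mps_coeff f \<beta>)"
    by (rule sum.reindex_bij_witness[of _ prod.swap prod.swap]) (auto simp: ac_simps)
  finally show "mps_coeff (mps_deriv i (f * g)) \<gamma> = mps_coeff (mps_deriv i f * g + f * mps_deriv i g) \<gamma>"
    by (simp only: * mps_coeff_simps mult.commute[of f "mps_deriv i g"])
qed


section \<open>The field of fractions and its derivations\<close>

definition pd :: "'v::finite \<Rightarrow> ('v, 'k::idom) mps fract \<Rightarrow> ('v, 'k) mps fract"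
  where "pd i q = (THE r. \<exists>a b. b \<noteq> 0 \<and> q = Fract a b
           \<and> r = Fract (mps_deriv i a * b - a * mps_deriv i b) (b * b))"

lemma pd_Fract:
  assumes "b \<noteq> 0"
  shows "pd i (Fract a b) = Fract (mps_deriv i a * b - a * mps_deriv i b) (b * b)"
proof -
  have "Fract (mps_deriv i c * d - c * mps_deriv i d) (d * d)
      = Fract (mps_deriv i a * b - a * mps_deriv i b) (b * b)"
    if "d \<noteq> 0" "Fract a b = Fract c d" for c d
  proof -
    have ad: "a * d = c * b"
      using that assms by (simp add: eq_fract)
    then have "mps_deriv i a * d + a * mps_deriv i d = mps_deriv i c * b + c * mps_deriv i b"
      by (metis mps_deriv_mult)
    then have e: "mps_deriv i a * d = mps_deriv i c * b + c * mps_deriv i b - a * mps_deriv i d"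
      by (simp add: algebra_simps)
    have "(mps_deriv i a * b - a * mps_deriv i b) * (d * d)
        = (mps_deriv i a * d) * (b * d) - (a * d) * (mps_deriv i b * d)"
      by (simp add: algebra_simps)
    also have "\<dots> = mps_deriv i c * b * (b * d) + c * mps_deriv i b * b * d
        - (a * d) * (mps_deriv i d * b) - (a * d) * (mps_deriv i b * d)"
      unfolding e by (simp add: algebra_simps)
    also have "\<dots> = (mps_deriv i c * d - c * mps_deriv i d) * (b * b)"
      unfolding ad by (simp add: algebra_simps)
    finally show ?thesis
      using that assms by (simp add: eq_fract)
  qed
  note * = this
  show ?thesis
    unfolding pd_def
  proof (rule the_equality)
    show "\<exists>a' b'. b' \<noteq> 0 \<and> Fract a b = Fract a' b'
      \<and> Fract (mps_deriv i a * b - a * mps_deriv i b) (b * b)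
        = Fract (mps_deriv i a' * b' - a' * mps_deriv i b') (b' * b')"
      using assms by blast
  next
    fix r
    assume "\<exists>a' b'. b' \<noteq> 0 \<and> Fract a b = Fract a' b'
      \<and> r = Fract (mps_deriv i a' * b' - a' * mps_deriv i b') (b' * b')"
    then obtain c d where cd: "d \<noteq> 0" "Fract a b = Fract c d"
      and r: "r = Fract (mps_deriv i c * d - c * mps_deriv i d) (d * d)"
      by blast
    show "r = Fract (mps_deriv i a * b - a * mps_deriv i b) (b * b)"
      unfolding r by (rule *[OF cd])
  qed
qed

lemma pd_add: "pd i (f + g) = pd i f + pd i g"
proof -
  obtain a b where f: "f = Fract a b" "b \<noteq> 0" by (cases f)
  obtain c d where g: "g = Fract c d" "d \<noteq> 0" by (cases g)
  show ?thesis
    using f(2) g(2) unfolding f(1) g(1)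
    by (simp add: pd_Fract eq_fract mps_deriv_mult mps_deriv_add) (simp add: algebra_simps)
qed

lemma pd_mult: "pd i (f * g) = pd i f * g + f * pd i g"
proof -
  obtain a b where f: "f = Fract a b" "b \<noteq> 0" by (cases f)
  obtain c d where g: "g = Fract c d" "d \<noteq> 0" by (cases g)
  let ?D = "mps_deriv i"
  have "pd i f * g + f * pd i g
      = Fract ((?D a * b - a * ?D b) * c) (b * b * d) + Fract (a * (?D c * d - c * ?D d)) (b * (d * d))"
    by (simp only: f(1) g(1) pd_Fract[OF f(2)] pd_Fract[OF g(2)] mult_fract)
  also have "Fract ((?D a * b - a * ?D b) * c) (b * b * d) = Fract (d * ((?D a * b - a * ?D b) * c)) ((b * d) * (b * d))"
    using f(2) g(2) by (simp add: eq_fract)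
  also have "Fract (a * (?D c * d - c * ?D d)) (b * (d * d)) = Fract (b * (a * (?D c * d - c * ?D d))) ((b * d) * (b * d))"
    using f(2) g(2) by (simp add: eq_fract)
  also have "Fract (d * ((?D a * b - a * ?D b) * c)) ((b * d) * (b * d))
        + Fract (b * (a * (?D c * d - c * ?D d))) ((b * d) * (b * d))
      = Fract (d * ((?D a * b - a * ?D b) * c) + b * (a * (?D c * d - c * ?D d))) ((b * d) * (b * d))"
    using f(2) g(2) by (simp add: eq_fract) (simp only: distrib_right mult.assoc)
  also have "d * ((?D a * b - a * ?D b) * c) + b * (a * (?D c * d - c * ?D d))
      = ?D (a * c) * (b * d) - (a * c) * ?D (b * d)"
    by (simp add: mps_deriv_mult algebra_simps)
  also have "Fract (?D (a * c) * (b * d) - (a * c) * ?D (b * d)) ((b * d) * (b * d)) = pd i (f * g)"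
    using f(2) g(2) by (simp only: f(1) g(1) pd_Fract mult_fract mult_eq_0_iff simp_thms)
  finally show ?thesis by simp
qed

lemma pd_commute: "pd i (pd j f) = pd j (pd i f)"
proof -
  obtain a b where f: "f = Fract a b" "b \<noteq> 0" by (cases f)
  let ?N = "\<lambda>i j. mps_deriv i (mps_deriv j a * b - a * mps_deriv j b) * (b * b)
      - (mps_deriv j a * b - a * mps_deriv j b) * mps_deriv i (b * b)"
  have "pd i (pd j f) = Fract (?N i j) (b * b * (b * b))" for i j
    using f(2) by (simp only: f(1) pd_Fract mult_eq_0_iff simp_thms)
  moreover have "?N i j = ?N j i"
  proof -
    have "(aij * b + aj * bi - (ai * bj + a * bij)) * (b * b) - (aj * b - a * bj) * (bi * b + b * bi)
        = (aij * b + ai * bj - (aj * bi + a * bij)) * (b * b) - (ai * b - a * bi) * (bj * b + b * bj)"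
      for a b ai aj bi bj aij bij :: "('a, 'b) mps"
      by (simp add: algebra_simps)
    then show ?thesis
      by (simp only: mps_deriv_mult mps_deriv_diff mps_deriv_commute[of j i])
  qed
  ultimately show ?thesis by simp
qed

definition kconst :: "'k::idom \<Rightarrow> ('v::finite, 'k) mps fract"
  where "kconst c = Fract (mps_const c) 1"

text \<open>
  The derivations in use are \<open>pd (\<iota> i)\<close> for \<open>i :: 'n\<close>, where the injection \<open>\<iota> :: 'n \<Rightarrow> 'v\<close>
  selects \<open>n = CARD('n) \<ge> 1\<close> of the \<open>n + m = CARD('v)\<close> variables; exponents of differential
  operators live in \<open>'n \<Rightarrow>\<^sub>0 nat\<close>.
\<close>

definition pd_pow :: "('n::finite \<Rightarrow> 'v::finite) \<Rightarrow> ('n \<Rightarrow>\<^sub>0 nat)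
    \<Rightarrow> ('v, 'k::idom) mps fract \<Rightarrow> ('v, 'k) mps fract"
  where "pd_pow \<iota> \<alpha> f = Finite_Set.fold (\<lambda>i. pd (\<iota> i) ^^ Poly_Mapping.lookup \<alpha> i) f UNIV"

lemma pd_funpow_commute: "(pd i ^^ k) ((pd j ^^ l) f) = (pd j ^^ l) ((pd i ^^ k) f)"
proof -
  have *: "pd i ((pd j ^^ l) f) = (pd j ^^ l) (pd i f)" for f
  proof (induction l)
    case (Suc l)
    then show ?case by (simp only: funpow.simps comp_apply pd_commute[of i j])
  qed simp
  show ?thesis
  proof (induction k)
    case (Suc k)
    then show ?case by (simp only: funpow.simps comp_apply *)
  qed simp
qed

lemma pd_pow_comp_fun_commute:
  "comp_fun_commute (\<lambda>i. pd (\<iota> i) ^^ Poly_Mapping.lookup \<alpha> i)"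
  by standard (rule ext, simp only: comp_apply, rule pd_funpow_commute)


section \<open>Linear differential operators\<close>

definition additive_End :: "('a::comm_ring_1 \<Rightarrow> 'a) ring"
  where "additive_End = \<lparr>carrier = {T. Modules.additive T}, monoid.mult = (\<lambda>S T. S \<circ> T), one = id,
           ring.zero = (\<lambda>_. 0), add = (\<lambda>S T f. S f + T f)\<rparr>"

lemma ring_additive_End: "ring (additive_End :: ('a::comm_ring_1 \<Rightarrow> 'a) ring)"
proof (rule ringI)
  show "abelian_group (additive_End :: ('a \<Rightarrow> 'a) ring)"
  proof (rule abelian_groupI)
    fix S :: "'a \<Rightarrow> 'a"
    assume "S \<in> carrier additive_End"
    then show "\<exists>T\<in>carrier additive_End. T \<oplus>\<^bsub>additive_End\<^esub> S = \<zero>\<^bsub>additive_End\<^esub>"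
      by (intro bexI[of _ "\<lambda>f. - S f"]) (auto simp: additive_End_def Modules.additive_def)
  qed (auto simp: additive_End_def Modules.additive_def algebra_simps)
  show "monoid (additive_End :: ('a \<Rightarrow> 'a) ring)"
    by (rule monoidI) (auto simp: additive_End_def Modules.additive_def fun_eq_iff)
qed (auto simp: additive_End_def Modules.additive_def fun_eq_iff)

definition mult_op :: "'a::comm_ring_1 \<Rightarrow> 'a \<Rightarrow> 'a"
  where "mult_op h = (\<lambda>f. h * f)"

text \<open>
  \<open>A[\<partial>\<^sub>1, \<dots>, \<partial>\<^sub>n]\<close> is realized inside the additive endomorphisms of \<open>\<k>((X))\<close>, with composition as product.
\<close>

definition diff_ops :: "('n::finite \<Rightarrow> 'v::finite) \<Rightarrow> ('v, 'k::idom) mps fract set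
    \<Rightarrow> (('v, 'k) mps fract \<Rightarrow> ('v, 'k) mps fract) set"
  where "diff_ops \<iota> A = generate_ring additive_End (mult_op ` A \<union> range (\<lambda>i. pd (\<iota> i)))"

definition diff_ring :: "('n::finite \<Rightarrow> 'v::finite) \<Rightarrow> ('v, 'k::idom) mps fract set
    \<Rightarrow> (('v, 'k) mps fract \<Rightarrow> ('v, 'k) mps fract) ring"
  where "diff_ring \<iota> A = additive_End\<lparr>carrier := diff_ops \<iota> A\<rparr>"

text \<open>Normal form \<open>\<Sum>\<^sub>\<alpha> p\<^sub>\<alpha> \<partial>\<^sup>\<alpha>\<close>; it is unique in characteristic zero (lemma \<open>inj_normal_op\<close>).\<close>

definition normal_op :: "('n::finite \<Rightarrow> 'v::finite) \<Rightarrow> (('n \<Rightarrow>\<^sub>0 nat) \<Rightarrow>\<^sub>0 ('v, 'k::idom) mps fract)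
    \<Rightarrow> ('v, 'k) mps fract \<Rightarrow> ('v, 'k) mps fract"
  where "normal_op \<iota> p = (\<lambda>f. \<Sum>\<alpha>\<in>Poly_Mapping.keys p. Poly_Mapping.lookup p \<alpha> * pd_pow \<iota> \<alpha> f)"

definition op_coeffs :: "('n::finite \<Rightarrow> 'v::finite) \<Rightarrow> (('v, 'k::idom) mps fract \<Rightarrow> ('v, 'k) mps fract)
    \<Rightarrow> ('n \<Rightarrow>\<^sub>0 nat) \<Rightarrow>\<^sub>0 ('v, 'k) mps fract"
  where "op_coeffs \<iota> = the_inv (normal_op \<iota>)"


lemma pd_pow_Fract_1:
  assumes "inj \<iota>"
  shows "\<exists>a' c. pd_pow \<iota> \<alpha> (Fract a 1) = Fract a' 1 \<and> (\<forall>\<gamma>. (c \<gamma> :: nat) \<noteq> 0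
    \<and> mps_coeff a' \<gamma> = of_nat (c \<gamma>) * mps_coeff a (\<gamma> + (\<Sum>i\<in>UNIV. Poly_Mapping.single (\<iota> i) (Poly_Mapping.lookup \<alpha> i))))"
proof -
  interpret comp_fun_commute "\<lambda>i. pd (\<iota> i) ^^ Poly_Mapping.lookup \<alpha> i :: ('b, 'c) mps fract \<Rightarrow> _"
    by (rule pd_pow_comp_fun_commute)
  let ?Q = "\<lambda>\<delta> a q. \<exists>a' c. q = Fract a' 1 \<and> (\<forall>\<gamma>. (c \<gamma> :: nat) \<noteq> 0
    \<and> mps_coeff a' \<gamma> = of_nat (c \<gamma>) * mps_coeff a (\<gamma> + \<delta>))"
  have step: "?Q (Poly_Mapping.single v 1 + \<delta>) a (pd v q)" if "?Q \<delta> a q"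
    for v \<delta> q and a :: "('b, 'c) mps"
  proof -
    obtain a' c where q: "q = Fract a' 1" "\<And>\<gamma>. c \<gamma> \<noteq> (0::nat)"
      "\<And>\<gamma>. mps_coeff a' \<gamma> = of_nat (c \<gamma>) * mps_coeff a (\<gamma> + \<delta>)"
      using \<open>?Q \<delta> a q\<close> by blast
    have "mps_deriv v (1 :: ('b, 'c) mps) = 0"
      by (metis mps_deriv_mult add_cancel_right_right mult_1 mult_1_right)
    then have "pd v q = Fract (mps_deriv v a') 1"
      by (simp add: q(1) pd_Fract)
    moreover have "mps_coeff (mps_deriv v a') \<gamma>
        = of_nat (Suc (Poly_Mapping.lookup \<gamma> v) * c (\<gamma> + Poly_Mapping.single v 1))
          * mps_coeff a (\<gamma> + (Poly_Mapping.single v 1 + \<delta>))" for \<gamma>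
      by (simp only: mps_coeff_deriv q(3) of_nat_mult mult.assoc add.assoc)
    ultimately show ?thesis
      using q(2)
      by (intro exI[of _ "mps_deriv v a'"]
          exI[of _ "\<lambda>\<gamma>. Suc (Poly_Mapping.lookup \<gamma> v) * c (\<gamma> + Poly_Mapping.single v 1)"] conjI) auto
  qed
  have steps: "?Q (Poly_Mapping.single v k + \<delta>) a ((pd v ^^ k) q)" if "?Q \<delta> a q"
    for v \<delta> q k and a :: "('b, 'c) mps"
  proof (induction k)
    case 0
    show ?case using that by simp
  next
    case (Suc k)
    have "Poly_Mapping.single v (1::nat) + (Poly_Mapping.single v k + \<delta>) = Poly_Mapping.single v (Suc k) + \<delta>"
      by (simp add: single_add[symmetric] add.assoc[symmetric])
    with step[OF Suc, of v] show ?case by simp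
  qed
  have "?Q (\<Sum>i\<in>A. Poly_Mapping.single (\<iota> i) (Poly_Mapping.lookup \<alpha> i)) a
      (Finite_Set.fold (\<lambda>i. pd (\<iota> i) ^^ Poly_Mapping.lookup \<alpha> i) (Fract a 1) A)" if "finite A" for A
    using that
  proof (induction A)
    case empty
    show ?case by (intro exI[of _ a] exI[of _ "\<lambda>_. 1"]) simp
  next
    case (insert i A)
    show ?case
      unfolding fold_insert[OF insert.hyps] sum.insert[OF insert.hyps]
      by (rule steps[OF insert.IH])
  qed
  from this[OF finite_UNIV] show ?thesis
    by (simp only: pd_pow_def)
qed

lemma normal_op_superset:
  assumes "finite S" "Poly_Mapping.keys p \<subseteq> S"
  shows "normal_op \<iota> p f = (\<Sum>\<alpha>\<in>S. Poly_Mapping.lookup p \<alpha> * pd_pow \<iota> \<alpha> f)"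
  unfolding normal_op_def
  by (rule sum.mono_neutral_left) (use assms in \<open>auto simp: in_keys_iff\<close>)

lemma inj_normal_op:
  fixes \<iota> :: "'n::finite \<Rightarrow> 'v::finite"
  assumes "inj \<iota>"
  shows "inj (normal_op \<iota> :: (('n \<Rightarrow>\<^sub>0 nat) \<Rightarrow>\<^sub>0 ('v, 'k::field_char_0) mps fract) \<Rightarrow> _)"
proof (rule injI, rule ccontr)
  fix p q :: "('n \<Rightarrow>\<^sub>0 nat) \<Rightarrow>\<^sub>0 ('v, 'k) mps fract"
  assume eq: "normal_op \<iota> p = normal_op \<iota> q" and "p \<noteq> q"
  define r where "r = p - q"
  have r0: "normal_op \<iota> r f = 0" for f
  proof -
    let ?S = "Poly_Mapping.keys p \<union> Poly_Mapping.keys q"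
    have "Poly_Mapping.keys r \<subseteq> ?S"
      by (auto simp: r_def in_keys_iff lookup_minus)
    then have "normal_op \<iota> r f = normal_op \<iota> p f - normal_op \<iota> q f"
      by (simp add: normal_op_superset[of ?S] r_def lookup_minus left_diff_distrib sum_subtractf)
    then show ?thesis by (simp add: eq)
  qed
  define emb where "emb = (\<lambda>\<alpha>. \<Sum>i\<in>UNIV. Poly_Mapping.single (\<iota> i) (Poly_Mapping.lookup \<alpha> i :: nat))"
  have emb: "Poly_Mapping.lookup (emb \<alpha>) (\<iota> i) = Poly_Mapping.lookup \<alpha> i" for \<alpha> i
  proof -
    have "Poly_Mapping.lookup (emb \<alpha>) (\<iota> i) = (\<Sum>j\<in>UNIV. if j = i then Poly_Mapping.lookup \<alpha> i else 0)"
      unfolding emb_def lookup_sum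
      by (rule sum.cong) (use assms in \<open>auto simp: lookup_single when_def inj_eq\<close>)
    then show ?thesis by simp
  qed
  define deg where "deg = (\<lambda>\<alpha> :: 'n \<Rightarrow>\<^sub>0 nat. \<Sum>i\<in>UNIV. Poly_Mapping.lookup \<alpha> i)"
  have "r \<noteq> 0" using \<open>p \<noteq> q\<close> by (simp add: r_def)
  then obtain \<alpha>0 where "\<alpha>0 \<in> Poly_Mapping.keys r"
    by (metis keys_eq_empty all_not_in_conv)
  then obtain \<beta> where \<beta>: "\<beta> \<in> Poly_Mapping.keys r" "\<And>\<alpha>. \<alpha> \<in> Poly_Mapping.keys r \<Longrightarrow> deg \<beta> \<le> deg \<alpha>"
    using ex_has_least_nat[of "\<lambda>\<alpha>. \<alpha> \<in> Poly_Mapping.keys r" \<alpha>0 deg] by blast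
  define a :: "('v, 'k) mps" where "a = Mps (\<lambda>\<alpha>. if \<alpha> = emb \<beta> then 1 else 0)"
  have a: "mps_coeff a \<alpha> = (if \<alpha> = emb \<beta> then 1 else 0)" for \<alpha>
    by (simp add: a_def Mps_inverse)
  have other: "pd_pow \<iota> \<alpha> (Fract a 1) = 0" if "\<alpha> \<in> Poly_Mapping.keys r" "\<alpha> \<noteq> \<beta>" for \<alpha>
  proof -
    obtain a' c where a': "pd_pow \<iota> \<alpha> (Fract a 1) = Fract a' 1"
      "\<And>\<gamma>. mps_coeff a' \<gamma> = of_nat (c \<gamma> :: nat) * mps_coeff a (\<gamma> + emb \<alpha>)"
      using pd_pow_Fract_1[OF assms, of \<alpha> a] unfolding emb_def by blast
    have "\<gamma> + emb \<alpha> \<noteq> emb \<beta>" for \<gamma>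
    proof
      assume g: "\<gamma> + emb \<alpha> = emb \<beta>"
      have le: "Poly_Mapping.lookup \<alpha> i \<le> Poly_Mapping.lookup \<beta> i" for i
        using arg_cong[OF g, of "\<lambda>x. Poly_Mapping.lookup x (\<iota> i)"] by (simp add: lookup_add emb)
      moreover obtain i where "Poly_Mapping.lookup \<alpha> i \<noteq> Poly_Mapping.lookup \<beta> i"
        using \<open>\<alpha> \<noteq> \<beta>\<close> by (meson poly_mapping_eqI)
      ultimately have "deg \<alpha> < deg \<beta>"
        unfolding deg_def by (intro sum_strict_mono_ex1) (auto intro!: exI[of _ i] le_neq_implies_less)
      with \<beta>(2)[OF that(1)] show False by simp
    qed
    then have "a' = 0" by (intro mps_eqI) (simp add: a'(2) a)
    then show ?thesis by (simp add: a'(1) Zero_fract_def)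
  qed
  have main: "pd_pow \<iota> \<beta> (Fract a 1) \<noteq> 0"
  proof -
    obtain a' c where a': "pd_pow \<iota> \<beta> (Fract a 1) = Fract a' 1" "\<And>\<gamma>. c \<gamma> \<noteq> 0"
      "\<And>\<gamma>. mps_coeff a' \<gamma> = of_nat (c \<gamma> :: nat) * mps_coeff a (\<gamma> + emb \<beta>)"
      using pd_pow_Fract_1[OF assms, of \<beta> a] unfolding emb_def by blast
    have "mps_coeff a' 0 \<noteq> 0" using a'(2) by (simp add: a'(3) a)
    then have "a' \<noteq> 0" by auto
    then show ?thesis by (simp add: a'(1) Zero_fract_def eq_fract)
  qed
  have "normal_op \<iota> r (Fract a 1) = Poly_Mapping.lookup r \<beta> * pd_pow \<iota> \<beta> (Fract a 1)"
    unfolding normal_op_def using \<beta>(1) other by (subst sum.remove[of _ \<beta>]) auto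
  with r0[of "Fract a 1"] main \<beta>(1) show False by (auto simp: in_keys_iff)
qed

lemma op_coeffs_normal_op:
  fixes p :: "('n::finite \<Rightarrow>\<^sub>0 nat) \<Rightarrow>\<^sub>0 ('v::finite, 'k::field_char_0) mps fract"
  shows "inj \<iota> \<Longrightarrow> op_coeffs \<iota> (normal_op \<iota> p) = p"
  unfolding op_coeffs_def by (rule the_inv_f_f[OF inj_normal_op])

text \<open>Below, \<open>lt\<close> is the strict order on \<open>\<nat>\<^sup>n\<close>.\<close>

definition delta_exp :: "('n::finite \<Rightarrow> 'v::finite) \<Rightarrow> (('n \<Rightarrow>\<^sub>0 nat) \<Rightarrow> ('n \<Rightarrow>\<^sub>0 nat) \<Rightarrow> bool)
    \<Rightarrow> (('v, 'k::idom) mps fract \<Rightarrow> ('v, 'k) mps fract) \<Rightarrow> ('n \<Rightarrow>\<^sub>0 nat)"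
  where "delta_exp \<iota> lt P
    = linorder.Max (\<lambda>\<alpha> \<beta>. lt \<alpha> \<beta> \<or> \<alpha> = \<beta>) (Poly_Mapping.keys (op_coeffs \<iota> P))"

definition delta_lc :: "('n::finite \<Rightarrow> 'v::finite) \<Rightarrow> (('n \<Rightarrow>\<^sub>0 nat) \<Rightarrow> ('n \<Rightarrow>\<^sub>0 nat) \<Rightarrow> bool)
    \<Rightarrow> (('v, 'k::idom) mps fract \<Rightarrow> ('v, 'k) mps fract) \<Rightarrow> ('v, 'k) mps fract"
  where "delta_lc \<iota> lt P = Poly_Mapping.lookup (op_coeffs \<iota> P) (delta_exp \<iota> lt P)"

definition delta_Exp :: "('n::finite \<Rightarrow> 'v::finite) \<Rightarrow> (('n \<Rightarrow>\<^sub>0 nat) \<Rightarrow> ('n \<Rightarrow>\<^sub>0 nat) \<Rightarrow> bool)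
    \<Rightarrow> (('v, 'k::idom) mps fract \<Rightarrow> ('v, 'k) mps fract) set \<Rightarrow> ('n \<Rightarrow>\<^sub>0 nat) set"
  where "delta_Exp \<iota> lt I = delta_exp \<iota> lt ` (I - {\<lambda>_. 0})"

definition delta_stair :: "('n::finite \<Rightarrow> 'v::finite) \<Rightarrow> (('n \<Rightarrow>\<^sub>0 nat) \<Rightarrow> ('n \<Rightarrow>\<^sub>0 nat) \<Rightarrow> bool)
    \<Rightarrow> (('v, 'k::idom) mps fract \<Rightarrow> ('v, 'k) mps fract) set \<Rightarrow> ('n \<Rightarrow>\<^sub>0 nat) set \<Rightarrow> bool"
  where "delta_stair \<iota> lt I E \<longleftrightarrow> finite E \<and> E \<subseteq> delta_Exp \<iota> lt I
    \<and> delta_Exp \<iota> lt I = (\<Union>\<alpha>\<in>E. {\<alpha> + \<gamma> |\<gamma>. True})"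


section \<open>Ideals, spectrum, localization\<close>

definition subring_of :: "'a::comm_ring_1 set \<Rightarrow> 'a ring"
  where "subring_of A = ring_of_type_algebra\<lparr>carrier := A\<rparr>"

definition lc_ideal :: "('n::finite \<Rightarrow> 'v::finite) \<Rightarrow> (('n \<Rightarrow>\<^sub>0 nat) \<Rightarrow> ('n \<Rightarrow>\<^sub>0 nat) \<Rightarrow> bool)
    \<Rightarrow> ('v, 'k::idom) mps fract set \<Rightarrow> ('n \<Rightarrow>\<^sub>0 nat)
    \<Rightarrow> (('v, 'k) mps fract \<Rightarrow> ('v, 'k) mps fract) set \<Rightarrow> ('v, 'k) mps fract set"
  where "lc_ideal \<iota> lt A \<alpha> I = Idl\<^bsub>subring_of A\<^esub>
    {delta_lc \<iota> lt P |P. P \<in> I - {\<lambda>_. 0} \<and> (\<exists>\<gamma>. \<alpha> = delta_exp \<iota> lt P + \<gamma>)}"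

definition Spec :: "('a, 'b) ring_scheme \<Rightarrow> 'a set set"
  where "Spec R = {\<pp>. primeideal \<pp> R}"

definition zero_locus :: "('a, 'b) ring_scheme \<Rightarrow> 'a set \<Rightarrow> 'a set set"
  where "zero_locus R K = {\<pp> \<in> Spec R. K \<subseteq> \<pp>}"

definition localize :: "'a::field set \<Rightarrow> 'a set \<Rightarrow> 'a set"
  where "localize A \<pp> = {a / s |a s. a \<in> A \<and> s \<in> A - \<pp>}"

definition left_ideal :: "'a set \<Rightarrow> ('a, 'b) ring_scheme \<Rightarrow> bool"
  where "left_ideal I R \<longleftrightarrow> additive_subgroup I R \<and> (\<forall>a\<in>I. \<forall>x\<in>carrier R. x \<otimes>\<^bsub>R\<^esub> a \<in> I)"

definition left_genideal :: "('a, 'b) ring_scheme \<Rightarrow> 'a set \<Rightarrow> 'a set"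
  where "left_genideal R S = \<Inter>{I. left_ideal I R \<and> S \<subseteq> I}"


section \<open>Modules\<close>

text \<open>
  The quotient of a ring \<open>R\<close> by a left ideal \<open>I\<close>, with scalars acting by left multiplication through \<open>\<phi>\<close>.
  The fields \<open>mult\<close> and \<open>one\<close> of the module record play no role.
\<close>

definition left_quotient :: "('b, 'c) ring_scheme \<Rightarrow> 'b set \<Rightarrow> ('a \<Rightarrow> 'b) \<Rightarrow> ('a, 'b set) module"
  where "left_quotient R I \<phi> = \<lparr>carrier = a_rcosets\<^bsub>R\<^esub> I, monoid.mult = undefined, one = undefined,
    ring.zero = I, add = set_add R, module.smult = (\<lambda>r C. \<Union>x\<in>C. I +>\<^bsub>R\<^esub> (\<phi> r \<otimes>\<^bsub>R\<^esub> x))\<rparr>"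

definition module_basis :: "('a, 'c) ring_scheme \<Rightarrow> ('a, 'b, 'd) module_scheme \<Rightarrow> 'b set \<Rightarrow> bool"
  where "module_basis R M B \<longleftrightarrow> B \<subseteq> carrier M \<and>
    (\<forall>x\<in>carrier M. \<exists>!c. (\<forall>b. c b \<in> carrier R) \<and> (\<forall>b. b \<notin> B \<longrightarrow> c b = \<zero>\<^bsub>R\<^esub>)
      \<and> finite {b. c b \<noteq> \<zero>\<^bsub>R\<^esub>} \<and> x = (\<Oplus>\<^bsub>M\<^esub>b\<in>{b. c b \<noteq> \<zero>\<^bsub>R\<^esub>}. c b \<odot>\<^bsub>M\<^esub> b))"

definition free_module :: "('a, 'c) ring_scheme \<Rightarrow> ('a, 'b, 'd) module_scheme \<Rightarrow> bool"
  where "free_module R M \<longleftrightarrow> module R M \<and> (\<exists>B. module_basis R M B)"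

definition linear_maps :: "('a, 'c) ring_scheme \<Rightarrow> ('a, 'b, 'd) module_scheme
    \<Rightarrow> ('a, 'e, 'f) module_scheme \<Rightarrow> ('b \<Rightarrow> 'e) set"
  where "linear_maps R M N = {f \<in> hom (add_monoid M) (add_monoid N).
    \<forall>r\<in>carrier R. \<forall>x\<in>carrier M. f (r \<odot>\<^bsub>M\<^esub> x) = r \<odot>\<^bsub>N\<^esub> f x}"

definition tensor_relators :: "('a, 'c) ring_scheme \<Rightarrow> ('a, 'b, 'd) module_scheme
    \<Rightarrow> ('a, 'e, 'f) module_scheme \<Rightarrow> ('b \<times> 'e \<Rightarrow>\<^sub>0 int) set"
  where "tensor_relators R M N = generate (free_Abelian_group (carrier M \<times> carrier N))
    ({frag_of (x \<oplus>\<^bsub>M\<^esub> x', y) - frag_of (x, y) - frag_of (x', y) |x x' y.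
        x \<in> carrier M \<and> x' \<in> carrier M \<and> y \<in> carrier N}
     \<union> {frag_of (x, y \<oplus>\<^bsub>N\<^esub> y') - frag_of (x, y) - frag_of (x, y') |x y y'.
        x \<in> carrier M \<and> y \<in> carrier N \<and> y' \<in> carrier N}
     \<union> {frag_of (r \<odot>\<^bsub>M\<^esub> x, y) - frag_of (x, r \<odot>\<^bsub>N\<^esub> y) |r x y.
        r \<in> carrier R \<and> x \<in> carrier M \<and> y \<in> carrier N})"

definition tensor_product :: "('a, 'c) ring_scheme \<Rightarrow> ('a, 'b, 'd) module_scheme
    \<Rightarrow> ('a, 'e, 'f) module_scheme \<Rightarrow> ('b \<times> 'e \<Rightarrow>\<^sub>0 int) set monoid"
  where "tensor_product R M N
    = free_Abelian_group (carrier M \<times> carrier N) Mod tensor_relators R M N"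

text \<open>\<open>f \<otimes> id : M' \<otimes> N \<rightarrow> M \<otimes> N\<close>\<close>

definition tensor_map :: "('a, 'c) ring_scheme \<Rightarrow> ('a, 'b, 'd) module_scheme
    \<Rightarrow> ('a, 'e, 'f) module_scheme \<Rightarrow> ('g \<Rightarrow> 'b) \<Rightarrow> ('g \<times> 'e \<Rightarrow>\<^sub>0 int) set \<Rightarrow> ('b \<times> 'e \<Rightarrow>\<^sub>0 int) set"
  where "tensor_map R M N f C = (\<Union>z\<in>C. tensor_relators R M N
    #>\<^bsub>free_Abelian_group (carrier M \<times> carrier N)\<^esub> frag_extend (\<lambda>(x, y). frag_of (f x, y)) z)"

text \<open>
  The type argument carries the element types of the test modules; a theorem polymorphic in
  \<open>'x\<close> and \<open>'y\<close> covers test modules over all types.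
\<close>

definition flat_module :: "('x \<times> 'y) itself \<Rightarrow> ('a, 'c) ring_scheme \<Rightarrow> ('a, 'b, 'd) module_scheme \<Rightarrow> bool"
  where "flat_module _ R N \<longleftrightarrow> module R N \<and>
    (\<forall>(M' :: ('a, 'x) module) (M :: ('a, 'y) module). \<forall>f\<in>linear_maps R M' M.
      module R M' \<and> module R M \<and> inj_on f (carrier M')
        \<longrightarrow> inj_on (tensor_map R M N f) (carrier (tensor_product R M' N)))"


section \<open>Effectivity\<close>

text \<open>
  Algorithms are functions, and which functions count as computable is a parameter (the predicates
  \<open>computable_mem\<close> and \<open>computable_syz\<close>), so that no model of computation on \<open>A\<close> is singled out.
  In \<open>decides_membership\<close>, the answer \<open>None\<close> means non-membership and \<open>Some qs\<close> returns the quotients.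
  Finite subsets are presented as distinct lists.
\<close>

definition decides_membership ::
    "'a::comm_ring_1 set \<Rightarrow> ('a list \<Rightarrow> 'a \<Rightarrow> 'a list option) \<Rightarrow> bool"
  where "decides_membership A mem \<longleftrightarrow> (\<forall>fs f. distinct fs \<and> set fs \<subseteq> A \<and> f \<in> A \<longrightarrow>
    (case mem fs f of
       None \<Rightarrow> f \<notin> Idl\<^bsub>subring_of A\<^esub> (set fs)
     | Some qs \<Rightarrow> f \<in> Idl\<^bsub>subring_of A\<^esub> (set fs) \<and> length qs = length fs \<and> set qs \<subseteq> A
         \<and> f = (\<Sum>j<length fs. qs ! j * fs ! j)))"

definition syzygies :: "'a::comm_ring_1 set \<Rightarrow> 'a list \<Rightarrow> 'a list set"
  where "syzygies A fs = {qs. length qs = length fs \<and> set qs \<subseteq> A \<and> (\<Sum>j<length fs. qs ! j * fs ! j) = 0}"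

definition finds_syzygies :: "'a::comm_ring_1 set \<Rightarrow> ('a list \<Rightarrow> 'a list list) \<Rightarrow> bool"
  where "finds_syzygies A syz \<longleftrightarrow> (\<forall>fs. distinct fs \<and> set fs \<subseteq> A \<longrightarrow>
    set (syz fs) \<subseteq> syzygies A fs \<and>
    (\<forall>qs\<in>syzygies A fs. \<exists>cs. length cs = length (syz fs) \<and> set cs \<subseteq> A
      \<and> (\<forall>j<length fs. qs ! j = (\<Sum>l<length (syz fs). cs ! l * syz fs ! l ! j))))"

definition effective :: "(('a list \<Rightarrow> 'a \<Rightarrow> 'a list option) \<Rightarrow> bool) \<Rightarrow> (('a list \<Rightarrow> 'a list list) \<Rightarrow> bool)
    \<Rightarrow> 'a::comm_ring_1 set \<Rightarrow> bool"
  where "effective computable_mem computable_syz A \<longleftrightarrow>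
    (\<exists>mem. computable_mem mem \<and> decides_membership A mem) \<and>
    (\<exists>syz. computable_syz syz \<and> finds_syzygies A syz)"

end

theory Submission
  imports Defs
begin

text \<open>
  The quotient is free because division with remainder works at \<open>\<PP>\<close>.  For each corner \<open>\<alpha>(i)\<close> of the
  stair, \<open>C(\<alpha>(i); I) \<supseteq> J\<close> is not contained in the prime \<open>\<PP>\<close>, so some generator of it, the leading
  coefficient of a \<open>P \<in> I\<close> with \<open>\<alpha>(i) \<in> exp(P) + \<nat>\<^sup>n\<close>, lies outside \<open>\<PP>\<close>.  Composing \<open>P\<close> with a
  monomial \<open>\<partial>\<^sup>\<gamma>\<close> on the left moves its leading exponent by \<open>\<gamma>\<close> and keeps the leading coefficient.
  As the stair generates \<open>Exp(I)\<close>, every exponent in \<open>Exp(I)\<close> is the leading exponent of an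
  element of \<open>I\<close> whose leading coefficient is a unit of the localization
  (lemma \<open>unit_leading_coefficient\<close>).

  Dividing by these elements writes any operator of the localized ring as an element of the localized
  ideal plus a remainder \<open>\<Sum> q\<^sub>\<alpha> \<partial>\<^sup>\<alpha>\<close> with all \<open>\<alpha> \<notin> Exp(I)\<close> (lemma \<open>division\<close>).  The remainder is unique:
  an element of the localized ideal is \<open>s\<^sup>-\<^sup>1 P\<close> with \<open>P \<in> I\<close>, so its leading exponent is still in \<open>Exp(I)\<close>,
  whereas the difference of two remainders has none of its exponents there (lemma \<open>remainder_unique\<close>).
  Hence the classes of the \<open>\<partial>\<^sup>\<alpha>\<close> with \<open>\<alpha> \<notin> Exp(I)\<close> form a basis (lemma \<open>free_localized_quotient\<close>).

  Flatness of a free module \<open>N\<close> (lemma \<open>free_module_flat\<close>) holds because coordinates with respect to a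
  basis split \<open>M \<otimes> N\<close> into copies of \<open>M\<close>, compatibly with maps in \<open>M\<close>.
\<close>

section \<open>Free modules are flat\<close>

lemma keys_diff_subset:
  "Poly_Mapping.keys a \<subseteq> S \<Longrightarrow> Poly_Mapping.keys b \<subseteq> S \<Longrightarrow> Poly_Mapping.keys (a - b) \<subseteq> S"
  using keys_diff[of a b] by blast

lemma tensor_relators_closed:
  assumes "module R M" "module R N"
  shows "subgroup (tensor_relators R M N) (free_Abelian_group (carrier M \<times> carrier N))"
proof -
  interpret M: module R M by fact
  interpret N: module R N by fact
  show ?thesis
    unfolding tensor_relators_def
    by (rule group.generate_is_subgroup[OF group_free_Abelian_group])
      (auto dest!: subsetD[OF keys_diff])
qed

lemma tensor_relators_zero:
  assumes "module R M" "module R N"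
  shows "0 \<in> tensor_relators R M N"
  using subgroup.one_closed[OF tensor_relators_closed[OF assms]] by simp

lemma tensor_relators_add:
  assumes "module R M" "module R N" "a \<in> tensor_relators R M N" "b \<in> tensor_relators R M N"
  shows "a + b \<in> tensor_relators R M N"
  using subgroup.m_closed[OF tensor_relators_closed[OF assms(1,2)] assms(3,4)] by simp

lemma tensor_relators_minus:
  assumes "module R M" "module R N" "a \<in> tensor_relators R M N"
  shows "- a \<in> tensor_relators R M N"
  using subgroup.m_inv_closed[OF tensor_relators_closed[OF assms(1,2)] assms(3)]
    subgroup.mem_carrier[OF tensor_relators_closed[OF assms(1,2)] assms(3)] by simp

lemma tensor_relators_diff:
  assumes "module R M" "module R N" "a \<in> tensor_relators R M N" "b \<in> tensor_relators R M N"
  shows "a - b \<in> tensor_relators R M N"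
  using tensor_relators_add[OF assms(1-3) tensor_relators_minus[OF assms(1,2,4)]] by simp

lemma tensor_relators_sum:
  assumes "module R M" "module R N" "\<And>i. i \<in> A \<Longrightarrow> g i \<in> tensor_relators R M N"
  shows "sum g A \<in> tensor_relators R M N"
  using assms(3)
  by (induction A rule: infinite_finite_induct)
    (auto simp: tensor_relators_zero tensor_relators_add assms(1,2))

lemma tensor_relators_gens:
  shows tensor_relators_l_distr: "x \<in> carrier M \<Longrightarrow> x' \<in> carrier M \<Longrightarrow> y \<in> carrier N \<Longrightarrow>
      frag_of (x \<oplus>\<^bsub>M\<^esub> x', y) - frag_of (x, y) - frag_of (x', y) \<in> tensor_relators R M N"
    and tensor_relators_r_distr: "x \<in> carrier M \<Longrightarrow> y \<in> carrier N \<Longrightarrow> y' \<in> carrier N \<Longrightarrow>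
      frag_of (x, y \<oplus>\<^bsub>N\<^esub> y') - frag_of (x, y) - frag_of (x, y') \<in> tensor_relators R M N"
    and tensor_relators_smult: "r \<in> carrier R \<Longrightarrow> x \<in> carrier M \<Longrightarrow> y \<in> carrier N \<Longrightarrow>
      frag_of (r \<odot>\<^bsub>M\<^esub> x, y) - frag_of (x, r \<odot>\<^bsub>N\<^esub> y) \<in> tensor_relators R M N"
  unfolding tensor_relators_def by (rule generate.incl; blast)+

lemma tensor_relators_zero_left:
  assumes "module R M" "module R N" "y \<in> carrier N"
  shows "frag_of (\<zero>\<^bsub>M\<^esub>, y) \<in> tensor_relators R M N"
proof -
  interpret M: module R M by fact
  have "- frag_of (\<zero>\<^bsub>M\<^esub>, y) \<in> tensor_relators R M N"
    using tensor_relators_l_distr[of "\<zero>\<^bsub>M\<^esub>" M "\<zero>\<^bsub>M\<^esub>" y N R] assms(3) by simp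
  from tensor_relators_minus[OF assms(1,2) this] show ?thesis by simp
qed

lemma tensor_relators_zero_right:
  assumes "module R M" "module R N" "x \<in> carrier M"
  shows "frag_of (x, \<zero>\<^bsub>N\<^esub>) \<in> tensor_relators R M N"
proof -
  interpret N: module R N by fact
  have "- frag_of (x, \<zero>\<^bsub>N\<^esub>) \<in> tensor_relators R M N"
    using tensor_relators_r_distr[of x M "\<zero>\<^bsub>N\<^esub>" N "\<zero>\<^bsub>N\<^esub>" R] assms(3) by simp
  from tensor_relators_minus[OF assms(1,2) this] show ?thesis by simp
qed

lemma hom_free_Abelian_group_diff:
  assumes "abelian_group M" "h \<in> hom (free_Abelian_group S) (add_monoid M)"
    "Poly_Mapping.keys a \<subseteq> S" "Poly_Mapping.keys b \<subseteq> S"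
  shows "h (a - b) = h a \<ominus>\<^bsub>M\<^esub> h b"
proof -
  interpret M: abelian_group M by fact
  have c: "h z \<in> carrier M" if "Poly_Mapping.keys z \<subseteq> S" for z
    using hom_in_carrier[OF assms(2), of z] that by simp
  have "h ((a - b) + b) = h (a - b) \<oplus>\<^bsub>M\<^esub> h b"
    using hom_mult[OF assms(2), of "a - b" b] assms(3,4) keys_diff_subset[of a S b] by simp
  then show ?thesis
    using c[OF assms(3)] c[OF assms(4)] c[OF keys_diff_subset[OF assms(3,4)]]
    by (simp add: a_minus_def M.a_assoc M.r_neg)
qed

lemma hom_free_Abelian_group_zero:
  assumes "abelian_group M" "h \<in> hom (free_Abelian_group S) (add_monoid M)"
  shows "h 0 = \<zero>\<^bsub>M\<^esub>"
proof -
  interpret M: abelian_group M by fact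
  have "h 0 \<in> carrier M" using hom_in_carrier[OF assms(2), of 0] by simp
  then show ?thesis
    using hom_free_Abelian_group_diff[OF assms, of 0 0] by (simp add: a_minus_def M.r_neg)
qed

text \<open>
  A linear form \<open>\<phi>\<close> on \<open>N\<close> contracts \<open>M \<otimes> N\<close> to \<open>M\<close>, sending \<open>x \<otimes> y\<close> to \<open>\<phi> y \<cdot> x\<close>.  Working on the
  free group that presents the tensor product avoids choosing representatives of classes.
\<close>

lemma tensor_contraction:
  assumes "module R M" "module R N"
    and \<phi>: "\<And>y. y \<in> carrier N \<Longrightarrow> \<phi> y \<in> carrier R"
      "\<And>y y'. y \<in> carrier N \<Longrightarrow> y' \<in> carrier N \<Longrightarrow> \<phi> (y \<oplus>\<^bsub>N\<^esub> y') = \<phi> y \<oplus>\<^bsub>R\<^esub> \<phi> y'"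
      "\<And>r y. r \<in> carrier R \<Longrightarrow> y \<in> carrier N \<Longrightarrow> \<phi> (r \<odot>\<^bsub>N\<^esub> y) = r \<otimes>\<^bsub>R\<^esub> \<phi> y"
  obtains h where "h \<in> hom (free_Abelian_group (carrier M \<times> carrier N)) (add_monoid M)"
    and "\<And>x y. x \<in> carrier M \<Longrightarrow> y \<in> carrier N \<Longrightarrow> h (frag_of (x, y)) = \<phi> y \<odot>\<^bsub>M\<^esub> x"
    and "\<And>z. z \<in> tensor_relators R M N \<Longrightarrow> h z = \<zero>\<^bsub>M\<^esub>"
proof -
  interpret M: module R M by fact
  interpret N: module R N by fact
  let ?F = "free_Abelian_group (carrier M \<times> carrier N)"
  have "(\<lambda>(x, y). \<phi> y \<odot>\<^bsub>M\<^esub> x) ` (carrier M \<times> carrier N) \<subseteq> carrier (add_monoid M)"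
    using \<phi>(1) by auto
  then obtain h where h: "h \<in> hom ?F (add_monoid M)"
    and h_of: "\<And>p. p \<in> carrier M \<times> carrier N \<Longrightarrow> h (frag_of p) = (\<lambda>(x, y). \<phi> y \<odot>\<^bsub>M\<^esub> x) p"
    by (rule comm_group.free_Abelian_group_universal[OF M.M.a_comm_group]) blast
  have of: "h (frag_of (x, y)) = \<phi> y \<odot>\<^bsub>M\<^esub> x" if "x \<in> carrier M" "y \<in> carrier N" for x y
    using h_of[of "(x, y)"] that by simp
  have diff: "h (a - b) = h a \<ominus>\<^bsub>M\<^esub> h b"
    if "Poly_Mapping.keys a \<subseteq> carrier M \<times> carrier N" "Poly_Mapping.keys b \<subseteq> carrier M \<times> carrier N" for a b
    by (rule hom_free_Abelian_group_diff[OF M.abelian_group_axioms h that])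
  interpret h: group_hom ?F "add_monoid M" h
    by (intro group_hom.intro group_hom_axioms.intro h) (simp_all add: M.M.a_group)
  have "tensor_relators R M N \<subseteq> kernel ?F (add_monoid M) h"
    unfolding tensor_relators_def
  proof (rule group.generate_subgroup_incl[OF group_free_Abelian_group _ h.subgroup_kernel], safe, goal_cases)
    case (1 z x x' y)
    then show ?case
      by (auto simp: kernel_def diff of keys_diff_subset \<phi> M.smult_r_distr a_minus_def
          M.M.a_ac M.M.r_neg M.M.r_neg1 M.M.r_neg2 M.M.minus_add intro!: keys_diff_subset)
  next
    case (2 z x y y')
    then show ?case
      by (auto simp: kernel_def diff of keys_diff_subset \<phi> M.smult_l_distr a_minus_def
          M.M.a_ac M.M.r_neg M.M.r_neg1 M.M.r_neg2 M.M.minus_add intro!: keys_diff_subset)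
  next
    case (3 z r x y)
    have "\<phi> y \<odot>\<^bsub>M\<^esub> (r \<odot>\<^bsub>M\<^esub> x) = (r \<otimes>\<^bsub>R\<^esub> \<phi> y) \<odot>\<^bsub>M\<^esub> x"
      using 3 \<phi>(1) by (simp add: M.smult_assoc1[symmetric] M.m_comm)
    with 3 show ?case
      by (auto simp: kernel_def diff of keys_diff_subset \<phi> a_minus_def M.M.r_neg intro!: keys_diff_subset)
  qed
  then have "h z = \<zero>\<^bsub>M\<^esub>" if "z \<in> tensor_relators R M N" for z
    using that by (auto simp: kernel_def)
  with h of show ?thesis by (rule that)
qed

lemma module_basis_coordinates:
  assumes "module R N" "module_basis R N B"
  obtains c where "\<And>y b. y \<in> carrier N \<Longrightarrow> c y b \<in> carrier R"
    and "\<And>y. y \<in> carrier N \<Longrightarrow> finite {b. c y b \<noteq> \<zero>\<^bsub>R\<^esub>}"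
    and "\<And>y. y \<in> carrier N \<Longrightarrow> {b. c y b \<noteq> \<zero>\<^bsub>R\<^esub>} \<subseteq> B"
    and "\<And>y A. y \<in> carrier N \<Longrightarrow> finite A \<Longrightarrow> {b. c y b \<noteq> \<zero>\<^bsub>R\<^esub>} \<subseteq> A \<Longrightarrow> A \<subseteq> B
      \<Longrightarrow> y = (\<Oplus>\<^bsub>N\<^esub>b\<in>A. c y b \<odot>\<^bsub>N\<^esub> b)"
    and "\<And>y y' b. y \<in> carrier N \<Longrightarrow> y' \<in> carrier N \<Longrightarrow> c (y \<oplus>\<^bsub>N\<^esub> y') b = c y b \<oplus>\<^bsub>R\<^esub> c y' b"
    and "\<And>r y b. r \<in> carrier R \<Longrightarrow> y \<in> carrier N \<Longrightarrow> c (r \<odot>\<^bsub>N\<^esub> y) b = r \<otimes>\<^bsub>R\<^esub> c y b"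
proof -
  interpret N: module R N by fact
  have B: "b \<in> carrier N" if "b \<in> B" for b
    using assms(2) that by (auto simp: module_basis_def)
  define supp where "supp = (\<lambda>a :: 'c \<Rightarrow> 'a. {b. a b \<noteq> \<zero>\<^bsub>R\<^esub>})"
  define repr where "repr = (\<lambda>y a. (\<forall>b. a b \<in> carrier R) \<and> (\<forall>b. b \<notin> B \<longrightarrow> a b = \<zero>\<^bsub>R\<^esub>)
      \<and> finite (supp a) \<and> y = (\<Oplus>\<^bsub>N\<^esub>b\<in>supp a. a b \<odot>\<^bsub>N\<^esub> b))"
  have ex1: "\<exists>!a. repr y a" if "y \<in> carrier N" for y
    using assms(2) that unfolding module_basis_def repr_def supp_def by blast
  have enlarge: "(\<Oplus>\<^bsub>N\<^esub>b\<in>supp a. a b \<odot>\<^bsub>N\<^esub> b) = (\<Oplus>\<^bsub>N\<^esub>b\<in>A. a b \<odot>\<^bsub>N\<^esub> b)"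
    if "\<And>b. a b \<in> carrier R" "finite A" "supp a \<subseteq> A" "A \<subseteq> B" for a A
    by (rule N.M.add.finprod_mono_neutral_cong_left) (use that B in \<open>auto simp: supp_def\<close>)
  have reprI: "repr y a" if "\<And>b. a b \<in> carrier R" "finite A" "supp a \<subseteq> A" "A \<subseteq> B"
    "y = (\<Oplus>\<^bsub>N\<^esub>b\<in>A. a b \<odot>\<^bsub>N\<^esub> b)" for y a A
    using that enlarge[OF that(1-4)] finite_subset[OF that(3,2)] unfolding repr_def
    by (auto simp: supp_def)
  define c where "c y = (THE a. repr y a)" for y
  have c: "repr y (c y)" if "y \<in> carrier N" for y
    unfolding c_def by (rule theI'[OF ex1[OF that]])
  have c_eq: "c y = a" if "y \<in> carrier N" "repr y a" for y a
    using ex1[OF that(1)] c[OF that(1)] that(2) by blast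
  have cR: "c y b \<in> carrier R" if "y \<in> carrier N" for y b
    using c[OF that] by (simp add: repr_def)
  have fin: "finite (supp (c y))" and sub: "supp (c y) \<subseteq> B" if "y \<in> carrier N" for y
    using c[OF that] by (auto simp: repr_def supp_def)
  have expand: "y = (\<Oplus>\<^bsub>N\<^esub>b\<in>A. c y b \<odot>\<^bsub>N\<^esub> b)"
    if "y \<in> carrier N" "finite A" "supp (c y) \<subseteq> A" "A \<subseteq> B" for y A
    using enlarge[OF cR[OF that(1)] that(2-4)] c[OF that(1)] by (simp add: repr_def)
  show ?thesis
  proof (rule that[of c], goal_cases)
    case (5 y y' b)
    let ?A = "supp (c y) \<union> supp (c y')"
    have A: "finite ?A" "?A \<subseteq> B" using fin sub 5 by auto
    have "y \<oplus>\<^bsub>N\<^esub> y' = (\<Oplus>\<^bsub>N\<^esub>b\<in>?A. c y b \<odot>\<^bsub>N\<^esub> b) \<oplus>\<^bsub>N\<^esub> (\<Oplus>\<^bsub>N\<^esub>b\<in>?A. c y' b \<odot>\<^bsub>N\<^esub> b)"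
      using expand[OF 5(1) A(1) _ A(2)] expand[OF 5(2) A(1) _ A(2)] by simp
    also have "\<dots> = (\<Oplus>\<^bsub>N\<^esub>b\<in>?A. c y b \<odot>\<^bsub>N\<^esub> b \<oplus>\<^bsub>N\<^esub> c y' b \<odot>\<^bsub>N\<^esub> b)"
      by (rule N.M.finsum_addf[symmetric]) (use cR 5 A B in \<open>auto intro!: N.smult_closed\<close>)
    also have "\<dots> = (\<Oplus>\<^bsub>N\<^esub>b\<in>?A. (c y b \<oplus>\<^bsub>R\<^esub> c y' b) \<odot>\<^bsub>N\<^esub> b)"
      by (rule N.M.finsum_cong') (use cR 5 A B in \<open>auto intro!: N.smult_closed simp: N.smult_l_distr\<close>)
    finally have "repr (y \<oplus>\<^bsub>N\<^esub> y') (\<lambda>b. c y b \<oplus>\<^bsub>R\<^esub> c y' b)"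
      by (intro reprI[OF _ A(1) _ A(2)]) (use cR 5 in \<open>auto simp: supp_def\<close>)
    from c_eq[OF _ this] 5 show ?case by simp
  next
    case (6 r y b)
    let ?A = "supp (c y)"
    have A: "finite ?A" "?A \<subseteq> B" using fin sub 6 by auto
    have "r \<odot>\<^bsub>N\<^esub> y = r \<odot>\<^bsub>N\<^esub> (\<Oplus>\<^bsub>N\<^esub>b\<in>?A. c y b \<odot>\<^bsub>N\<^esub> b)"
      using expand[OF 6(2) A(1) _ A(2)] by simp
    also have "\<dots> = (\<Oplus>\<^bsub>N\<^esub>b\<in>?A. r \<odot>\<^bsub>N\<^esub> (c y b \<odot>\<^bsub>N\<^esub> b))"
      by (rule N.finsum_smult_ldistr) (use cR 6 A B in \<open>auto intro!: N.smult_closed\<close>)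
    also have "\<dots> = (\<Oplus>\<^bsub>N\<^esub>b\<in>?A. (r \<otimes>\<^bsub>R\<^esub> c y b) \<odot>\<^bsub>N\<^esub> b)"
      by (rule N.M.finsum_cong') (use cR 6 A B in \<open>auto intro!: N.smult_closed simp: N.smult_assoc1\<close>)
    finally have "repr (r \<odot>\<^bsub>N\<^esub> y) (\<lambda>b. r \<otimes>\<^bsub>R\<^esub> c y b)"
      by (intro reprI[OF _ A(1) _ A(2)]) (use cR 6 in \<open>auto simp: supp_def\<close>)
    from c_eq[OF _ this] 6 show ?case by simp
  qed (use cR fin sub expand in \<open>auto simp: supp_def\<close>)
qed

lemma tensor_relators_r_sum:
  assumes "module R M" "module R N" "x \<in> carrier M" "finite A" "A \<subseteq> carrier N"
    and "\<And>b. b \<in> A \<Longrightarrow> a b \<in> carrier R"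
  shows "frag_of (x, \<Oplus>\<^bsub>N\<^esub>b\<in>A. a b \<odot>\<^bsub>N\<^esub> b) - (\<Sum>b\<in>A. frag_of (a b \<odot>\<^bsub>M\<^esub> x, b)) \<in> tensor_relators R M N"
  using assms(4-6)
proof (induction A)
  case empty
  interpret N: module R N by fact
  show ?case by (simp add: tensor_relators_zero_right[OF assms(1-3)])
next
  case (insert b A)
  interpret M: module R M by fact
  interpret N: module R N by fact
  let ?K = "tensor_relators R M N"
  let ?s = "\<Oplus>\<^bsub>N\<^esub>b\<in>A. a b \<odot>\<^bsub>N\<^esub> b"
  have s: "?s \<in> carrier N"
    by (rule N.M.finsum_closed) (use insert.prems in auto)
  have b: "b \<in> carrier N" "a b \<in> carrier R" using insert.prems by auto
  have sum: "(\<Oplus>\<^bsub>N\<^esub>b\<in>insert b A. a b \<odot>\<^bsub>N\<^esub> b) = a b \<odot>\<^bsub>N\<^esub> b \<oplus>\<^bsub>N\<^esub> ?s"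
    by (rule N.M.finsum_insert) (use insert in auto)
  have 1: "frag_of (x, a b \<odot>\<^bsub>N\<^esub> b \<oplus>\<^bsub>N\<^esub> ?s) - frag_of (x, a b \<odot>\<^bsub>N\<^esub> b) - frag_of (x, ?s) \<in> ?K"
    by (rule tensor_relators_r_distr) (use b s assms(3) in auto)
  have 2: "frag_of (a b \<odot>\<^bsub>M\<^esub> x, b) - frag_of (x, a b \<odot>\<^bsub>N\<^esub> b) \<in> ?K"
    by (rule tensor_relators_smult) (use b assms(3) in auto)
  have 3: "frag_of (x, ?s) - (\<Sum>b\<in>A. frag_of (a b \<odot>\<^bsub>M\<^esub> x, b)) \<in> ?K"
    using insert by auto
  show ?case
    using tensor_relators_add[OF assms(1,2) tensor_relators_diff[OF assms(1,2) 1 2] 3] insert.hyps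
    by (simp add: sum algebra_simps)
qed

text \<open>
  If \<open>N\<close> has a basis \<open>B\<close>, then every tensor is \<open>\<Sum>\<^sub>b x\<^sub>b \<otimes> b\<close>, where \<open>x\<^sub>b\<close> is its contraction with the
  \<open>b\<close>-th coordinate form.  Quantifying over all large finite \<open>A\<close> keeps the sum finite and stable
  under subtraction.
\<close>

lemma tensor_expansion:
  assumes "module R M" "module R N" "B \<subseteq> carrier N"
    and c: "\<And>y b. y \<in> carrier N \<Longrightarrow> c y b \<in> carrier R"
      "\<And>y. y \<in> carrier N \<Longrightarrow> finite {b. c y b \<noteq> \<zero>\<^bsub>R\<^esub>}"
      "\<And>y. y \<in> carrier N \<Longrightarrow> {b. c y b \<noteq> \<zero>\<^bsub>R\<^esub>} \<subseteq> B"
      "\<And>y A. y \<in> carrier N \<Longrightarrow> finite A \<Longrightarrow> {b. c y b \<noteq> \<zero>\<^bsub>R\<^esub>} \<subseteq> A \<Longrightarrow> A \<subseteq> B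
        \<Longrightarrow> y = (\<Oplus>\<^bsub>N\<^esub>b\<in>A. c y b \<odot>\<^bsub>N\<^esub> b)"
    and h: "\<And>b. b \<in> B \<Longrightarrow> h b \<in> hom (free_Abelian_group (carrier M \<times> carrier N)) (add_monoid M)"
      "\<And>b x y. b \<in> B \<Longrightarrow> x \<in> carrier M \<Longrightarrow> y \<in> carrier N \<Longrightarrow> h b (frag_of (x, y)) = c y b \<odot>\<^bsub>M\<^esub> x"
    and z: "Poly_Mapping.keys z \<subseteq> carrier M \<times> carrier N"
  shows "\<exists>A0. finite A0 \<and> A0 \<subseteq> B \<and> (\<forall>A. finite A \<and> A0 \<subseteq> A \<and> A \<subseteq> B \<longrightarrow>
    z - (\<Sum>b\<in>A. frag_of (h b z, b)) \<in> tensor_relators R M N)"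
  using z
proof (induction z rule: free_Abelian_group_induct[consumes 1])
  case 1
  interpret M: module R M by fact
  have "frag_of (h b 0, b) \<in> tensor_relators R M N" if "b \<in> B" for b
    using hom_free_Abelian_group_zero[OF M.abelian_group_axioms h(1)[OF that]]
      tensor_relators_zero_left[OF assms(1,2)] that assms(3) by auto
  then have "- (\<Sum>b\<in>A. frag_of (h b 0, b)) \<in> tensor_relators R M N" if "A \<subseteq> B" for A
    using that by (intro tensor_relators_minus tensor_relators_sum assms(1,2)) auto
  then show ?case by (intro exI[of _ "{}"]) (simp only: diff_0, blast)
next
  case (2 z w)
  interpret M: module R M by fact
  let ?K = "tensor_relators R M N"
  let ?large = "\<lambda>z A0. finite A0 \<and> A0 \<subseteq> B \<and> (\<forall>A. finite A \<and> A0 \<subseteq> A \<and> A \<subseteq> B \<longrightarrow>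
    z - (\<Sum>b\<in>A. frag_of (h b z, b)) \<in> ?K)"
  obtain A1 where A1: "?large z A1" using 2(3) by (rule exE)
  obtain A2 where A2: "?large w A2" using 2(4) by (rule exE)
  have "(z - w) - (\<Sum>b\<in>A. frag_of (h b (z - w), b)) \<in> ?K"
    if A: "finite A" "A1 \<union> A2 \<subseteq> A" "A \<subseteq> B" for A
  proof -
    have *: "frag_of (h b z, b) - frag_of (h b (z - w), b) - frag_of (h b w, b) \<in> ?K" if "b \<in> A" for b
    proof -
      have b: "b \<in> B" "b \<in> carrier N" using that A(3) assms(3) by auto
      have hc: "h b v \<in> carrier M" if "Poly_Mapping.keys v \<subseteq> carrier M \<times> carrier N" for v
        using hom_in_carrier[OF h(1)[OF b(1)], of v] that by simp
      have hd: "h b (z - w) \<in> carrier M" by (intro hc keys_diff_subset 2)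
      have "h b z = h b (z - w) \<oplus>\<^bsub>M\<^esub> h b w"
        using hom_mult[OF h(1)[OF b(1)], of "z - w" w] 2(1,2) keys_diff_subset[OF 2(1,2)] by simp
      then show ?thesis
        using tensor_relators_l_distr[of "h b (z - w)" M "h b w" b N R] hd hc[OF 2(2)] b(2) by simp
    qed
    have 1: "z - (\<Sum>b\<in>A. frag_of (h b z, b)) \<in> ?K" and 2: "w - (\<Sum>b\<in>A. frag_of (h b w, b)) \<in> ?K"
      using A A1 A2 by simp_all
    have 3: "(\<Sum>b\<in>A. frag_of (h b z, b) - frag_of (h b (z - w), b) - frag_of (h b w, b)) \<in> ?K"
      by (rule tensor_relators_sum[OF assms(1,2) *])
    from tensor_relators_add[OF assms(1,2) tensor_relators_diff[OF assms(1,2) 1 2] 3]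
    show ?thesis by (simp add: sum_subtractf sum.distrib algebra_simps)
  qed
  then show ?case using A1 A2 by (intro exI[of _ "A1 \<union> A2"] conjI allI impI) auto
next
  case (3 p)
  interpret M: module R M by fact
  obtain x y where p: "p = (x, y)" "x \<in> carrier M" "y \<in> carrier N" using 3 by auto
  have "frag_of p - (\<Sum>b\<in>A. frag_of (h b (frag_of p), b)) \<in> tensor_relators R M N"
    if A: "finite A" "{b. c y b \<noteq> \<zero>\<^bsub>R\<^esub>} \<subseteq> A" "A \<subseteq> B" for A
  proof -
    have "(\<Sum>b\<in>A. frag_of (h b (frag_of p), b)) = (\<Sum>b\<in>A. frag_of (c y b \<odot>\<^bsub>M\<^esub> x, b))"
      by (rule sum.cong) (use A p h(2) in auto)
    with tensor_relators_r_sum[OF assms(1,2) p(2) A(1), of "c y"] c(4)[OF p(3) A] c(1)[OF p(3)]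
      A(3) assms(3) show ?thesis by (simp add: p(1))
  qed
  then show ?case using c(2,3)[OF p(3)] by (intro exI[of _ "{b. c y b \<noteq> \<zero>\<^bsub>R\<^esub>}"]) blast
qed

lemma free_Abelian_group_rcoset_eq_iff:
  assumes "subgroup K (free_Abelian_group S)" "Poly_Mapping.keys z \<subseteq> S" "Poly_Mapping.keys w \<subseteq> S"
  shows "K #>\<^bsub>free_Abelian_group S\<^esub> z = K #>\<^bsub>free_Abelian_group S\<^esub> w \<longleftrightarrow> z - w \<in> K"
proof -
  interpret F: group "free_Abelian_group S" by simp
  interpret K: subgroup K "free_Abelian_group S" by fact
  have mem: "v \<in> K #>\<^bsub>free_Abelian_group S\<^esub> w \<longleftrightarrow> v - w \<in> K" for v w
    unfolding r_coset_def by (auto intro!: bexI[of _ "v - w"])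
  show ?thesis
  proof
    assume "K #>\<^bsub>free_Abelian_group S\<^esub> z = K #>\<^bsub>free_Abelian_group S\<^esub> w"
    moreover have "z \<in> K #>\<^bsub>free_Abelian_group S\<^esub> z" using K.one_closed by (simp add: mem)
    ultimately show "z - w \<in> K" using mem by blast
  next
    assume zw: "z - w \<in> K"
    then show "K #>\<^bsub>free_Abelian_group S\<^esub> z = K #>\<^bsub>free_Abelian_group S\<^esub> w"
      using F.repr_independence[of z K w] assms mem by auto
  qed
qed

text \<open>
  Contractions with the coordinate forms of \<open>N\<close> commute with \<open>f\<close>.  So if \<open>f \<otimes> id\<close> kills a tensor, then
  \<open>f\<close> kills its contractions, which therefore vanish, and a tensor is determined by them.
\<close>

lemma free_module_flat:
  fixes R :: "('a, 'c) ring_scheme" and N :: "('a, 'b, 'd) module_scheme"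
  assumes "free_module R N"
  shows "flat_module TYPE('x \<times> 'y) R N"
proof -
  obtain B where N: "module R N" and basis: "module_basis R N B"
    using assms by (auto simp: free_module_def)
  have BN: "B \<subseteq> carrier N" using basis by (simp add: module_basis_def)
  obtain c where c: "\<And>y b. y \<in> carrier N \<Longrightarrow> c y b \<in> carrier R"
      "\<And>y. y \<in> carrier N \<Longrightarrow> finite {b. c y b \<noteq> \<zero>\<^bsub>R\<^esub>}"
      "\<And>y. y \<in> carrier N \<Longrightarrow> {b. c y b \<noteq> \<zero>\<^bsub>R\<^esub>} \<subseteq> B"
      "\<And>y A. y \<in> carrier N \<Longrightarrow> finite A \<Longrightarrow> {b. c y b \<noteq> \<zero>\<^bsub>R\<^esub>} \<subseteq> A \<Longrightarrow> A \<subseteq> B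
        \<Longrightarrow> y = (\<Oplus>\<^bsub>N\<^esub>b\<in>A. c y b \<odot>\<^bsub>N\<^esub> b)"
    and c_lin: "\<And>y y' b. y \<in> carrier N \<Longrightarrow> y' \<in> carrier N \<Longrightarrow> c (y \<oplus>\<^bsub>N\<^esub> y') b = c y b \<oplus>\<^bsub>R\<^esub> c y' b"
      "\<And>r y b. r \<in> carrier R \<Longrightarrow> y \<in> carrier N \<Longrightarrow> c (r \<odot>\<^bsub>N\<^esub> y) b = r \<otimes>\<^bsub>R\<^esub> c y b"
    by (rule module_basis_coordinates[OF N basis]) blast
  have "inj_on (tensor_map R M N f) (carrier (tensor_product R M' N))"
    if f: "f \<in> linear_maps R M' M" and mods: "module R M'" "module R M" and inj: "inj_on f (carrier M')"
    for M' :: "('a, 'x) module" and M :: "('a, 'y) module" and f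
  proof -
    interpret M': module R M' by fact
    interpret M: module R M by fact
    let ?F' = "free_Abelian_group (carrier M' \<times> carrier N)"
    let ?F = "free_Abelian_group (carrier M \<times> carrier N)"
    let ?K' = "tensor_relators R M' N"
    let ?K = "tensor_relators R M N"
    let ?g = "frag_extend (\<lambda>(x, y). frag_of (f x, y))"
    have f_closed: "f x \<in> carrier M" if "x \<in> carrier M'" for x
      using f that by (auto simp: linear_maps_def dest: hom_in_carrier)
    have f_add: "f (x \<oplus>\<^bsub>M'\<^esub> x') = f x \<oplus>\<^bsub>M\<^esub> f x'" if "x \<in> carrier M'" "x' \<in> carrier M'" for x x'
      using f that by (auto simp: linear_maps_def dest: hom_mult)
    have f_smult: "f (r \<odot>\<^bsub>M'\<^esub> x) = r \<odot>\<^bsub>M\<^esub> f x" if "r \<in> carrier R" "x \<in> carrier M'" for r x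
      using f that by (auto simp: linear_maps_def)
    have f_zero: "f \<zero>\<^bsub>M'\<^esub> = \<zero>\<^bsub>M\<^esub>"
      using f_smult[of "\<zero>\<^bsub>R\<^esub>" "\<zero>\<^bsub>M'\<^esub>"] f_closed by simp
    have f_diff: "f (x \<ominus>\<^bsub>M'\<^esub> x') = f x \<ominus>\<^bsub>M\<^esub> f x'" if "x \<in> carrier M'" "x' \<in> carrier M'" for x x'
    proof -
      have "f x = f (x \<ominus>\<^bsub>M'\<^esub> x') \<oplus>\<^bsub>M\<^esub> f x'"
        using f_add[of "x \<ominus>\<^bsub>M'\<^esub> x'" x'] that by (simp add: a_minus_def M'.M.a_assoc M'.M.l_neg)
      then show ?thesis
        using that f_closed by (simp add: a_minus_def M.M.a_assoc M.M.r_neg)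
    qed
    have g_closed: "Poly_Mapping.keys (?g z) \<subseteq> carrier M \<times> carrier N"
      if "Poly_Mapping.keys z \<subseteq> carrier M' \<times> carrier N" for z
      using that
      by (induction z rule: free_Abelian_group_induct[consumes 1])
        (auto simp: frag_extend_diff f_closed dest!: subsetD[OF keys_diff])
    have gK: "?g z \<in> ?K" if "z \<in> ?K'" for z
      using that unfolding tensor_relators_def[of R M']
    proof (induction z rule: generate.induct)
      case one
      show ?case by (simp add: tensor_relators_zero mods N)
    next
      case (incl z)
      then show ?case
        by (auto simp: frag_extend_diff f_add f_smult f_closed
            intro!: tensor_relators_l_distr tensor_relators_r_distr tensor_relators_smult)
    next
      case (inv z)
      have z: "z \<in> ?K'" unfolding tensor_relators_def using inv by (rule generate.incl)
      have keys: "Poly_Mapping.keys z \<subseteq> carrier M' \<times> carrier N"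
        using subgroup.mem_carrier[OF tensor_relators_closed[OF mods(1) N] z] by simp
      from inv have "?g z \<in> ?K"
        by (auto simp: frag_extend_diff f_add f_smult f_closed
            intro!: tensor_relators_l_distr tensor_relators_r_distr tensor_relators_smult)
      then show ?case using keys by (simp add: frag_extend_minus tensor_relators_minus mods N)
    next
      case (eng z w)
      then show ?case by (simp add: frag_extend_add tensor_relators_add mods N)
    qed
    (* the kernel of f \<otimes> id is trivial, stated on representatives *)
    have ker: "z \<in> ?K'" if z: "Poly_Mapping.keys z \<subseteq> carrier M' \<times> carrier N" and gz: "?g z \<in> ?K" for z
    proof -
      have "\<exists>h. h \<in> hom ?F' (add_monoid M')
          \<and> (\<forall>x\<in>carrier M'. \<forall>y\<in>carrier N. h (frag_of (x, y)) = c y b \<odot>\<^bsub>M'\<^esub> x)" for b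
        by (rule tensor_contraction[OF mods(1) N, of "\<lambda>y. c y b"]) (use c c_lin in auto)
      then obtain h' where h': "\<And>b. h' b \<in> hom ?F' (add_monoid M')"
          "\<And>b x y. x \<in> carrier M' \<Longrightarrow> y \<in> carrier N \<Longrightarrow> h' b (frag_of (x, y)) = c y b \<odot>\<^bsub>M'\<^esub> x"
        by metis
      have zero: "h' b z = \<zero>\<^bsub>M'\<^esub>" for b
      proof -
        obtain h where h: "h \<in> hom ?F (add_monoid M)"
            "\<And>x y. x \<in> carrier M \<Longrightarrow> y \<in> carrier N \<Longrightarrow> h (frag_of (x, y)) = c y b \<odot>\<^bsub>M\<^esub> x"
            "\<And>z. z \<in> ?K \<Longrightarrow> h z = \<zero>\<^bsub>M\<^esub>"
          by (rule tensor_contraction[OF mods(2) N, of "\<lambda>y. c y b"]) (use c c_lin in auto)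
        have h'_closed: "h' b w \<in> carrier M'" if "Poly_Mapping.keys w \<subseteq> carrier M' \<times> carrier N" for w
          using hom_in_carrier[OF h'(1), of w b] that by simp
        have "h (?g z) = f (h' b z)"
          using z
        proof (induction z rule: free_Abelian_group_induct[consumes 1])
          case 1
          show ?case
            using hom_free_Abelian_group_zero[OF M'.abelian_group_axioms h'(1)]
              hom_free_Abelian_group_zero[OF M.abelian_group_axioms h(1)] by (simp add: f_zero)
        next
          case (2 v w)
          then show ?case
            by (simp add: frag_extend_diff f_diff h'_closed g_closed
                hom_free_Abelian_group_diff[OF M'.abelian_group_axioms h'(1)]
                hom_free_Abelian_group_diff[OF M.abelian_group_axioms h(1)])
        next
          case (3 p)
          then show ?case by (auto simp: h h' f_closed f_smult c)
        qed
        then have "f (h' b z) = f \<zero>\<^bsub>M'\<^esub>" by (simp add: h(3)[OF gz] f_zero)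
        then show ?thesis using inj h'_closed[OF z] by (auto dest: inj_onD)
      qed
      obtain A where A: "finite A" "A \<subseteq> B" "z - (\<Sum>b\<in>A. frag_of (h' b z, b)) \<in> ?K'"
        using tensor_expansion[OF mods(1) N BN c h' z] by blast
      have "(\<Sum>b\<in>A. frag_of (h' b z, b)) \<in> ?K'"
        using A(2) BN by (auto simp: zero intro!: tensor_relators_sum tensor_relators_zero_left mods N)
      from tensor_relators_add[OF mods(1) N A(3) this] show ?thesis by simp
    qed
    have map: "tensor_map R M N f (?K' #>\<^bsub>?F'\<^esub> z) = ?K #>\<^bsub>?F\<^esub> ?g z"
      if z: "Poly_Mapping.keys z \<subseteq> carrier M' \<times> carrier N" for z
    proof -
      have *: "?K #>\<^bsub>?F\<^esub> ?g w = ?K #>\<^bsub>?F\<^esub> ?g z" if "w \<in> ?K' #>\<^bsub>?F'\<^esub> z" for w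
      proof -
        obtain k where k: "k \<in> ?K'" "w = k + z" using \<open>w \<in> _\<close> by (auto simp: r_coset_def)
        have "Poly_Mapping.keys k \<subseteq> carrier M' \<times> carrier N"
          using subgroup.mem_carrier[OF tensor_relators_closed[OF mods(1) N] k(1)] by simp
        then have w: "Poly_Mapping.keys w \<subseteq> carrier M' \<times> carrier N"
          using z keys_add[of k z] k(2) by blast
        show ?thesis
          using gK[OF k(1)] free_Abelian_group_rcoset_eq_iff[OF tensor_relators_closed[OF mods(2) N]
              g_closed[OF w] g_closed[OF z]]
          by (simp add: k(2) frag_extend_add)
      qed
      have "z \<in> ?K' #>\<^bsub>?F'\<^esub> z"
        using tensor_relators_zero[OF mods(1) N] by (auto simp: r_coset_def intro!: bexI[of _ 0])
      then show ?thesis unfolding tensor_map_def by (intro UN_constant_eq ballI) (assumption, rule *)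
    qed
    show ?thesis
    proof (rule inj_onI)
      fix C1 C2
      assume C: "C1 \<in> carrier (tensor_product R M' N)" "C2 \<in> carrier (tensor_product R M' N)"
        and eq: "tensor_map R M N f C1 = tensor_map R M N f C2"
      obtain z1 z2 where z: "Poly_Mapping.keys z1 \<subseteq> carrier M' \<times> carrier N" "C1 = ?K' #>\<^bsub>?F'\<^esub> z1"
          "Poly_Mapping.keys z2 \<subseteq> carrier M' \<times> carrier N" "C2 = ?K' #>\<^bsub>?F'\<^esub> z2"
        using C by (auto simp: tensor_product_def FactGroup_def RCOSETS_def)
      have "?g z1 - ?g z2 \<in> ?K"
        using eq free_Abelian_group_rcoset_eq_iff[OF tensor_relators_closed[OF mods(2) N] g_closed[OF z(1)] g_closed[OF z(3)]]
        by (simp add: z(2,4) map[OF z(1)] map[OF z(3)])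
      then have "z1 - z2 \<in> ?K'"
        by (intro ker keys_diff_subset z) (simp add: frag_extend_diff)
      then show "C1 = C2"
        using free_Abelian_group_rcoset_eq_iff[OF tensor_relators_closed[OF mods(1) N] z(1,3)]
        by (simp add: z(2,4))
    qed
  qed
  with N show ?thesis unfolding flat_module_def by blast
qed


section \<open>Quotients by left ideals as modules\<close>

lemma left_ideal_abelian_subgroup:
  assumes "ring D" "left_ideal L D"
  shows "abelian_subgroup L D"
  using assms by (auto simp: left_ideal_def intro: abelian_subgroupI3 ring.axioms(1))

lemma coset_eq_iff:
  assumes "abelian_subgroup L D" "x \<in> carrier D" "y \<in> carrier D"
  shows "L +>\<^bsub>D\<^esub> x = L +>\<^bsub>D\<^esub> y \<longleftrightarrow> x \<ominus>\<^bsub>D\<^esub> y \<in> L"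
proof -
  interpret abelian_subgroup L D by fact
  have "x \<in> L +>\<^bsub>D\<^esub> y \<longleftrightarrow> x \<ominus>\<^bsub>D\<^esub> y \<in> L"
    using assms(2,3) a_rcos_module[of y x] by (simp add: a_minus_def)
  moreover have "x \<in> L +>\<^bsub>D\<^esub> y \<longleftrightarrow> L +>\<^bsub>D\<^esub> x = L +>\<^bsub>D\<^esub> y"
    using a_repr_independence[of x L y] a_rcos_self[OF assms(2)] assms(3) a_subgroup by auto
  ultimately show ?thesis by simp
qed

context
  fixes D :: "('b, 'd) ring_scheme" and L :: "'b set" and R :: "('a, 'c) ring_scheme" and \<phi> :: "'a \<Rightarrow> 'b"
  assumes D: "ring D" and L: "left_ideal L D" and R: "cring R" and \<phi>: "\<phi> \<in> ring_hom R D"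
begin

interpretation D: ring D by (rule D)
interpretation L: abelian_subgroup L D by (rule left_ideal_abelian_subgroup[OF D L])

lemma left_quotient_carrier:
  "carrier (left_quotient D L \<phi>) = (\<lambda>x. L +>\<^bsub>D\<^esub> x) ` carrier D"
  by (auto simp: left_quotient_def A_RCOSETS_def')

lemma left_quotient_add:
  assumes "x \<in> carrier D" "y \<in> carrier D"
  shows "(L +>\<^bsub>D\<^esub> x) \<oplus>\<^bsub>left_quotient D L \<phi>\<^esub> (L +>\<^bsub>D\<^esub> y) = L +>\<^bsub>D\<^esub> (x \<oplus>\<^bsub>D\<^esub> y)"
  using L.a_rcos_sum[OF assms] by (simp add: left_quotient_def)

lemma left_quotient_zero: "\<zero>\<^bsub>left_quotient D L \<phi>\<^esub> = L +>\<^bsub>D\<^esub> \<zero>\<^bsub>D\<^esub>"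
  using D.a_coset_add_zero[OF L.a_subset] by (simp add: left_quotient_def)

text \<open>Well defined because a left ideal absorbs multiplication by \<open>\<phi> r\<close> on the left.\<close>

lemma left_quotient_smult:
  assumes r: "r \<in> carrier R" and x: "x \<in> carrier D"
  shows "r \<odot>\<^bsub>left_quotient D L \<phi>\<^esub> (L +>\<^bsub>D\<^esub> x) = L +>\<^bsub>D\<^esub> (\<phi> r \<otimes>\<^bsub>D\<^esub> x)"
proof -
  have \<phi>r: "\<phi> r \<in> carrier D" using ring_hom_closed[OF \<phi> r] .
  have *: "L +>\<^bsub>D\<^esub> (\<phi> r \<otimes>\<^bsub>D\<^esub> y) = L +>\<^bsub>D\<^esub> (\<phi> r \<otimes>\<^bsub>D\<^esub> x)" if "y \<in> L +>\<^bsub>D\<^esub> x" for y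
  proof -
    obtain l where l: "l \<in> L" "y = l \<oplus>\<^bsub>D\<^esub> x" using \<open>y \<in> L +>\<^bsub>D\<^esub> x\<close> by (auto simp: a_r_coset_def')
    have lD: "l \<in> carrier D" using l(1) L.a_subset by auto
    have \<phi>l: "\<phi> r \<otimes>\<^bsub>D\<^esub> l \<in> L" using L l(1) \<phi>r by (auto simp: left_ideal_def)
    have "(\<phi> r \<otimes>\<^bsub>D\<^esub> y) \<ominus>\<^bsub>D\<^esub> (\<phi> r \<otimes>\<^bsub>D\<^esub> x) = \<phi> r \<otimes>\<^bsub>D\<^esub> l"
      using lD x \<phi>r by (simp add: l(2) D.r_distr a_minus_def D.a_assoc D.r_neg)
    then show ?thesis
      using \<phi>l lD x \<phi>r by (subst coset_eq_iff[OF L.is_abelian_subgroup]) (auto simp: l(2))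
  qed
  show ?thesis
    by (simp add: left_quotient_def) (intro UN_constant_eq[OF L.a_rcos_self[OF x]] ballI, rule *)
qed

lemma left_quotient_module: "module R (left_quotient D L \<phi>)"
proof -
  interpret R: cring R by (rule R)
  note simps = left_quotient_carrier left_quotient_zero left_quotient_add
  have "abelian_group (left_quotient D L \<phi>)"
  proof (rule abelian_groupI, goal_cases)
    case (6 u)
    then obtain x where x: "x \<in> carrier D" "u = L +>\<^bsub>D\<^esub> x" by (auto simp: simps)
    then show ?case
      by (intro bexI[of _ "L +>\<^bsub>D\<^esub> (\<ominus>\<^bsub>D\<^esub> x)"]) (auto simp: simps D.l_neg)
  qed (auto simp: simps D.a_ac)
  then show ?thesis
  proof (rule moduleI[OF R], goal_cases)
    case (1 a u)
    then show ?case by (auto simp: simps left_quotient_smult ring_hom_closed[OF \<phi>])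
  next
    case (2 a b u)
    then obtain x where "x \<in> carrier D" "u = L +>\<^bsub>D\<^esub> x" by (auto simp: simps)
    with 2 show ?case
      by (simp add: simps left_quotient_smult ring_hom_closed[OF \<phi>] ring_hom_add[OF \<phi>] D.l_distr)
  next
    case (3 a u v)
    then obtain x y where "x \<in> carrier D" "u = L +>\<^bsub>D\<^esub> x" "y \<in> carrier D" "v = L +>\<^bsub>D\<^esub> y"
      by (auto simp: simps)
    with 3 show ?case
      by (simp add: simps left_quotient_smult ring_hom_closed[OF \<phi>] D.r_distr)
  next
    case (4 a b u)
    then obtain x where "x \<in> carrier D" "u = L +>\<^bsub>D\<^esub> x" by (auto simp: simps)
    with 4 show ?case
      by (simp add: simps left_quotient_smult ring_hom_closed[OF \<phi>] ring_hom_mult[OF \<phi>] D.m_assoc)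
  next
    case (5 u)
    then obtain x where "x \<in> carrier D" "u = L +>\<^bsub>D\<^esub> x" by (auto simp: simps)
    then show ?case by (simp add: left_quotient_smult ring_hom_one[OF \<phi>])
  qed
qed

lemma left_quotient_finsum:
  assumes "finite A" "g \<in> A \<rightarrow> carrier D"
  shows "(\<Oplus>\<^bsub>left_quotient D L \<phi>\<^esub>i\<in>A. L +>\<^bsub>D\<^esub> g i) = L +>\<^bsub>D\<^esub> (\<Oplus>\<^bsub>D\<^esub>i\<in>A. g i)"
  using assms
proof (induction A)
  case empty
  interpret M: module R "left_quotient D L \<phi>" by (rule left_quotient_module)
  show ?case by (simp add: left_quotient_zero)
next
  case (insert i A)
  interpret M: module R "left_quotient D L \<phi>" by (rule left_quotient_module)
  have "(\<lambda>i. L +>\<^bsub>D\<^esub> g i) \<in> A \<rightarrow> carrier (left_quotient D L \<phi>)"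
    using insert.prems by (auto simp: left_quotient_carrier)
  moreover have "L +>\<^bsub>D\<^esub> g i \<in> carrier (left_quotient D L \<phi>)"
    using insert.prems by (auto simp: left_quotient_carrier)
  moreover have "g \<in> A \<rightarrow> carrier D" "g i \<in> carrier D" using insert.prems by auto
  ultimately show ?case
    using insert.hyps insert.IH by (simp add: left_quotient_add)
qed

text \<open>
  A normal form modulo \<open>L\<close> is the same thing as a basis of the quotient.  The hypothesis is phrased
  with coefficient families indexed by \<open>\<Delta>\<close> and not by cosets; that \<open>i \<mapsto> L + e\<^sub>i\<close> is injective on
  \<open>\<Delta>\<close> then follows from uniqueness.
\<close>

lemma left_quotient_basis:
  fixes e :: "'i \<Rightarrow> 'b"
  assumes nontrivial: "\<one>\<^bsub>R\<^esub> \<noteq> \<zero>\<^bsub>R\<^esub>"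
    and e: "\<And>i. i \<in> \<Delta> \<Longrightarrow> e i \<in> carrier D"
    and nf: "\<And>x. x \<in> carrier D \<Longrightarrow> \<exists>!a. (\<forall>i. a i \<in> carrier R) \<and> {i. a i \<noteq> \<zero>\<^bsub>R\<^esub>} \<subseteq> \<Delta>
      \<and> finite {i. a i \<noteq> \<zero>\<^bsub>R\<^esub>} \<and> x \<ominus>\<^bsub>D\<^esub> (\<Oplus>\<^bsub>D\<^esub>i\<in>{i. a i \<noteq> \<zero>\<^bsub>R\<^esub>}. \<phi> (a i) \<otimes>\<^bsub>D\<^esub> e i) \<in> L"
  shows "module_basis R (left_quotient D L \<phi>) ((\<lambda>i. L +>\<^bsub>D\<^esub> e i) ` \<Delta>)"
proof -
  let ?M = "left_quotient D L \<phi>"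
  let ?e = "\<lambda>i. L +>\<^bsub>D\<^esub> e i"
  interpret R: cring R by (rule R)
  interpret M: module R ?M by (rule left_quotient_module)
  define supp where "supp = (\<lambda>a :: 'i \<Rightarrow> 'a. {i. a i \<noteq> \<zero>\<^bsub>R\<^esub>})"
  define repr where "repr = (\<lambda>x a. (\<forall>i. a i \<in> carrier R) \<and> supp a \<subseteq> \<Delta> \<and> finite (supp a)
      \<and> x \<ominus>\<^bsub>D\<^esub> (\<Oplus>\<^bsub>D\<^esub>i\<in>supp a. \<phi> (a i) \<otimes>\<^bsub>D\<^esub> e i) \<in> L)"
  have ex1: "\<exists>!a. repr x a" if "x \<in> carrier D" for x
    using nf[OF that] by (simp add: repr_def supp_def)
  have inj: "inj_on ?e \<Delta>"
  proof (rule inj_onI)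
    fix i j assume ij: "i \<in> \<Delta>" "j \<in> \<Delta>" and eq: "?e i = ?e j"
    let ?\<delta> = "\<lambda>k l. if l = k then \<one>\<^bsub>R\<^esub> else \<zero>\<^bsub>R\<^esub>"
    have "repr (e i) (?\<delta> k)" if "k \<in> \<Delta>" "?e i = ?e k" for k
    proof -
      have "supp (?\<delta> k) = {k}" using nontrivial by (auto simp: supp_def)
      moreover have "e i \<ominus>\<^bsub>D\<^esub> e k \<in> L"
        using that e ij(1) by (simp add: coset_eq_iff[OF L.is_abelian_subgroup])
      ultimately show ?thesis
        using that e[OF that(1)] by (simp add: repr_def ring_hom_one[OF \<phi>])
    qed
    from this[OF ij(1) refl] this[OF ij(2) eq] have "?\<delta> i = ?\<delta> j"
      using ex1[OF e[OF ij(1)]] by blast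
    then have "?\<delta> i i = ?\<delta> j i" by (rule fun_cong)
    then show "i = j" using nontrivial by (auto split: if_splits)
  qed
  define lift where "lift = (\<lambda>c i. if i \<in> \<Delta> then c (?e i) else \<zero>\<^bsub>R\<^esub>)"
  define good where "good = (\<lambda>u c. (\<forall>b. c b \<in> carrier R) \<and> (\<forall>b. b \<notin> ?e ` \<Delta> \<longrightarrow> c b = \<zero>\<^bsub>R\<^esub>)
      \<and> finite {b. c b \<noteq> \<zero>\<^bsub>R\<^esub>} \<and> u = (\<Oplus>\<^bsub>?M\<^esub>b\<in>{b. c b \<noteq> \<zero>\<^bsub>R\<^esub>}. c b \<odot>\<^bsub>?M\<^esub> b))"
  have good_iff: "good (L +>\<^bsub>D\<^esub> x) c \<longleftrightarrow> repr x (lift c)"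
    if x: "x \<in> carrier D" and c0: "\<And>b. b \<notin> ?e ` \<Delta> \<Longrightarrow> c b = \<zero>\<^bsub>R\<^esub>" for x c
  proof -
    have supp: "{b. c b \<noteq> \<zero>\<^bsub>R\<^esub>} = ?e ` supp (lift c)"
    proof (intro equalityI subsetI)
      fix b assume b: "b \<in> {b. c b \<noteq> \<zero>\<^bsub>R\<^esub>}"
      then obtain i where "i \<in> \<Delta>" "b = ?e i" using c0[of b] by auto
      with b show "b \<in> ?e ` supp (lift c)" by (auto simp: supp_def lift_def)
    qed (auto simp: supp_def lift_def split: if_splits)
    have sub: "supp (lift c) \<subseteq> \<Delta>" by (auto simp: supp_def lift_def split: if_splits)
    have inj': "inj_on ?e (supp (lift c))" using inj sub by (rule inj_on_subset)
    have fin: "finite {b. c b \<noteq> \<zero>\<^bsub>R\<^esub>} \<longleftrightarrow> finite (supp (lift c))"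
      unfolding supp by (rule finite_image_iff[OF inj'])
    have vals: "(\<forall>b. c b \<in> carrier R) \<longleftrightarrow> (\<forall>i. lift c i \<in> carrier R)"
    proof
      assume a: "\<forall>i. lift c i \<in> carrier R"
      have "c b \<in> carrier R" for b
      proof (cases "b \<in> ?e ` \<Delta>")
        case True
        then obtain i where "i \<in> \<Delta>" "b = ?e i" by auto
        with a[rule_format, of i] show ?thesis by (simp add: lift_def)
      qed (simp add: c0)
      then show "\<forall>b. c b \<in> carrier R" ..
    qed (auto simp: lift_def)
    have "(\<Oplus>\<^bsub>?M\<^esub>b\<in>{b. c b \<noteq> \<zero>\<^bsub>R\<^esub>}. c b \<odot>\<^bsub>?M\<^esub> b)
        = L +>\<^bsub>D\<^esub> (\<Oplus>\<^bsub>D\<^esub>i\<in>supp (lift c). \<phi> (lift c i) \<otimes>\<^bsub>D\<^esub> e i)"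
      if a: "\<forall>i. lift c i \<in> carrier R" and f: "finite (supp (lift c))"
    proof -
      have cl: "lift c i \<in> carrier R" "c (?e i) = lift c i" "e i \<in> carrier D" if "i \<in> supp (lift c)" for i
        using that sub e a by (auto simp: lift_def)
      have mem: "c (?e i) \<odot>\<^bsub>?M\<^esub> ?e i \<in> carrier ?M" if "i \<in> supp (lift c)" for i
        using cl[OF that] by (intro M.smult_closed) (auto simp: left_quotient_carrier)
      have "(\<Oplus>\<^bsub>?M\<^esub>b\<in>{b. c b \<noteq> \<zero>\<^bsub>R\<^esub>}. c b \<odot>\<^bsub>?M\<^esub> b) = (\<Oplus>\<^bsub>?M\<^esub>i\<in>supp (lift c). c (?e i) \<odot>\<^bsub>?M\<^esub> ?e i)"
        unfolding supp by (rule M.M.finsum_reindex[OF _ inj']) (use mem in auto)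
      also have "\<dots> = (\<Oplus>\<^bsub>?M\<^esub>i\<in>supp (lift c). L +>\<^bsub>D\<^esub> (\<phi> (lift c i) \<otimes>\<^bsub>D\<^esub> e i))"
        by (rule M.M.finsum_cong') (use cl ring_hom_closed[OF \<phi>] in \<open>auto simp: left_quotient_smult left_quotient_carrier\<close>)
      also have "\<dots> = L +>\<^bsub>D\<^esub> (\<Oplus>\<^bsub>D\<^esub>i\<in>supp (lift c). \<phi> (lift c i) \<otimes>\<^bsub>D\<^esub> e i)"
        by (rule left_quotient_finsum[OF f]) (use cl ring_hom_closed[OF \<phi>] in auto)
      finally show ?thesis .
    qed
    moreover have "(\<Oplus>\<^bsub>D\<^esub>i\<in>supp (lift c). \<phi> (lift c i) \<otimes>\<^bsub>D\<^esub> e i) \<in> carrier D"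
      if "\<forall>i. lift c i \<in> carrier R"
      using that sub e ring_hom_closed[OF \<phi>] by (intro D.finsum_closed) auto
    ultimately have "L +>\<^bsub>D\<^esub> x = (\<Oplus>\<^bsub>?M\<^esub>b\<in>{b. c b \<noteq> \<zero>\<^bsub>R\<^esub>}. c b \<odot>\<^bsub>?M\<^esub> b)
        \<longleftrightarrow> x \<ominus>\<^bsub>D\<^esub> (\<Oplus>\<^bsub>D\<^esub>i\<in>supp (lift c). \<phi> (lift c i) \<otimes>\<^bsub>D\<^esub> e i) \<in> L"
      if "\<forall>i. lift c i \<in> carrier R" "finite (supp (lift c))"
      using that by (simp add: coset_eq_iff[OF L.is_abelian_subgroup x])
    then show ?thesis
      unfolding good_def repr_def fin vals using c0 sub by blast
  qed
  have lift_onto: "\<exists>c. (\<forall>b. b \<notin> ?e ` \<Delta> \<longrightarrow> c b = \<zero>\<^bsub>R\<^esub>) \<and> lift c = a" if "supp a \<subseteq> \<Delta>" for a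
  proof (intro exI[of _ "\<lambda>b. if b \<in> ?e ` \<Delta> then a (the_inv_into \<Delta> ?e b) else \<zero>\<^bsub>R\<^esub>"] conjI ext)
    fix i
    show "lift (\<lambda>b. if b \<in> ?e ` \<Delta> then a (the_inv_into \<Delta> ?e b) else \<zero>\<^bsub>R\<^esub>) i = a i"
    proof (cases "i \<in> \<Delta>")
      case False
      then have "a i = \<zero>\<^bsub>R\<^esub>" using that unfolding supp_def by blast
      with False show ?thesis by (simp add: lift_def)
    qed (simp add: lift_def the_inv_into_f_f[OF inj])
  qed auto
  have "\<exists>!c. good u c" if u: "u \<in> carrier ?M" for u
  proof -
    obtain x where x: "x \<in> carrier D" "u = L +>\<^bsub>D\<^esub> x" using u by (auto simp: left_quotient_carrier)
    obtain a where a: "repr x a" "\<And>a'. repr x a' \<Longrightarrow> a' = a" using ex1[OF x(1)] by auto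
    have "supp a \<subseteq> \<Delta>" using a(1) by (simp add: repr_def)
    then obtain c where c: "\<And>b. b \<notin> ?e ` \<Delta> \<Longrightarrow> c b = \<zero>\<^bsub>R\<^esub>" "lift c = a"
      using lift_onto by blast
    show ?thesis
    proof (rule ex1I[of _ c])
      show "good u c" using good_iff[OF x(1) c(1)] a(1) c(2) x(2) by simp
    next
      fix c' assume g: "good u c'"
      then have c'0: "\<And>b. b \<notin> ?e ` \<Delta> \<Longrightarrow> c' b = \<zero>\<^bsub>R\<^esub>" by (simp add: good_def)
      have "lift c' = lift c"
        using good_iff[OF x(1) c'0] g x(2) a(2) c(2) by simp
      moreover have "c' (?e i) = lift c' i" "c (?e i) = lift c i" if "i \<in> \<Delta>" for i
        using that by (simp_all add: lift_def)
      ultimately have "c' (?e i) = c (?e i)" if "i \<in> \<Delta>" for i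
        using that by simp
      then show "c' = c"
        using c(1) c'0 by (intro ext) (metis (no_types, lifting) imageE)
    qed
  qed
  moreover have "?e ` \<Delta> \<subseteq> carrier ?M" using e by (auto simp: left_quotient_carrier)
  ultimately show ?thesis unfolding module_basis_def good_def by auto
qed

end


section \<open>Normal forms of differential operators\<close>

lemma pd_zero [simp]: "pd i 0 = 0"
  using pd_add[of i 0 0] by (metis add.right_neutral add_left_cancel)

lemma pd_sum: "pd i (\<Sum>a\<in>S. g a) = (\<Sum>a\<in>S. pd i (g a))"
  by (induction S rule: infinite_finite_induct) (auto simp: pd_add)

lemma pd_pow_zero [simp]:
  fixes \<iota> :: "'n::finite \<Rightarrow> 'v::finite" and f :: "('v, 'k::idom) mps fract"
  shows "pd_pow \<iota> 0 f = f"
proof -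
  interpret comp_fun_commute "\<lambda>i. pd (\<iota> i) ^^ Poly_Mapping.lookup (0 :: 'n \<Rightarrow>\<^sub>0 nat) i :: ('v, 'k) mps fract \<Rightarrow> _"
    by (rule pd_pow_comp_fun_commute)
  have "Finite_Set.fold (\<lambda>i. pd (\<iota> i) ^^ Poly_Mapping.lookup (0 :: 'n \<Rightarrow>\<^sub>0 nat) i) f A = f" if "finite A" for A
    using that
  proof induction
    case (insert i A)
    then show ?case using fold_insert[OF insert.hyps, of f] by (simp add: id_def)
  qed simp
  then show ?thesis by (simp add: pd_pow_def)
qed

lemma pd_pow_single_add:
  fixes \<iota> :: "'n::finite \<Rightarrow> 'v::finite" and f :: "('v, 'k::idom) mps fract"
  shows "pd_pow \<iota> (\<alpha> + Poly_Mapping.single i 1) f = pd (\<iota> i) (pd_pow \<iota> \<alpha> f)"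
proof -
  let ?g = "\<lambda>\<alpha> i. pd (\<iota> i) ^^ Poly_Mapping.lookup \<alpha> i :: ('v, 'k) mps fract \<Rightarrow> _"
  let ?\<beta> = "\<alpha> + Poly_Mapping.single i 1"
  interpret A: comp_fun_commute "?g \<alpha>" by (rule pd_pow_comp_fun_commute)
  interpret B: comp_fun_commute "?g ?\<beta>" by (rule pd_pow_comp_fun_commute)
  have U: "UNIV = insert i (UNIV - {i})" by auto
  have rest: "Finite_Set.fold (?g ?\<beta>) f (UNIV - {i}) = Finite_Set.fold (?g \<alpha>) f (UNIV - {i})"
    by (rule Finite_Set.fold_cong[OF B.comp_fun_commute_axioms[unfolded comp_fun_commute_def']
          A.comp_fun_commute_axioms[unfolded comp_fun_commute_def']])
      (auto simp: lookup_add lookup_single)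
  have "pd_pow \<iota> ?\<beta> f = ?g ?\<beta> i (Finite_Set.fold (?g ?\<beta>) f (UNIV - {i}))"
    unfolding pd_pow_def by (subst U, subst B.fold_insert) auto
  also have "\<dots> = pd (\<iota> i) (?g \<alpha> i (Finite_Set.fold (?g \<alpha>) f (UNIV - {i})))"
    unfolding rest by (simp add: lookup_add)
  also have "?g \<alpha> i (Finite_Set.fold (?g \<alpha>) f (UNIV - {i})) = pd_pow \<iota> \<alpha> f"
    unfolding pd_pow_def by (subst (2) U, subst A.fold_insert) auto
  finally show ?thesis .
qed

lemma exponent_induct [case_names zero add_single]:
  fixes \<gamma> :: "'n::finite \<Rightarrow>\<^sub>0 nat"
  assumes "P 0" "\<And>\<gamma> i. P \<gamma> \<Longrightarrow> P (\<gamma> + Poly_Mapping.single i 1)"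
  shows "P \<gamma>"
proof (induction "\<Sum>i\<in>UNIV. Poly_Mapping.lookup \<gamma> i" arbitrary: \<gamma>)
  case 0
  then have "\<gamma> = 0" by (intro poly_mapping_eqI) simp
  with assms(1) show ?case by simp
next
  case (Suc d)
  then obtain i where i: "Poly_Mapping.lookup \<gamma> i \<noteq> 0"
    by (metis sum.neutral nat.distinct(1))
  let ?\<delta> = "\<gamma> - Poly_Mapping.single i 1"
  have \<gamma>: "?\<delta> + Poly_Mapping.single i 1 = \<gamma>"
    using i by (intro poly_mapping_eqI) (auto simp: lookup_add lookup_minus lookup_single when_def)
  have "(\<Sum>j\<in>UNIV. Poly_Mapping.lookup \<gamma> j)
      = (\<Sum>j\<in>UNIV. Poly_Mapping.lookup ?\<delta> j + (if i = j then 1 else 0))"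
    by (subst (1) \<gamma>[symmetric], rule sum.cong) (auto simp: lookup_add lookup_single when_def simp del: \<gamma>)
  then have "d = (\<Sum>j\<in>UNIV. Poly_Mapping.lookup ?\<delta> j)"
    using Suc(2) by (simp add: sum.distrib)
  from assms(2)[OF Suc(1)[OF this], of i] show ?case by (simp only: \<gamma>)
qed

lemma normal_op_zero [simp]: "normal_op \<iota> 0 = (\<lambda>_. 0)"
  by (simp add: normal_op_def)

lemma normal_op_single: "normal_op \<iota> (Poly_Mapping.single \<alpha> a) f = a * pd_pow \<iota> \<alpha> f"
  by (subst normal_op_superset[of "{\<alpha>}"]) auto

lemma normal_op_add: "normal_op \<iota> (p + q) f = normal_op \<iota> p f + normal_op \<iota> q f"
proof -
  let ?S = "Poly_Mapping.keys p \<union> Poly_Mapping.keys q"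
  have "Poly_Mapping.keys (p + q) \<subseteq> ?S" by (rule keys_add)
  then show ?thesis
    by (simp add: normal_op_superset[of ?S] lookup_add distrib_right sum.distrib)
qed

lemma normal_op_uminus: "normal_op \<iota> (- p) f = - normal_op \<iota> p f"
  using normal_op_add[of \<iota> p "- p" f] by (simp add: add_eq_0_iff)

lemma normal_op_diff: "normal_op \<iota> (p - q) f = normal_op \<iota> p f - normal_op \<iota> q f"
  using normal_op_add[of \<iota> p "- q" f] by (simp add: normal_op_uminus)

lemma normal_op_sum: "normal_op \<iota> (\<Sum>a\<in>S. g a) f = (\<Sum>a\<in>S. normal_op \<iota> (g a) f)"
  by (induction S rule: infinite_finite_induct) (auto simp: normal_op_add)

lemma normal_op_scale:
  "normal_op \<iota> (Poly_Mapping.map ((*) h) p) f = h * normal_op \<iota> p f"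
proof -
  have "Poly_Mapping.keys (Poly_Mapping.map ((*) h) p) \<subseteq> Poly_Mapping.keys p"
    by (auto simp: in_keys_iff map.rep_eq when_def)
  then show ?thesis
    by (subst normal_op_superset[of "Poly_Mapping.keys p"])
      (auto simp: normal_op_def sum_distrib_left map.rep_eq when_def in_keys_iff mult.assoc intro!: sum.cong)
qed

lemma lookup_scale: "Poly_Mapping.lookup (Poly_Mapping.map ((*) h) p) \<alpha> = (h :: 'a::idom) * Poly_Mapping.lookup p \<alpha>"
  by (simp add: map.rep_eq when_def)

text \<open>The coefficients of \<open>\<partial>\<^sub>i \<circ> \<Sum> p\<^sub>\<alpha> \<partial>\<^sup>\<alpha>\<close>, read off from the Leibniz rule.\<close>

definition deriv_coeffs :: "('n::finite \<Rightarrow> 'v::finite) \<Rightarrow> 'n \<Rightarrow> (('n \<Rightarrow>\<^sub>0 nat) \<Rightarrow>\<^sub>0 ('v, 'k::idom) mps fract)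
    \<Rightarrow> (('n \<Rightarrow>\<^sub>0 nat) \<Rightarrow>\<^sub>0 ('v, 'k) mps fract)"
  where "deriv_coeffs \<iota> i p = (\<Sum>\<alpha>\<in>Poly_Mapping.keys p.
    Poly_Mapping.single \<alpha> (pd (\<iota> i) (Poly_Mapping.lookup p \<alpha>))
    + Poly_Mapping.single (\<alpha> + Poly_Mapping.single i 1) (Poly_Mapping.lookup p \<alpha>))"

lemma normal_op_deriv_coeffs: "normal_op \<iota> (deriv_coeffs \<iota> i p) f = pd (\<iota> i) (normal_op \<iota> p f)"
  by (simp add: deriv_coeffs_def normal_op_sum normal_op_add normal_op_single pd_pow_single_add
      normal_op_def[of _ p] pd_sum pd_mult del: One_nat_def)

lemma lookup_deriv_coeffs:
  "Poly_Mapping.lookup (deriv_coeffs \<iota> i p) \<beta> = pd (\<iota> i) (Poly_Mapping.lookup p \<beta>)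
    + (\<Sum>\<alpha>\<in>Poly_Mapping.keys p. Poly_Mapping.lookup p \<alpha> when \<alpha> + Poly_Mapping.single i 1 = \<beta>)"
proof -
  have "(\<Sum>\<alpha>\<in>Poly_Mapping.keys p. pd (\<iota> i) (Poly_Mapping.lookup p \<alpha>) when \<alpha> = \<beta>)
      = pd (\<iota> i) (Poly_Mapping.lookup p \<beta>)"
    by (cases "\<beta> \<in> Poly_Mapping.keys p") (auto simp: when_def in_keys_iff)
  then show ?thesis
    by (simp add: deriv_coeffs_def lookup_sum lookup_add lookup_single sum.distrib)
qed

lemma lookup_deriv_coeffs_shift:
  "Poly_Mapping.lookup (deriv_coeffs \<iota> i p) (\<alpha> + Poly_Mapping.single i 1)
    = pd (\<iota> i) (Poly_Mapping.lookup p (\<alpha> + Poly_Mapping.single i 1)) + Poly_Mapping.lookup p \<alpha>"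
  unfolding lookup_deriv_coeffs
  by (cases "\<alpha> \<in> Poly_Mapping.keys p") (auto simp: when_def in_keys_iff)

lemma keys_deriv_coeffs:
  "Poly_Mapping.keys (deriv_coeffs \<iota> i p)
    \<subseteq> Poly_Mapping.keys p \<union> (\<lambda>\<alpha>. \<alpha> + Poly_Mapping.single i 1) ` Poly_Mapping.keys p"
proof
  fix \<beta> assume "\<beta> \<in> Poly_Mapping.keys (deriv_coeffs \<iota> i p)"
  then have "pd (\<iota> i) (Poly_Mapping.lookup p \<beta>) \<noteq> 0
      \<or> (\<Sum>\<alpha>\<in>Poly_Mapping.keys p. Poly_Mapping.lookup p \<alpha> when \<alpha> + Poly_Mapping.single i 1 = \<beta>) \<noteq> 0"
    by (auto simp: in_keys_iff lookup_deriv_coeffs)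
  then show "\<beta> \<in> Poly_Mapping.keys p \<union> (\<lambda>\<alpha>. \<alpha> + Poly_Mapping.single i 1) ` Poly_Mapping.keys p"
  proof
    assume "pd (\<iota> i) (Poly_Mapping.lookup p \<beta>) \<noteq> 0"
    then show ?thesis by (auto simp: in_keys_iff)
  next
    assume "(\<Sum>\<alpha>\<in>Poly_Mapping.keys p. Poly_Mapping.lookup p \<alpha> when \<alpha> + Poly_Mapping.single i 1 = \<beta>) \<noteq> 0"
    then obtain \<alpha> where "\<alpha> \<in> Poly_Mapping.keys p"
        "(Poly_Mapping.lookup p \<alpha> when \<alpha> + Poly_Mapping.single i 1 = \<beta>) \<noteq> 0"
      by (meson sum.neutral)
    then show ?thesis by (auto simp: when_def split: if_splits)
  qed
qed

locale differential_subring =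
  fixes \<iota> :: "'n::finite \<Rightarrow> 'v::finite" and A :: "('v, 'k::field_char_0) mps fract set"
  assumes inj_\<iota>: "inj \<iota>"
    and subcring_A: "subcring A ring_of_type_algebra"
    and pd_closed: "f \<in> A \<Longrightarrow> pd (\<iota> i) f \<in> A"
begin

lemma A_closed:
  shows A_zero: "0 \<in> A" and A_one: "1 \<in> A"
    and A_add: "f \<in> A \<Longrightarrow> g \<in> A \<Longrightarrow> f + g \<in> A"
    and A_mult: "f \<in> A \<Longrightarrow> g \<in> A \<Longrightarrow> f * g \<in> A"
    and A_uminus: "f \<in> A \<Longrightarrow> - f \<in> A"
proof -
  interpret cring "ring_of_type_algebra :: ('v, 'k) mps fract ring"
    by (rule cring_from_type_algebra)
  show "0 \<in> A" "1 \<in> A" and "f \<in> A \<Longrightarrow> g \<in> A \<Longrightarrow> f + g \<in> A" and "f \<in> A \<Longrightarrow> g \<in> A \<Longrightarrow> f * g \<in> A"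
    using subcringE[OF subcring_A] by (auto simp: ring_of_type_algebra_def)
  assume "f \<in> A"
  then have "\<ominus>\<^bsub>ring_of_type_algebra\<^esub> f \<in> A" by (rule subcringE(5)[OF subcring_A])
  moreover have "\<ominus>\<^bsub>ring_of_type_algebra\<^esub> f = - f"
    by (rule minus_equality) (auto simp: ring_of_type_algebra_def)
  ultimately show "- f \<in> A" by simp
qed

lemma A_diff: "f \<in> A \<Longrightarrow> g \<in> A \<Longrightarrow> f - g \<in> A"
  using A_add[of f "- g"] A_uminus by simp

lemma A_sum: "(\<And>a. a \<in> S \<Longrightarrow> g a \<in> A) \<Longrightarrow> sum g S \<in> A"
  by (induction S rule: infinite_finite_induct) (auto intro: A_zero A_add)

lemma cring_subring_of: "cring (subring_of A)"
proof -
  interpret cring "ring_of_type_algebra :: ('v, 'k) mps fract ring"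
    by (rule cring_from_type_algebra)
  show ?thesis
    unfolding subring_of_def
    using subcring_iff[of A] subcring_A by (auto simp: ring_of_type_algebra_def)
qed

lemma diff_ring_simps [simp]:
  "carrier (diff_ring \<iota> A) = diff_ops \<iota> A"
  "S \<oplus>\<^bsub>diff_ring \<iota> A\<^esub> T = (\<lambda>f. S f + T f)"
  "S \<otimes>\<^bsub>diff_ring \<iota> A\<^esub> T = S \<circ> T"
  "\<zero>\<^bsub>diff_ring \<iota> A\<^esub> = (\<lambda>_. 0)"
  "\<one>\<^bsub>diff_ring \<iota> A\<^esub> = id"
  by (simp_all add: diff_ring_def additive_End_def)

lemma subring_of_simps [simp]:
  "carrier (subring_of A) = A"
  "f \<oplus>\<^bsub>subring_of A\<^esub> g = f + g"
  "f \<otimes>\<^bsub>subring_of A\<^esub> g = f * g"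
  "\<zero>\<^bsub>subring_of A\<^esub> = 0"
  "\<one>\<^bsub>subring_of A\<^esub> = 1"
  by (simp_all add: subring_of_def ring_of_type_algebra_def)

lemma generators_additive:
  "mult_op ` A \<union> range (\<lambda>i. pd (\<iota> i)) \<subseteq> carrier additive_End"
  by (auto simp: additive_End_def Modules.additive_def mult_op_def distrib_left pd_add)

lemma ring_diff_ring: "ring (diff_ring \<iota> A)"
  unfolding diff_ring_def diff_ops_def
  by (rule ring.generate_ring_is_ring[OF ring_additive_End generators_additive])

lemma diff_ops_closed:
  shows diff_ops_mult_op: "a \<in> A \<Longrightarrow> mult_op a \<in> diff_ops \<iota> A"
    and diff_ops_pd: "pd (\<iota> i) \<in> diff_ops \<iota> A"
    and diff_ops_add: "S \<in> diff_ops \<iota> A \<Longrightarrow> T \<in> diff_ops \<iota> A \<Longrightarrow> (\<lambda>f. S f + T f) \<in> diff_ops \<iota> A"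
    and diff_ops_comp: "S \<in> diff_ops \<iota> A \<Longrightarrow> T \<in> diff_ops \<iota> A \<Longrightarrow> S \<circ> T \<in> diff_ops \<iota> A"
proof -
  interpret D: ring "diff_ring \<iota> A" by (rule ring_diff_ring)
  show "a \<in> A \<Longrightarrow> mult_op a \<in> diff_ops \<iota> A" "pd (\<iota> i) \<in> diff_ops \<iota> A"
    unfolding diff_ops_def by (auto intro: generate_ring.incl)
  show "S \<in> diff_ops \<iota> A \<Longrightarrow> T \<in> diff_ops \<iota> A \<Longrightarrow> (\<lambda>f. S f + T f) \<in> diff_ops \<iota> A"
    using D.a_closed[of S T] by simp
  show "S \<in> diff_ops \<iota> A \<Longrightarrow> T \<in> diff_ops \<iota> A \<Longrightarrow> S \<circ> T \<in> diff_ops \<iota> A"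
    using D.m_closed[of S T] by simp
qed

lemma diff_ops_zero: "(\<lambda>_. 0) \<in> diff_ops \<iota> A" and diff_ops_id: "id \<in> diff_ops \<iota> A"
proof -
  interpret D: ring "diff_ring \<iota> A" by (rule ring_diff_ring)
  show "(\<lambda>_. 0) \<in> diff_ops \<iota> A" "id \<in> diff_ops \<iota> A"
    using D.zero_closed D.one_closed by simp_all
qed

lemma diff_ops_uminus: "T \<in> diff_ops \<iota> A \<Longrightarrow> (\<lambda>f. - T f) \<in> diff_ops \<iota> A"
  using diff_ops_comp[OF diff_ops_mult_op[OF A_uminus[OF A_one]], of T]
  by (simp add: mult_op_def comp_def)

lemma diff_ring_uminus:
  assumes "T \<in> diff_ops \<iota> A"
  shows "\<ominus>\<^bsub>diff_ring \<iota> A\<^esub> T = (\<lambda>f. - T f)"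
proof -
  interpret D: ring "diff_ring \<iota> A" by (rule ring_diff_ring)
  show ?thesis by (rule D.minus_equality) (use assms diff_ops_uminus[OF assms] in auto)
qed

lemma diff_ring_minus: "T \<in> diff_ops \<iota> A \<Longrightarrow> S \<ominus>\<^bsub>diff_ring \<iota> A\<^esub> T = (\<lambda>f. S f - T f)"
  by (simp add: a_minus_def diff_ring_uminus)

lemma diff_ring_finsum:
  assumes "finite S" "\<And>a. a \<in> S \<Longrightarrow> g a \<in> diff_ops \<iota> A"
  shows "(\<Oplus>\<^bsub>diff_ring \<iota> A\<^esub>a\<in>S. g a) = (\<lambda>f. \<Sum>a\<in>S. g a f)"
  using assms
proof (induction S)
  case empty
  interpret D: ring "diff_ring \<iota> A" by (rule ring_diff_ring)
  show ?case by simp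
next
  case (insert a S)
  interpret D: ring "diff_ring \<iota> A" by (rule ring_diff_ring)
  have "g a \<in> carrier (diff_ring \<iota> A)" "g \<in> S \<rightarrow> carrier (diff_ring \<iota> A)"
    using insert.prems by auto
  with insert show ?case by simp
qed

lemma mult_op_ring_hom: "mult_op \<in> ring_hom (subring_of A) (diff_ring \<iota> A)"
proof (rule ring_hom_memI)
  show "mult_op a \<in> carrier (diff_ring \<iota> A)" if "a \<in> carrier (subring_of A)" for a
    using that by (simp add: diff_ops_mult_op)
qed (simp_all, simp_all add: mult_op_def fun_eq_iff algebra_simps)

definition coeffs_in :: "(('n \<Rightarrow>\<^sub>0 nat) \<Rightarrow>\<^sub>0 ('v, 'k) mps fract) \<Rightarrow> bool"
  where "coeffs_in p \<longleftrightarrow> (\<forall>\<alpha>. Poly_Mapping.lookup p \<alpha> \<in> A)"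

lemma coeffs_in_zero: "coeffs_in 0"
  by (simp add: coeffs_in_def A_zero)

lemma coeffs_in_add: "coeffs_in p \<Longrightarrow> coeffs_in q \<Longrightarrow> coeffs_in (p + q)"
  by (simp add: coeffs_in_def lookup_add A_add)

lemma coeffs_in_diff: "coeffs_in p \<Longrightarrow> coeffs_in q \<Longrightarrow> coeffs_in (p - q)"
  by (simp add: coeffs_in_def lookup_minus A_diff)

lemma coeffs_in_uminus: "coeffs_in p \<Longrightarrow> coeffs_in (- p)"
  using coeffs_in_diff[OF coeffs_in_zero, of p] by simp

lemma coeffs_in_scale: "h \<in> A \<Longrightarrow> coeffs_in p \<Longrightarrow> coeffs_in (Poly_Mapping.map ((*) h) p)"
  by (simp add: coeffs_in_def lookup_scale A_mult)

lemma coeffs_in_single: "a \<in> A \<Longrightarrow> coeffs_in (Poly_Mapping.single \<alpha> a)"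
  by (simp add: coeffs_in_def lookup_single when_def A_zero)

lemma coeffs_in_deriv_coeffs: "coeffs_in p \<Longrightarrow> coeffs_in (deriv_coeffs \<iota> i p)"
  by (auto simp: coeffs_in_def lookup_deriv_coeffs when_def intro!: A_add A_sum pd_closed A_zero)

lemma pd_pow_in_diff_ops: "pd_pow \<iota> \<alpha> \<in> diff_ops \<iota> A"
proof (induction \<alpha> rule: exponent_induct)
  case zero
  have "pd_pow \<iota> 0 = (id :: ('v, 'k) mps fract \<Rightarrow> _)" by (simp add: fun_eq_iff)
  then show ?case using diff_ops_id by metis
next
  case (add_single \<alpha> i)
  have "pd_pow \<iota> (\<alpha> + Poly_Mapping.single i 1) = pd (\<iota> i) \<circ> pd_pow \<iota> \<alpha>"
    by (rule ext) (simp only: pd_pow_single_add comp_apply)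
  with diff_ops_comp[OF diff_ops_pd add_single] show ?case by metis
qed

lemma normal_op_in_diff_ops:
  assumes "coeffs_in p"
  shows "normal_op \<iota> p \<in> diff_ops \<iota> A"
proof -
  have "(\<lambda>f. \<Sum>\<alpha>\<in>S. Poly_Mapping.lookup p \<alpha> * pd_pow \<iota> \<alpha> f) \<in> diff_ops \<iota> A" if "finite S" for S
    using that
  proof (induction S)
    case (insert \<alpha> S)
    have "mult_op (Poly_Mapping.lookup p \<alpha>) \<circ> pd_pow \<iota> \<alpha> \<in> diff_ops \<iota> A"
      using assms by (intro diff_ops_comp diff_ops_mult_op pd_pow_in_diff_ops) (simp add: coeffs_in_def)
    from diff_ops_add[OF this insert.IH] insert.hyps show ?case
      by (simp add: mult_op_def)
  qed (simp add: diff_ops_zero)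
  from this[OF finite_keys] show ?thesis by (simp add: normal_op_def)
qed

text \<open>
  Normal forms are stable under composition with each generator on the left.  By induction over the
  generated ring they form a left module over it, and \<open>id\<close> has a normal form, so every operator does.
\<close>

lemma diff_ops_normal_form:
  assumes "T \<in> diff_ops \<iota> A"
  obtains p where "coeffs_in p" "T = normal_op \<iota> p"
proof -
  have "\<exists>q. coeffs_in q \<and> T \<circ> normal_op \<iota> p = normal_op \<iota> q" if "coeffs_in p" for p
    using assms that unfolding diff_ops_def
  proof (induction T arbitrary: p rule: generate_ring.induct)
    case one
    then show ?case by (auto simp: additive_End_def)
  next
    case (incl T)
    then consider a where "a \<in> A" "T = mult_op a" | i where "T = pd (\<iota> i)" by auto
    then show ?case
    proof cases
      case 1
      then show ?thesis
        using coeffs_in_scale[OF 1(1) incl(2)]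
        by (intro exI[of _ "Poly_Mapping.map ((*) a) p"]) (auto simp: normal_op_scale mult_op_def)
    next
      case 2
      then show ?thesis
        using coeffs_in_deriv_coeffs[OF incl(2)]
        by (intro exI[of _ "deriv_coeffs \<iota> i p"]) (auto simp: normal_op_deriv_coeffs)
    qed
  next
    case (a_inv T)
    then obtain q where q: "coeffs_in q" "T \<circ> normal_op \<iota> p = normal_op \<iota> q" by blast
    interpret E: ring "additive_End :: (('v, 'k) mps fract \<Rightarrow> _) ring" by (rule ring_additive_End)
    have T: "T \<in> carrier additive_End"
      by (rule E.generate_ring_in_carrier[OF generators_additive a_inv(1)])
    have "\<ominus>\<^bsub>additive_End\<^esub> T = (\<lambda>f. - T f)"
      by (rule E.minus_equality) (use T in \<open>auto simp: additive_End_def Modules.additive_def\<close>)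
    then have "(\<ominus>\<^bsub>additive_End\<^esub> T) \<circ> normal_op \<iota> p = normal_op \<iota> (- q)"
      using fun_cong[OF q(2)] by (auto simp: normal_op_uminus)
    then show ?case using coeffs_in_uminus[OF q(1)] by blast
  next
    case (eng_add S T)
    then obtain q r where "coeffs_in q" "S \<circ> normal_op \<iota> p = normal_op \<iota> q"
        "coeffs_in r" "T \<circ> normal_op \<iota> p = normal_op \<iota> r" by meson
    then show ?case
      by (intro exI[of _ "q + r"])
        (auto simp: coeffs_in_add normal_op_add additive_End_def fun_eq_iff)
  next
    case (eng_mult S T)
    then obtain q where q: "coeffs_in q" "T \<circ> normal_op \<iota> p = normal_op \<iota> q" by meson
    obtain r where r: "coeffs_in r" "S \<circ> normal_op \<iota> q = normal_op \<iota> r"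
      using eng_mult.IH(1)[OF q(1)] by blast
    have "(S \<otimes>\<^bsub>additive_End\<^esub> T) \<circ> normal_op \<iota> p = S \<circ> (T \<circ> normal_op \<iota> p)"
      by (simp add: additive_End_def comp_assoc)
    with q(2) r show ?case by metis
  qed
  from this[OF coeffs_in_single[OF A_one]]
  obtain q where "coeffs_in q" "T \<circ> normal_op \<iota> (Poly_Mapping.single 0 1) = normal_op \<iota> q" by blast
  moreover have "normal_op \<iota> (Poly_Mapping.single 0 1) = (id :: ('v, 'k) mps fract \<Rightarrow> _)"
    by (rule ext) (simp only: normal_op_single pd_pow_zero mult_1_left id_apply)
  ultimately show ?thesis using that by auto
qed

end


section \<open>Leading exponents\<close>

definition leading :: "(('n \<Rightarrow>\<^sub>0 nat) \<Rightarrow> ('n \<Rightarrow>\<^sub>0 nat) \<Rightarrow> bool) \<Rightarrow> (('n \<Rightarrow>\<^sub>0 nat) \<Rightarrow>\<^sub>0 'a::zero) \<Rightarrow> ('n \<Rightarrow>\<^sub>0 nat) \<Rightarrow> bool"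
  where "leading lt p \<alpha> \<longleftrightarrow> \<alpha> \<in> Poly_Mapping.keys p \<and> (\<forall>\<beta>\<in>Poly_Mapping.keys p. lt \<beta> \<alpha> \<or> \<beta> = \<alpha>)"

locale exponent_order =
  fixes lt :: "('n::finite \<Rightarrow>\<^sub>0 nat) \<Rightarrow> ('n \<Rightarrow>\<^sub>0 nat) \<Rightarrow> bool"
  assumes wellorder: "class.wellorder (\<lambda>\<beta> \<gamma>. lt \<beta> \<gamma> \<or> \<beta> = \<gamma>) lt"
    and lt_add: "lt (\<beta> + \<delta>) (\<gamma> + \<delta>) \<longleftrightarrow> lt \<beta> \<gamma>"
begin

sublocale ord: wellorder "\<lambda>\<beta> \<gamma>. lt \<beta> \<gamma> \<or> \<beta> = \<gamma>" lt
  by (rule wellorder)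

text \<open>A negative exponent \<open>\<gamma>\<close> would start the infinite descent \<open>0 > \<gamma> > 2\<gamma> > \<dots>\<close>.\<close>

lemma zero_le: "lt 0 \<gamma> \<or> 0 = \<gamma>"
proof (induction \<gamma> rule: ord.less_induct)
  case (less \<gamma>)
  show ?case
  proof (rule ccontr)
    assume "\<not> ?case"
    then have \<gamma>: "lt \<gamma> 0" "\<gamma> \<noteq> 0" using ord.less_linear[of \<gamma> 0] by auto
    then have "lt (\<gamma> + \<gamma>) \<gamma>" using lt_add[of \<gamma> \<gamma> 0] by simp
    with less[OF this] have "lt 0 \<gamma>" by (metis ord.less_trans)
    with \<open>\<not> ?case\<close> show False by simp
  qed
qed

lemma lt_add_single: "lt \<alpha> (\<alpha> + Poly_Mapping.single i 1)"
proof -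
  have "Poly_Mapping.single i (1::nat) \<noteq> 0"
    by (metis lookup_single_eq lookup_zero one_neq_zero)
  then have "lt 0 (Poly_Mapping.single i 1)" using zero_le by metis
  then show ?thesis using lt_add[of 0 \<alpha> "Poly_Mapping.single i 1"] by (simp add: add.commute)
qed

lemma leading_exists:
  assumes "p \<noteq> 0"
  obtains \<alpha> where "leading lt p \<alpha>"
proof -
  have "\<exists>\<alpha>\<in>S. \<forall>\<beta>\<in>S. lt \<beta> \<alpha> \<or> \<beta> = \<alpha>" if "finite S" "S \<noteq> {}" for S
    using that
  proof (induction rule: finite_ne_induct)
    case (insert x S)
    then obtain \<alpha> where \<alpha>: "\<alpha> \<in> S" "\<And>\<beta>. \<beta> \<in> S \<Longrightarrow> lt \<beta> \<alpha> \<or> \<beta> = \<alpha>" by auto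
    show ?case
    proof (cases "lt \<alpha> x")
      case True
      then show ?thesis using \<alpha>(2) ord.less_trans by (intro bexI[of _ x]) auto
    next
      case False
      then have "lt x \<alpha> \<or> x = \<alpha>" using ord.less_linear[of x \<alpha>] by auto
      then show ?thesis using \<alpha> by (intro bexI[of _ \<alpha>]) auto
    qed
  qed auto
  from this[OF finite_keys, of p] assms that show ?thesis
    by (auto simp: leading_def)
qed

lemma leading_scale:
  fixes p :: "('n \<Rightarrow>\<^sub>0 nat) \<Rightarrow>\<^sub>0 'a::idom"
  assumes "h \<noteq> 0"
  shows "leading lt (Poly_Mapping.map ((*) h) p) \<alpha> \<longleftrightarrow> leading lt p \<alpha>"
proof -
  have "Poly_Mapping.keys (Poly_Mapping.map ((*) h) p) = Poly_Mapping.keys p"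
    using assms by (auto simp: in_keys_iff lookup_scale)
  then show ?thesis by (simp add: leading_def)
qed

text \<open>
  The Leibniz terms \<open>\<partial>\<^sub>i(p\<^sub>\<beta>) \<partial>\<^sup>\<beta>\<close> have \<open>\<beta> \<le> \<alpha> < \<alpha> + e\<^sub>i\<close>, so they cannot disturb the leading term with
  coefficient \<open>p\<^sub>\<alpha>\<close> at the exponent \<open>\<alpha> + e\<^sub>i\<close>.
\<close>

lemma leading_deriv_coeffs:
  assumes "leading lt p \<alpha>"
  shows "leading lt (deriv_coeffs \<iota> i p) (\<alpha> + Poly_Mapping.single i 1)"
    and "Poly_Mapping.lookup (deriv_coeffs \<iota> i p) (\<alpha> + Poly_Mapping.single i 1) = Poly_Mapping.lookup p \<alpha>"
proof -
  let ?e = "Poly_Mapping.single i (1::nat)"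
  have "\<alpha> + ?e \<notin> Poly_Mapping.keys p"
    using assms lt_add_single[of \<alpha> i] ord.less_asym ord.less_irrefl unfolding leading_def by metis
  then show lc: "Poly_Mapping.lookup (deriv_coeffs \<iota> i p) (\<alpha> + ?e) = Poly_Mapping.lookup p \<alpha>"
    by (simp add: lookup_deriv_coeffs_shift in_keys_iff del: One_nat_def)
  have "lt \<beta> (\<alpha> + ?e) \<or> \<beta> = \<alpha> + ?e" if "\<beta> \<in> Poly_Mapping.keys (deriv_coeffs \<iota> i p)" for \<beta>
  proof -
    from that consider "\<beta> \<in> Poly_Mapping.keys p" | \<gamma> where "\<gamma> \<in> Poly_Mapping.keys p" "\<beta> = \<gamma> + ?e"
      using keys_deriv_coeffs[of \<iota> i p] by auto
    then show ?thesis
    proof cases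
      case 1
      then show ?thesis
        using assms lt_add_single[of \<alpha> i] ord.less_trans unfolding leading_def by metis
    next
      case 2
      then show ?thesis using assms lt_add[of \<gamma> ?e \<alpha>] unfolding leading_def by metis
    qed
  qed
  moreover have "\<alpha> + ?e \<in> Poly_Mapping.keys (deriv_coeffs \<iota> i p)"
    using assms lc by (simp add: leading_def in_keys_iff)
  ultimately show "leading lt (deriv_coeffs \<iota> i p) (\<alpha> + ?e)" by (simp add: leading_def)
qed

lemma delta_exp_normal_op:
  fixes p :: "('n \<Rightarrow>\<^sub>0 nat) \<Rightarrow>\<^sub>0 ('v::finite, 'k::field_char_0) mps fract"
  assumes "inj \<iota>" "leading lt p \<alpha>"
  shows "delta_exp \<iota> lt (normal_op \<iota> p) = \<alpha>"
    and "delta_lc \<iota> lt (normal_op \<iota> p) = Poly_Mapping.lookup p \<alpha>"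
proof -
  have "linorder.Max (\<lambda>\<beta> \<gamma>. lt \<beta> \<gamma> \<or> \<beta> = \<gamma>) (Poly_Mapping.keys p) = \<alpha>"
    by (rule linorder.Max_eqI[OF ord.linorder_axioms]) (use assms in \<open>auto simp: leading_def\<close>)
  then show *: "delta_exp \<iota> lt (normal_op \<iota> p) = \<alpha>"
    using assms by (simp add: delta_exp_def op_coeffs_normal_op)
  show "delta_lc \<iota> lt (normal_op \<iota> p) = Poly_Mapping.lookup p \<alpha>"
    using assms by (simp add: delta_lc_def * op_coeffs_normal_op)
qed

end


section \<open>Localization at a prime\<close>

lemma (in cring) finprod_ideals_subset:
  assumes "finite S" "\<And>j. j \<in> S \<Longrightarrow> ideal (C j) R" "i \<in> S"
  shows "finprod (ideals_set R) C S \<subseteq> C i"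
proof -
  interpret M: comm_monoid "ideals_set R" by (rule ideals_set_is_comm_monoid)
  have C: "C \<in> S \<rightarrow> carrier (ideals_set R)" using assms(2) by (auto simp: ideals_set_def)
  have "finprod (ideals_set R) C S
      = finprod (ideals_set R) C (insert i (S - {i}))"
    using assms(3) by (simp add: insert_absorb)
  also have "\<dots> = C i \<otimes>\<^bsub>ideals_set R\<^esub> finprod (ideals_set R) C (S - {i})"
    by (rule M.finprod_insert) (use assms C in auto)
  also have "\<dots> = ideal_prod R (C i) (finprod (ideals_set R) C (S - {i}))"
    by (simp add: ideals_set_def)
  also have "\<dots> \<subseteq> C i"
  proof -
    have "finprod (ideals_set R) C (S - {i}) \<in> carrier (ideals_set R)"
      by (rule M.finprod_closed) (use C in auto)
    then show ?thesis
      using ideal_prod_inter[of "C i"] assms(2,3) by (auto simp: ideals_set_def)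
  qed
  finally show ?thesis .
qed

lemma pd_divide:
  assumes "s \<noteq> 0"
  shows "pd i (f / s) = (s * pd i f - pd i s * f) / (s * s)"
proof -
  have "pd i f = pd i (f / s) * s + f / s * pd i s"
    using pd_mult[of i "f / s" s] assms by simp
  then show ?thesis using assms by (simp add: field_simps)
qed

locale localized_differential_subring = differential_subring \<iota> A
  for \<iota> :: "'n::finite \<Rightarrow> 'v::finite" and A :: "('v, 'k::field_char_0) mps fract set" +
  fixes \<pp> :: "('v, 'k) mps fract set"
  assumes prime: "primeideal \<pp> (subring_of A)"
begin

definition denoms :: "('v, 'k) mps fract set" where "denoms = A - \<pp>"

lemma denoms_props:
  shows denoms_A: "s \<in> denoms \<Longrightarrow> s \<in> A"
    and denoms_nonzero: "s \<in> denoms \<Longrightarrow> s \<noteq> 0"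
    and denoms_one: "1 \<in> denoms"
    and denoms_mult: "s \<in> denoms \<Longrightarrow> t \<in> denoms \<Longrightarrow> s * t \<in> denoms"
proof -
  interpret primeideal \<pp> "subring_of A" by (rule prime)
  have "0 \<in> \<pp>" using additive_subgroup.zero_closed[OF additive_subgroup_axioms] by simp
  then show "s \<in> denoms \<Longrightarrow> s \<in> A" "s \<in> denoms \<Longrightarrow> s \<noteq> 0" by (auto simp: denoms_def)
  show "1 \<in> denoms" using one_imp_carrier I_notcarr A_one by (auto simp: denoms_def)
  show "s * t \<in> denoms" if "s \<in> denoms" "t \<in> denoms"
    using that I_prime[of s t] A_mult by (auto simp: denoms_def)
qed

lemma localize_iff: "f \<in> localize A \<pp> \<longleftrightarrow> (\<exists>a\<in>A. \<exists>s\<in>denoms. f = a / s)"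
  by (auto simp: localize_def denoms_def)

lemma localize_fraction: "a \<in> A \<Longrightarrow> s \<in> denoms \<Longrightarrow> a / s \<in> localize A \<pp>"
  by (auto simp: localize_iff)

lemma subset_localize: "A \<subseteq> localize A \<pp>"
  using localize_fraction[OF _ denoms_one] by auto

lemma subcring_localize: "subcring (localize A \<pp>) ring_of_type_algebra"
proof -
  interpret F: cring "ring_of_type_algebra :: ('v, 'k) mps fract ring"
    by (rule cring_from_type_algebra)
  have add: "f + g \<in> localize A \<pp>" if fg: "f \<in> localize A \<pp>" "g \<in> localize A \<pp>" for f g
  proof -
    obtain a s b t where *: "a \<in> A" "s \<in> denoms" "f = a / s" "b \<in> A" "t \<in> denoms" "g = b / t"
      using fg by (auto simp: localize_iff)
    then have "f + g = (a * t + b * s) / (s * t)"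
      using denoms_nonzero by (simp add: add_frac_eq)
    with * show ?thesis
      by (simp add: localize_fraction A_add A_mult denoms_mult denoms_A)
  qed
  have mult: "f * g \<in> localize A \<pp>" if fg: "f \<in> localize A \<pp>" "g \<in> localize A \<pp>" for f g
  proof -
    obtain a s b t where "a \<in> A" "s \<in> denoms" "f = a / s" "b \<in> A" "t \<in> denoms" "g = b / t"
      using fg by (auto simp: localize_iff)
    then show ?thesis by (auto intro!: localize_fraction A_mult denoms_mult)
  qed
  have one: "1 \<in> localize A \<pp>" using A_one subset_localize by auto
  have minus: "- f \<in> localize A \<pp>" if "f \<in> localize A \<pp>" for f
    using mult[OF that, of "- 1"] A_uminus[OF A_one] subset_localize by auto
  have uminus: "\<ominus>\<^bsub>ring_of_type_algebra\<^esub> f = - f" for f :: "('v, 'k) mps fract"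
    by (rule F.minus_equality) (auto simp: ring_of_type_algebra_def)
  show ?thesis
    by (rule F.subcringI'[OF F.subringI])
      (use add mult one minus in \<open>auto simp: uminus\<close>, auto simp: ring_of_type_algebra_def)
qed

lemma pd_localize:
  assumes "f \<in> localize A \<pp>"
  shows "pd (\<iota> i) f \<in> localize A \<pp>"
proof -
  obtain a s where "a \<in> A" "s \<in> denoms" "f = a / s" using assms by (auto simp: localize_iff)
  then show ?thesis
    by (simp add: pd_divide denoms_nonzero localize_fraction A_diff A_mult denoms_mult pd_closed denoms_A)
qed

sublocale loc: differential_subring \<iota> "localize A \<pp>"
  by (intro differential_subring.intro inj_\<iota> subcring_localize pd_localize)

text \<open>
  The candidate for \<open>S\<^sup>-\<^sup>1 I\<close> is the set of fractions with denominator on the left.  It absorbs the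
  derivations because \<open>\<partial>\<^sub>i \<circ> s\<^sup>-\<^sup>1 P = s\<^sup>-\<^sup>2 (s \<partial>\<^sub>i - \<partial>\<^sub>i s) P\<close>.
\<close>

definition fractions :: "(('v, 'k) mps fract \<Rightarrow> ('v, 'k) mps fract) set
    \<Rightarrow> (('v, 'k) mps fract \<Rightarrow> ('v, 'k) mps fract) set"
  where "fractions I = {\<lambda>f. P f / s |P s. P \<in> I \<and> s \<in> denoms}"

lemma fractionsI: "P \<in> I \<Longrightarrow> s \<in> denoms \<Longrightarrow> (\<And>f. T f = P f / s) \<Longrightarrow> T \<in> fractions I"
  by (auto simp: fractions_def fun_eq_iff)

lemma diff_ops_subset_localize: "diff_ops \<iota> A \<subseteq> diff_ops \<iota> (localize A \<pp>)"
proof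
  fix T assume "T \<in> diff_ops \<iota> A"
  then obtain p where "coeffs_in p" "T = normal_op \<iota> p" by (rule diff_ops_normal_form)
  then show "T \<in> diff_ops \<iota> (localize A \<pp>)"
    by (auto intro!: loc.normal_op_in_diff_ops subsetD[OF subset_localize]
        simp: coeffs_in_def loc.coeffs_in_def)
qed

context
  fixes I :: "(('v, 'k) mps fract \<Rightarrow> ('v, 'k) mps fract) set"
  assumes I: "left_ideal I (diff_ring \<iota> A)"
begin

lemma I_closed:
  shows I_diff_ops: "P \<in> I \<Longrightarrow> P \<in> diff_ops \<iota> A"
    and I_zero: "(\<lambda>_. 0) \<in> I"
    and I_add: "P \<in> I \<Longrightarrow> Q \<in> I \<Longrightarrow> (\<lambda>f. P f + Q f) \<in> I"
    and I_comp: "T \<in> diff_ops \<iota> A \<Longrightarrow> P \<in> I \<Longrightarrow> T \<circ> P \<in> I"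
    and I_scale: "a \<in> A \<Longrightarrow> P \<in> I \<Longrightarrow> (\<lambda>f. a * P f) \<in> I"
proof -
  interpret additive_subgroup I "diff_ring \<iota> A" using I by (simp add: left_ideal_def)
  show "P \<in> I \<Longrightarrow> P \<in> diff_ops \<iota> A" using a_subset by auto
  show "(\<lambda>_. 0) \<in> I" using zero_closed by simp
  show "P \<in> I \<Longrightarrow> Q \<in> I \<Longrightarrow> (\<lambda>f. P f + Q f) \<in> I" using a_closed[of P Q] by simp
  show comp: "T \<in> diff_ops \<iota> A \<Longrightarrow> P \<in> I \<Longrightarrow> T \<circ> P \<in> I" for T P using I by (simp add: left_ideal_def)
  show "(\<lambda>f. a * P f) \<in> I" if "a \<in> A" "P \<in> I"
    using comp[OF diff_ops_mult_op[OF that(1)] that(2)] by (simp add: mult_op_def comp_def)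
qed

lemma fractions_add:
  assumes "S \<in> fractions I" "T \<in> fractions I"
  shows "(\<lambda>f. S f + T f) \<in> fractions I"
proof -
  obtain P s Q t where *: "P \<in> I" "s \<in> denoms" "S = (\<lambda>f. P f / s)" "Q \<in> I" "t \<in> denoms" "T = (\<lambda>f. Q f / t)"
    using assms by (auto simp: fractions_def)
  show ?thesis
  proof (rule fractionsI)
    show "(\<lambda>f. t * P f + s * Q f) \<in> I" using * by (intro I_add I_scale denoms_A)
    show "s * t \<in> denoms" using * by (intro denoms_mult)
    show "S f + T f = (t * P f + s * Q f) / (s * t)" for f
      using * denoms_nonzero by (simp add: add_frac_eq mult.commute)
  qed
qed

lemma fractions_comp:
  assumes "T \<in> diff_ops \<iota> (localize A \<pp>)" "S \<in> fractions I"
  shows "T \<circ> S \<in> fractions I"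
proof -
  have scale: "(\<lambda>f. a * T f) \<in> fractions I" if a: "a \<in> localize A \<pp>" and T: "T \<in> fractions I" for a T
  proof -
    obtain P s where *: "P \<in> I" "s \<in> denoms" "T = (\<lambda>f. P f / s)" using T by (auto simp: fractions_def)
    obtain b t where **: "b \<in> A" "t \<in> denoms" "a = b / t" using a by (auto simp: localize_iff)
    show ?thesis
      using * ** by (intro fractionsI[of "\<lambda>f. b * P f" _ "t * s"]) (auto intro: I_scale denoms_mult)
  qed
  show ?thesis
    using assms unfolding diff_ops_def
  proof (induction T arbitrary: S rule: generate_ring.induct)
    case one
    then show ?case by (simp add: additive_End_def)
  next
    case (incl T)
    then consider a where "a \<in> localize A \<pp>" "T = mult_op a" | i where "T = pd (\<iota> i)" by auto
    then show ?case
    proof cases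
      case 1
      then show ?thesis using scale[OF 1(1) incl(2)] by (simp add: mult_op_def comp_def)
    next
      case 2
      obtain P s where *: "P \<in> I" "s \<in> denoms" "S = (\<lambda>f. P f / s)" using incl(2) by (auto simp: fractions_def)
      show ?thesis
      proof (rule fractionsI)
        show "(\<lambda>f. s * (pd (\<iota> i) \<circ> P) f + (- pd (\<iota> i) s) * P f) \<in> I"
          by (intro I_add I_scale I_comp diff_ops_pd A_uminus pd_closed denoms_A *)
        show "s * s \<in> denoms" using * by (intro denoms_mult)
        show "(T \<circ> S) f = (s * (pd (\<iota> i) \<circ> P) f + (- pd (\<iota> i) s) * P f) / (s * s)" for f
          using pd_divide[OF denoms_nonzero[OF *(2)]] by (simp add: 2 *(3))
      qed
    qed
  next
    case (a_inv T)
    interpret E: ring "additive_End :: (('v, 'k) mps fract \<Rightarrow> _) ring" by (rule ring_additive_End)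
    have T: "T \<in> carrier additive_End"
      by (rule E.generate_ring_in_carrier[OF loc.generators_additive a_inv(1)])
    have "\<ominus>\<^bsub>additive_End\<^esub> T = (\<lambda>f. - T f)"
      by (rule E.minus_equality) (use T in \<open>auto simp: additive_End_def Modules.additive_def\<close>)
    then show ?case
      using scale[OF loc.A_uminus[OF loc.A_one] a_inv(2)[OF a_inv(3)]] by (simp add: comp_def)
  next
    case (eng_add T1 T2)
    from fractions_add[OF eng_add(3)[OF eng_add(5)] eng_add(4)[OF eng_add(5)]]
    show ?case by (simp add: additive_End_def comp_def)
  next
    case (eng_mult T1 T2)
    from eng_mult(3)[OF eng_mult(4)[OF eng_mult(5)]]
    show ?case by (simp add: additive_End_def comp_assoc)
  qed
qed

lemma fractions_diff_ops: "fractions I \<subseteq> diff_ops \<iota> (localize A \<pp>)"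
proof
  fix T assume "T \<in> fractions I"
  then obtain P s where *: "P \<in> I" "s \<in> denoms" "T = (\<lambda>f. P f / s)" by (auto simp: fractions_def)
  have "mult_op (1 / s) \<circ> P \<in> diff_ops \<iota> (localize A \<pp>)"
    using * I_diff_ops diff_ops_subset_localize
    by (intro loc.diff_ops_comp loc.diff_ops_mult_op localize_fraction A_one) auto
  then show "T \<in> diff_ops \<iota> (localize A \<pp>)" by (simp add: *(3) mult_op_def comp_def)
qed

lemma fractions_left_ideal: "left_ideal (fractions I) (diff_ring \<iota> (localize A \<pp>))"
proof -
  interpret D: ring "diff_ring \<iota> (localize A \<pp>)" by (rule loc.ring_diff_ring)
  have minus: "\<ominus>\<^bsub>diff_ring \<iota> (localize A \<pp>)\<^esub> T \<in> fractions I" if "T \<in> fractions I" for T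
  proof -
    obtain P s where *: "P \<in> I" "s \<in> denoms" "T = (\<lambda>f. P f / s)"
      using \<open>T \<in> fractions I\<close> by (auto simp: fractions_def)
    have "(\<lambda>f. - 1 * P f) \<in> I" using * by (intro I_scale A_uminus A_one)
    then have "(\<lambda>f. - T f) \<in> fractions I" using *(2,3) by (auto intro: fractionsI)
    then show ?thesis using that fractions_diff_ops by (simp add: loc.diff_ring_uminus subset_iff)
  qed
  have zero: "(\<lambda>_. 0) \<in> fractions I" using I_zero denoms_one by (intro fractionsI) auto
  have "subgroup (fractions I) (add_monoid (diff_ring \<iota> (localize A \<pp>)))"
  proof (rule subgroup.intro)
    show "inv\<^bsub>add_monoid (diff_ring \<iota> (localize A \<pp>))\<^esub> T \<in> fractions I" if "T \<in> fractions I" for T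
      using minus[OF that] by (simp only: a_inv_def)
  qed (use zero fractions_diff_ops fractions_add in auto)
  then show ?thesis
    using fractions_comp by (auto simp: left_ideal_def intro: additive_subgroup.intro)
qed

lemma left_genideal_fractions: "left_genideal (diff_ring \<iota> (localize A \<pp>)) I = fractions I"
proof
  have "I \<subseteq> fractions I"
    using denoms_one by (auto intro!: fractionsI[of _ _ 1])
  then show "left_genideal (diff_ring \<iota> (localize A \<pp>)) I \<subseteq> fractions I"
    using fractions_left_ideal unfolding left_genideal_def by blast
  show "fractions I \<subseteq> left_genideal (diff_ring \<iota> (localize A \<pp>)) I"
    unfolding left_genideal_def
  proof safe
    fix T K assume T: "T \<in> fractions I" and K: "left_ideal K (diff_ring \<iota> (localize A \<pp>))" "I \<subseteq> K"
    obtain P s where *: "P \<in> I" "s \<in> denoms" "T = (\<lambda>f. P f / s)" using T by (auto simp: fractions_def)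
    have "mult_op (1 / s) \<in> diff_ops \<iota> (localize A \<pp>)"
      using * by (intro loc.diff_ops_mult_op localize_fraction A_one)
    then have "mult_op (1 / s) \<circ> P \<in> K" using K * by (auto simp: left_ideal_def)
    then show "T \<in> K" by (simp add: *(3) mult_op_def comp_def)
  qed
qed

end

end


section \<open>Division and the basis of the localized quotient\<close>

locale ordered_localized_subring = localized_differential_subring \<iota> A \<pp> + exponent_order lt
  for \<iota> :: "'n::finite \<Rightarrow> 'v::finite" and A :: "('v, 'k::field_char_0) mps fract set" and \<pp>
    and lt :: "('n \<Rightarrow>\<^sub>0 nat) \<Rightarrow> ('n \<Rightarrow>\<^sub>0 nat) \<Rightarrow> bool"
begin

lemma normal_op_eq_zero_iff:
  fixes p :: "('n \<Rightarrow>\<^sub>0 nat) \<Rightarrow>\<^sub>0 ('v, 'k) mps fract"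
  shows "normal_op \<iota> p = (\<lambda>_. 0) \<longleftrightarrow> p = 0"
  using inj_normal_op[OF inj_\<iota>, THEN injD, of p 0] by auto

context
  fixes I :: "(('v, 'k) mps fract \<Rightarrow> ('v, 'k) mps fract) set"
  assumes I: "left_ideal I (diff_ring \<iota> A)"
begin

lemma leading_in_delta_Exp:
  assumes "normal_op \<iota> p \<in> I" "leading lt p \<beta>"
  shows "\<beta> \<in> delta_Exp \<iota> lt I"
proof -
  have "p \<noteq> 0" using assms(2) by (auto simp: leading_def)
  then have "normal_op \<iota> p \<in> I - {\<lambda>_. 0}" using assms(1) by (simp add: normal_op_eq_zero_iff)
  then show ?thesis
    unfolding delta_Exp_def using delta_exp_normal_op(1)[OF inj_\<iota> assms(2)] by (metis imageI)
qed

lemma ideal_normal_form: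
  assumes "P \<in> I - {\<lambda>_. 0}"
  obtains p where "coeffs_in p" "P = normal_op \<iota> p" "leading lt p (delta_exp \<iota> lt P)"
    "delta_lc \<iota> lt P = Poly_Mapping.lookup p (delta_exp \<iota> lt P)"
proof -
  have P: "P \<in> diff_ops \<iota> A" using I_diff_ops[OF I] assms by auto
  obtain p where p: "coeffs_in p" "P = normal_op \<iota> p" using diff_ops_normal_form[OF P] by blast
  then have "p \<noteq> 0" using assms normal_op_eq_zero_iff by auto
  then obtain \<beta> where \<beta>: "leading lt p \<beta>" by (rule leading_exists)
  show ?thesis
    by (rule that[OF p]) (use \<beta> delta_exp_normal_op[OF inj_\<iota> \<beta>] p(2) in auto)
qed

lemma lc_ideal_ideal: "ideal (lc_ideal \<iota> lt A \<alpha> I) (subring_of A)"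
proof -
  interpret R: cring "subring_of A" by (rule cring_subring_of)
  have "delta_lc \<iota> lt P \<in> A" if P: "P \<in> I - {\<lambda>_. 0}" for P
  proof -
    obtain p where "coeffs_in p" "delta_lc \<iota> lt P = Poly_Mapping.lookup p (delta_exp \<iota> lt P)"
      using ideal_normal_form[OF P] by blast
    then show ?thesis by (simp add: coeffs_in_def)
  qed
  then show ?thesis
    unfolding lc_ideal_def by (intro R.genideal_ideal) auto
qed

text \<open>
  The witness is the normal form of \<open>\<partial>\<^sup>\<gamma>\<close> composed with the given operator, built up one derivation at
  a time because each of them keeps the leading coefficient.
\<close>

lemma shift_leading:
  assumes "coeffs_in p" "normal_op \<iota> p \<in> I" "leading lt p \<beta>"
  shows "\<exists>q. coeffs_in q \<and> normal_op \<iota> q \<in> I \<and> leading lt q (\<beta> + \<gamma>)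
    \<and> Poly_Mapping.lookup q (\<beta> + \<gamma>) = Poly_Mapping.lookup p \<beta>"
proof (induction \<gamma> rule: exponent_induct)
  case zero
  show ?case using assms by (intro exI[of _ p]) simp
next
  case (add_single \<gamma> i)
  then obtain q where q: "coeffs_in q" "normal_op \<iota> q \<in> I" "leading lt q (\<beta> + \<gamma>)"
    "Poly_Mapping.lookup q (\<beta> + \<gamma>) = Poly_Mapping.lookup p \<beta>" by blast
  have "normal_op \<iota> (deriv_coeffs \<iota> i q) = pd (\<iota> i) \<circ> normal_op \<iota> q"
    by (rule ext) (simp add: normal_op_deriv_coeffs)
  then have "normal_op \<iota> (deriv_coeffs \<iota> i q) \<in> I"
    using I_comp[OF I diff_ops_pd q(2)] by metis
  moreover note leading_deriv_coeffs[OF q(3), of \<iota> i]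
  ultimately show ?case
    using coeffs_in_deriv_coeffs[OF q(1)] q(4)
    by (intro exI[of _ "deriv_coeffs \<iota> i q"]) (simp add: add.assoc)
qed

text \<open>
  An ideal \<open>\<pp>\<close> that does not contain \<open>C(\<alpha>; I)\<close> omits one of its generators.  This provides, at every
  corner \<open>\<alpha>\<close> of the stair and then by shifting at every \<open>\<beta> \<in> Exp(I)\<close>, an element of \<open>I\<close> whose leading
  coefficient becomes a unit at \<open>\<pp>\<close>.
\<close>

lemma unit_leading_coefficient:
  assumes stair: "delta_stair \<iota> lt I E" and C: "\<And>\<alpha>. \<alpha> \<in> E \<Longrightarrow> \<not> lc_ideal \<iota> lt A \<alpha> I \<subseteq> \<pp>"
    and \<beta>: "\<beta> \<in> delta_Exp \<iota> lt I"
  obtains p where "coeffs_in p" "normal_op \<iota> p \<in> I" "leading lt p \<beta>" "Poly_Mapping.lookup p \<beta> \<in> denoms"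
proof -
  obtain \<alpha> \<gamma> where \<alpha>: "\<alpha> \<in> E" "\<beta> = \<alpha> + \<gamma>"
    using stair \<beta> by (auto simp: delta_stair_def)
  interpret P: primeideal \<pp> "subring_of A" by (rule prime)
  let ?gens = "{delta_lc \<iota> lt P |P. P \<in> I - {\<lambda>_. 0} \<and> (\<exists>\<gamma>. \<alpha> = delta_exp \<iota> lt P + \<gamma>)}"
  have "\<not> ?gens \<subseteq> \<pp>"
    using C[OF \<alpha>(1)] P.genideal_minimal[OF P.is_ideal, of ?gens] by (auto simp: lc_ideal_def)
  then obtain P \<delta> where P: "P \<in> I - {\<lambda>_. 0}" "\<alpha> = delta_exp \<iota> lt P + \<delta>" "delta_lc \<iota> lt P \<notin> \<pp>"
    by blast
  obtain p where p: "coeffs_in p" "P = normal_op \<iota> p" "leading lt p (delta_exp \<iota> lt P)"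
    "delta_lc \<iota> lt P = Poly_Mapping.lookup p (delta_exp \<iota> lt P)"
    using ideal_normal_form[OF P(1)] by blast
  have "normal_op \<iota> p \<in> I" using P(1) p(2) by auto
  from shift_leading[OF p(1) this p(3), of "\<delta> + \<gamma>"]
  obtain q where q: "coeffs_in q" "normal_op \<iota> q \<in> I" "leading lt q \<beta>"
    "Poly_Mapping.lookup q \<beta> = delta_lc \<iota> lt P"
    using P(2) \<alpha>(2) p(4) by (auto simp: add.assoc)
  have "Poly_Mapping.lookup q \<beta> \<in> denoms"
    using q(1,4) P(3) unfolding denoms_def coeffs_in_def by (metis DiffI)
  with q that show ?thesis by blast
qed

text \<open>Clearing the denominator of \<open>s\<^sup>-\<^sup>1 P\<close> does not change its leading exponent, so localizing does not enlarge \<open>Exp(I)\<close>.\<close>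

lemma fractions_leading:
  assumes "normal_op \<iota> q \<in> fractions I" "leading lt q \<beta>"
  shows "\<beta> \<in> delta_Exp \<iota> lt I"
proof -
  obtain P s where Ps: "P \<in> I" "s \<in> denoms" "normal_op \<iota> q = (\<lambda>f. P f / s)"
    using assms(1) by (auto simp: fractions_def)
  have s: "s \<noteq> 0" by (rule denoms_nonzero[OF Ps(2)])
  have "normal_op \<iota> (Poly_Mapping.map ((*) s) q) = P"
    using fun_cong[OF Ps(3)] s by (intro ext) (simp add: normal_op_scale)
  then have "normal_op \<iota> (Poly_Mapping.map ((*) s) q) \<in> I" using Ps(1) by simp
  then show ?thesis
    by (rule leading_in_delta_Exp) (simp add: assms(2) leading_scale[OF s])
qed

lemma fractions_closed:
  shows fractions_zero: "(\<lambda>_. 0) \<in> fractions I"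
    and fractions_scale: "a \<in> localize A \<pp> \<Longrightarrow> T \<in> fractions I \<Longrightarrow> (\<lambda>f. a * T f) \<in> fractions I"
    and fractions_diff: "S \<in> fractions I \<Longrightarrow> T \<in> fractions I \<Longrightarrow> (\<lambda>f. S f - T f) \<in> fractions I"
proof -
  show "(\<lambda>_. 0) \<in> fractions I"
    using I_zero[OF I] denoms_one by (auto intro: fractionsI)
  show scale: "(\<lambda>f. a * T f) \<in> fractions I" if "a \<in> localize A \<pp>" "T \<in> fractions I" for a T
    using fractions_comp[OF I loc.diff_ops_mult_op[OF that(1)] that(2)] by (simp add: mult_op_def comp_def)
  show "(\<lambda>f. S f - T f) \<in> fractions I" if "S \<in> fractions I" "T \<in> fractions I"
    using fractions_add[OF I that(1) scale[OF loc.A_uminus[OF loc.A_one] that(2)]] by simp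
qed

text \<open>
  Division with remainder: a leading term at an exponent of the ideal is cancelled against an element
  with unit leading coefficient, any other leading term moves to the remainder.  Both steps lower the
  leading exponent, so the well-ordering makes the process stop.
\<close>

lemma division:
  assumes unit: "\<And>\<beta>. \<beta> \<in> delta_Exp \<iota> lt I \<Longrightarrow>
      \<exists>p. coeffs_in p \<and> normal_op \<iota> p \<in> I \<and> leading lt p \<beta> \<and> Poly_Mapping.lookup p \<beta> \<in> denoms"
    and p: "loc.coeffs_in p"
  shows "\<exists>q. loc.coeffs_in q \<and> Poly_Mapping.keys q \<inter> delta_Exp \<iota> lt I = {}
    \<and> normal_op \<iota> (p - q) \<in> fractions I"
proof -
  let ?rem = "\<lambda>p q. loc.coeffs_in q \<and> Poly_Mapping.keys q \<inter> delta_Exp \<iota> lt I = {}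
    \<and> normal_op \<iota> (p - q) \<in> fractions I"
  have zero: "\<exists>q. ?rem 0 q"
    by (rule exI[of _ 0]) (simp add: loc.coeffs_in_zero fractions_zero)
  have step: "\<exists>q. ?rem p q" if "loc.coeffs_in p" "leading lt p \<mu>" for p \<mu>
    using that
  proof (induction \<mu> arbitrary: p rule: ord.less_induct)
    case (less \<mu>)
    have IH: "\<exists>q. ?rem r q"
      if r: "loc.coeffs_in r" "\<And>\<beta>. \<beta> \<in> Poly_Mapping.keys r \<Longrightarrow> lt \<beta> \<mu>" for r
    proof (cases "r = 0")
      case True
      then show ?thesis using zero by simp
    next
      case False
      then obtain \<nu> where "leading lt r \<nu>" by (rule leading_exists)
      with r less.IH show ?thesis unfolding leading_def by metis
    qed
    show ?case
    proof (cases "\<mu> \<in> delta_Exp \<iota> lt I")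
      case True
      obtain g where g: "coeffs_in g" "normal_op \<iota> g \<in> I" "leading lt g \<mu>" "Poly_Mapping.lookup g \<mu> \<in> denoms"
        using unit[OF True] by blast
      let ?a = "Poly_Mapping.lookup p \<mu> / Poly_Mapping.lookup g \<mu>"
      let ?h = "Poly_Mapping.map ((*) ?a) g"
      have "1 / Poly_Mapping.lookup g \<mu> \<in> localize A \<pp>"
        by (rule localize_fraction[OF A_one g(4)])
      from loc.A_mult[OF _ this, of "Poly_Mapping.lookup p \<mu>"] less.prems(1)
      have a: "?a \<in> localize A \<pp>" by (simp add: loc.coeffs_in_def)
      have "loc.coeffs_in g"
        using g(1) subset_localize unfolding coeffs_in_def loc.coeffs_in_def by blast
      then have h: "loc.coeffs_in ?h" by (rule loc.coeffs_in_scale[OF a])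
      have hI: "normal_op \<iota> ?h \<in> fractions I"
      proof -
        have "normal_op \<iota> g \<in> fractions I"
          using g(2) denoms_one by (auto intro: fractionsI[of _ _ 1])
        from fractions_scale[OF a this] show ?thesis by (simp add: normal_op_scale[abs_def])
      qed
      have "lt \<beta> \<mu>" if "\<beta> \<in> Poly_Mapping.keys (p - ?h)" for \<beta>
      proof -
        have "\<beta> \<in> Poly_Mapping.keys p \<or> \<beta> \<in> Poly_Mapping.keys g"
          using that by (auto simp: in_keys_iff lookup_minus lookup_scale)
        moreover have "\<beta> \<noteq> \<mu>"
          using that denoms_nonzero[OF g(4)] by (auto simp: in_keys_iff lookup_minus lookup_scale)
        ultimately show ?thesis using less.prems(2) g(3) unfolding leading_def by blast
      qed
      then obtain q where q: "?rem (p - ?h) q"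
        using IH[OF loc.coeffs_in_diff[OF less.prems(1) h]] by blast
      have eq: "normal_op \<iota> (p - q) = (\<lambda>f. normal_op \<iota> (p - ?h - q) f + normal_op \<iota> ?h f)"
        by (rule ext) (simp add: normal_op_diff)
      have "normal_op \<iota> (p - ?h - q) \<in> fractions I" using q by (elim conjE)
      then have "normal_op \<iota> (p - q) \<in> fractions I"
        unfolding eq by (rule fractions_add[OF I _ hI])
      with q have "?rem p q" by (intro conjI) (elim conjE, assumption)+
      then show ?thesis ..
    next
      case False
      let ?t = "Poly_Mapping.single \<mu> (Poly_Mapping.lookup p \<mu>)"
      have t: "loc.coeffs_in ?t"
        using less.prems(1) by (intro loc.coeffs_in_single) (simp add: loc.coeffs_in_def)
      have "lt \<beta> \<mu>" if "\<beta> \<in> Poly_Mapping.keys (p - ?t)" for \<beta>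
      proof -
        have "\<beta> \<noteq> \<mu>" using that by (auto simp: in_keys_iff lookup_minus lookup_single)
        with that have "\<beta> \<in> Poly_Mapping.keys p"
          by (auto simp: in_keys_iff lookup_minus lookup_single when_def)
        with \<open>\<beta> \<noteq> \<mu>\<close> show ?thesis using less.prems(2) unfolding leading_def by blast
      qed
      then obtain q where q: "?rem (p - ?t) q"
        using IH[OF loc.coeffs_in_diff[OF less.prems(1) t]] by blast
      have "Poly_Mapping.keys (q + ?t) \<subseteq> insert \<mu> (Poly_Mapping.keys q)"
        using keys_add[of q ?t] by (auto split: if_splits)
      with q False have "?rem p (q + ?t)"
        using loc.coeffs_in_add[OF _ t] by (auto simp: algebra_simps)
      then show ?thesis ..
    qed
  qed
  show ?thesis
  proof (cases "p = 0")
    case True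
    then show ?thesis using zero by simp
  next
    case False
    then obtain \<mu> where "leading lt p \<mu>" by (rule leading_exists)
    from step[OF p this] show ?thesis .
  qed
qed

lemma remainder_unique:
  assumes "normal_op \<iota> (p - q) \<in> fractions I" "normal_op \<iota> (p - q') \<in> fractions I"
    and "Poly_Mapping.keys q \<inter> delta_Exp \<iota> lt I = {}" "Poly_Mapping.keys q' \<inter> delta_Exp \<iota> lt I = {}"
  shows "q = q'"
proof (rule ccontr)
  assume "q \<noteq> q'"
  then have "q' - q \<noteq> 0" by simp
  then obtain \<beta> where \<beta>: "leading lt (q' - q) \<beta>" by (rule leading_exists)
  have "normal_op \<iota> (q' - q) = (\<lambda>f. normal_op \<iota> (p - q) f - normal_op \<iota> (p - q') f)"
    by (rule ext) (simp add: normal_op_diff)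
  then have "normal_op \<iota> (q' - q) \<in> fractions I"
    using fractions_diff[OF assms(1,2)] by simp
  from fractions_leading[OF this \<beta>] have "\<beta> \<in> delta_Exp \<iota> lt I" .
  moreover have "\<beta> \<in> Poly_Mapping.keys q \<union> Poly_Mapping.keys q'"
    using \<beta> keys_diff[of q' q] by (auto simp: leading_def)
  ultimately show False using assms(3,4) by auto
qed

lemma free_localized_quotient:
  assumes unit: "\<And>\<beta>. \<beta> \<in> delta_Exp \<iota> lt I \<Longrightarrow>
      \<exists>p. coeffs_in p \<and> normal_op \<iota> p \<in> I \<and> leading lt p \<beta> \<and> Poly_Mapping.lookup p \<beta> \<in> denoms"
  shows "free_module (subring_of (localize A \<pp>))
    (left_quotient (diff_ring \<iota> (localize A \<pp>)) (fractions I) mult_op)"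
proof -
  let ?A = "localize A \<pp>"
  let ?R = "subring_of ?A"
  let ?D = "diff_ring \<iota> ?A"
  let ?\<Delta> = "- delta_Exp \<iota> lt I"
  note setting = loc.ring_diff_ring fractions_left_ideal[OF I] loc.cring_subring_of loc.mult_op_ring_hom
  have sum: "(\<Oplus>\<^bsub>?D\<^esub>\<alpha>\<in>Poly_Mapping.keys q. mult_op (Poly_Mapping.lookup q \<alpha>) \<otimes>\<^bsub>?D\<^esub> pd_pow \<iota> \<alpha>) = normal_op \<iota> q"
    if "loc.coeffs_in q" for q
  proof -
    have "mult_op (Poly_Mapping.lookup q \<alpha>) \<circ> pd_pow \<iota> \<alpha> \<in> diff_ops \<iota> ?A" for \<alpha>
      using that by (intro loc.diff_ops_comp loc.diff_ops_mult_op loc.pd_pow_in_diff_ops)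
        (simp add: loc.coeffs_in_def)
    then show ?thesis
      by (simp add: loc.diff_ring_finsum) (simp add: normal_op_def mult_op_def)
  qed
  have "module_basis ?R (left_quotient ?D (fractions I) mult_op)
      ((\<lambda>\<alpha>. fractions I +>\<^bsub>?D\<^esub> pd_pow \<iota> \<alpha>) ` ?\<Delta>)"
  proof (rule left_quotient_basis[OF setting])
    fix T assume "T \<in> carrier ?D"
    then have "T \<in> diff_ops \<iota> ?A" by simp
    then obtain p where p: "loc.coeffs_in p" "T = normal_op \<iota> p" by (rule loc.diff_ops_normal_form)
    let ?nf = "\<lambda>a. (\<forall>\<alpha>. a \<alpha> \<in> carrier ?R) \<and> {\<alpha>. a \<alpha> \<noteq> \<zero>\<^bsub>?R\<^esub>} \<subseteq> ?\<Delta> \<and> finite {\<alpha>. a \<alpha> \<noteq> \<zero>\<^bsub>?R\<^esub>}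
      \<and> T \<ominus>\<^bsub>?D\<^esub> (\<Oplus>\<^bsub>?D\<^esub>\<alpha>\<in>{\<alpha>. a \<alpha> \<noteq> \<zero>\<^bsub>?R\<^esub>}. mult_op (a \<alpha>) \<otimes>\<^bsub>?D\<^esub> pd_pow \<iota> \<alpha>) \<in> fractions I"
    have nf_iff: "?nf (Poly_Mapping.lookup q) \<longleftrightarrow> loc.coeffs_in q
        \<and> Poly_Mapping.keys q \<inter> delta_Exp \<iota> lt I = {} \<and> normal_op \<iota> (p - q) \<in> fractions I" for q
    proof (cases "loc.coeffs_in q")
      case True
      have keys: "{\<alpha>. Poly_Mapping.lookup q \<alpha> \<noteq> \<zero>\<^bsub>?R\<^esub>} = Poly_Mapping.keys q"
        by (auto simp: in_keys_iff)
      have "T \<ominus>\<^bsub>?D\<^esub> normal_op \<iota> q = normal_op \<iota> (p - q)"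
        using loc.diff_ring_minus[OF loc.normal_op_in_diff_ops[OF True]] p(2)
        by (simp add: normal_op_diff[abs_def])
      then show ?thesis
        using True unfolding keys sum[OF True] by (auto simp: loc.coeffs_in_def)
    qed (auto simp: loc.coeffs_in_def)
    obtain q where q: "?nf (Poly_Mapping.lookup q)"
      using division[OF unit p(1)] nf_iff by blast
    show "\<exists>!a. ?nf a"
    proof (rule ex1I[of _ "Poly_Mapping.lookup q"])
      fix a assume a: "?nf a"
      then have "finite {\<alpha>. a \<alpha> \<noteq> 0}" by simp
      then have lookup: "Poly_Mapping.lookup (Abs_poly_mapping a) = a" by simp
      have "Abs_poly_mapping a = q"
        using nf_iff[of "Abs_poly_mapping a"] nf_iff[of q] a q remainder_unique[of p]
        unfolding lookup by blast
      then show "a = Poly_Mapping.lookup q" using lookup by simp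
    qed (rule q)
  qed (simp_all add: loc.pd_pow_in_diff_ops)
  with left_quotient_module[OF setting] show ?thesis
    unfolding free_module_def by blast
qed

end

end


theorem theorem29:
  fixes H :: "('v::finite, 'k::field_char_0) mps fract set"
    and \<iota> :: "'n::finite \<Rightarrow> 'v"
    and lt :: "('n \<Rightarrow>\<^sub>0 nat) \<Rightarrow> ('n \<Rightarrow>\<^sub>0 nat) \<Rightarrow> bool"
    and I :: "(('v, 'k) mps fract \<Rightarrow> ('v, 'k) mps fract) set"
    and computable_mem :: "(('v, 'k) mps fract list \<Rightarrow> ('v, 'k) mps fract
      \<Rightarrow> ('v, 'k) mps fract list option) \<Rightarrow> bool"
    and computable_syz :: "(('v, 'k) mps fract list \<Rightarrow> ('v, 'k) mps fract list list) \<Rightarrow> bool"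
    and \<alpha> :: "nat \<Rightarrow> ('n \<Rightarrow>\<^sub>0 nat)"
    and s :: nat
    and J \<PP> H\<^sub>\<PP> :: "('v, 'k) mps fract set"
  assumes "inj \<iota>"
    and "subcring H ring_of_type_algebra"
    and "range kconst \<subseteq> H"
    and "noetherian_ring (subring_of H)"
    and "\<And>i f. f \<in> H \<Longrightarrow> pd (\<iota> i) f \<in> H"
    and "effective computable_mem computable_syz H"
    and "class.wellorder (\<lambda>\<beta> \<gamma>. lt \<beta> \<gamma> \<or> \<beta> = \<gamma>) lt"
    and "\<And>\<beta> \<gamma> \<delta>. lt (\<beta> + \<delta>) (\<gamma> + \<delta>) \<longleftrightarrow> lt \<beta> \<gamma>"
    and "left_ideal I (diff_ring \<iota> H)"
    and "I \<noteq> {\<lambda>_. 0}"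
    and "delta_stair \<iota> lt I (\<alpha> ` {1..s})"
    and "J = (\<Otimes>\<^bsub>ideals_set (subring_of H)\<^esub> i\<in>{1..s}. lc_ideal \<iota> lt H (\<alpha> i) I)"
    and "\<PP> \<in> Spec (subring_of H) - zero_locus (subring_of H) J"
    and "H\<^sub>\<PP> = localize H \<PP>"
    and "D\<^sub>\<PP> = diff_ring \<iota> H\<^sub>\<PP>"
    and "I\<^sub>\<PP> = left_genideal D\<^sub>\<PP> I"
    and "M = left_quotient D\<^sub>\<PP> I\<^sub>\<PP> mult_op"
  shows "free_module (subring_of H\<^sub>\<PP>) M
    \<and> flat_module TYPE('x \<times> 'y) (subring_of H\<^sub>\<PP>) M"
proof -
  interpret differential_subring \<iota> H
    by (intro differential_subring.intro assms(1,2,5))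
  have prime: "primeideal \<PP> (subring_of H)"
    using assms(13) by (simp add: Spec_def)
  interpret ordered_localized_subring \<iota> H \<PP> lt
    by (intro ordered_localized_subring.intro localized_differential_subring.intro
        differential_subring_axioms localized_differential_subring_axioms.intro exponent_order.intro
        prime assms(7,8))
  interpret R: cring "subring_of H" by (rule cring_subring_of)
  have not_below: "\<not> lc_ideal \<iota> lt H a I \<subseteq> \<PP>" if a: "a \<in> \<alpha> ` {1..s}" for a
  proof
    assume sub: "lc_ideal \<iota> lt H a I \<subseteq> \<PP>"
    obtain i where i: "i \<in> {1..s}" "a = \<alpha> i" using a by auto
    have "J \<subseteq> lc_ideal \<iota> lt H (\<alpha> i) I"
      unfolding assms(12)
      by (rule R.finprod_ideals_subset) (use i lc_ideal_ideal[OF assms(9)] in auto)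
    then have "J \<subseteq> \<PP>" using sub i(2) by blast
    then show False using assms(13) by (simp add: zero_locus_def)
  qed
  have "free_module (subring_of H\<^sub>\<PP>) M"
    unfolding assms(14-17) left_genideal_fractions[OF assms(9)]
  proof (rule free_localized_quotient[OF assms(9)])
    fix \<beta> assume "\<beta> \<in> delta_Exp \<iota> lt I"
    then show "\<exists>p. coeffs_in p \<and> normal_op \<iota> p \<in> I \<and> leading lt p \<beta> \<and> Poly_Mapping.lookup p \<beta> \<in> denoms"
      using unit_leading_coefficient[OF assms(9,11) not_below] by metis
  qed
  then show ?thesis using free_module_flat by blast
qed

end
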